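(* Let $d\ge3$. For any moderately varying sequence $(p_j)_{j\in\mathbb N}$ there exists a sparse potential $V\ge0$ on $\mathbb Z^d$ such that $\lambda_j(\mathbf B_V)\sim p_j$, i.e. $\lim_{j\to\infty}\lambda_j(\mathbf B_V)/p_j=1$.
   Context: For a function $u$ on $\mathbb Z^d$ put $Q_0[u]=\sum_{x\in\mathbb Z^d}\sum_{j=1}^d|u(x+1_j)-u(x)|^2$, where $1_j$ is the $j$-th standard basis vector. For $d\ge3$, $\mathcal H^1=\mathcal H^1(\mathbb Z^d)$ is the completion of the set of finitely supported functions on $\mathbb Z^d$ in the metric generated by $Q_0$; it is a Hilbert space of functions on $\mathbb Z^d$. Birman–Schwinger operator: $\mathbf B_V$ is the operator generated in the Hilbert space $\mathcal H^1(\mathbb Z^d)$ by the quadratic form $\mathbf b_V[u]=\sum_{x\in\mathbb Z^d}V(x)|u(x)|^2$ (when this form is bounded on $\mathcal H^1(\mathbb Z^d)$). When it is compact, $\lambda_1(\mathbf B_V)\ge\lambda_2(\mathbf B_V)\ge\dots$ are its positive eigenvalues counted with multiplicities. Green function of the discrete Laplacian: with $\mathbb T^d=(\mathbb R/2\pi\mathbb Z)^d$, $$h_0(x)=(2\pi)^{-d}\int_{\mathbb T^d}\frac{e^{ixz}}{4\sum_{j=1}^d\sin^2(z_j/2)}\,dz,\qquad h_y(x)=h_0(x-y),\ y\in\mathbb Z^d,$$ $\mu>0$ is defined by $\mu^2=h_0(0)$; the functions $h_y$ belong to $\mathcal H^1(\mathbb Z^d)$ and have norm $\mu$ there. Put $\widetilde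 h_y=\mu^{-1}h_y$. A set $Y\subset\mathbb Z^d$ is sparse (strongly sparse) if there exists a compact operator $\mathbf T$ in $\mathcal H^1(\mathbb Z^d)$ such that $\mathbf I-\mathbf T$ has bounded inverse and the functions $e_y=(\mathbf I-\mathbf T)^{-1}\widetilde h_y$, $y\in Y$, form an orthonormal system in $\mathcal H^1(\mathbb Z^d)$. A function $V\ge0$ on $\mathbb Z^d$ is a sparse potential if its support $Y_V=\{x\in\mathbb Z^d:V(x)>0\}$ is sparse. An infinite sequence $(p_j)$ of positive numbers is moderately varying if it is non-increasing, $p_j\to0$, and $p_{j+1}/p_j\to1$. *)

theory Defs
  imports "HOL-Analysis.Analysis" "HOL-Library.Function_Algebras"
begin

text \<open>
  The lattice is the type \<open>int ^ 'd\<close>, of dimension \<open>CARD('d)\<close>.  Functions on it are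
  complex-valued and carry the pointwise additive structure of \<open>Function_Algebras\<close>.
\<close>

type_synonym 'd lfun = "int ^ 'd \<Rightarrow> complex"

definition fscale :: "complex \<Rightarrow> ('a \<Rightarrow> complex) \<Rightarrow> 'a \<Rightarrow> complex" where
  "fscale c u = (\<lambda>x. c * u x)"

global_interpretation fvec: vector_space "fscale :: complex \<Rightarrow> ('a \<Rightarrow> complex) \<Rightarrow> 'a \<Rightarrow> complex"
  by unfold_locales (auto simp: fscale_def fun_eq_iff algebra_simps)


definition Q0 :: "'d::finite lfun \<Rightarrow> real" where
  "Q0 u = (\<Sum>\<^sub>\<infinity>x. \<Sum>j\<in>UNIV. (cmod (u (x + axis j 1) - u x))\<^sup>2)"

text \<open>
  The completion of the finitely supported functions with respect to \<open>Q0\<close>, realised as a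
  space of functions.  If \<open>CARD('d) \<ge> 3\<close>, then by Hardy's inequality every \<open>Q0\<close>-Cauchy
  sequence of finitely supported functions converges pointwise, and two such sequences have
  the same pointwise limit iff they are equivalent; so a point of the completion is
  identified with this limit.  The norm and the inner product of the completion are then
  given by the same formulas as for finitely supported functions, with convergent sums.
\<close>

definition H1 :: "'d::finite lfun set" where
  "H1 = {u. \<exists>\<phi> :: nat \<Rightarrow> 'd lfun.
          (\<forall>n. finite {x. \<phi> n x \<noteq> 0}) \<and>
          (\<forall>e>0. \<exists>N. \<forall>m\<ge>N. \<forall>n\<ge>N. Q0 (\<phi> m - \<phi> n) < e) \<and>
          (\<forall>x. (\<lambda>n. \<phi> n x) \<longlonglongrightarrow> u x)}"

definition H1_inner :: "'d::finite lfun \<Rightarrow> 'd lfun \<Rightarrow> complex" where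
  "H1_inner u v =
     (\<Sum>\<^sub>\<infinity>x. \<Sum>j\<in>UNIV. (u (x + axis j 1) - u x) * cnj (v (x + axis j 1) - v x))"

definition H1_norm :: "'d::finite lfun \<Rightarrow> real" where
  "H1_norm u = sqrt (Q0 u)"


text \<open>Operators in \<open>H1\<close> are maps on all lattice functions of which only the values on
  \<open>H1\<close> matter.\<close>

definition H1_linear :: "('d::finite lfun \<Rightarrow> 'd lfun) \<Rightarrow> bool" where
  "H1_linear T \<longleftrightarrow>
     (\<forall>u\<in>H1. T u \<in> H1) \<and>
     (\<forall>u\<in>H1. \<forall>v\<in>H1. T (u + v) = T u + T v) \<and>
     (\<forall>c. \<forall>u\<in>H1. T (fscale c u) = fscale c (T u))"

definition H1_bounded :: "('d::finite lfun \<Rightarrow> 'd lfun) \<Rightarrow> bool" where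
  "H1_bounded T \<longleftrightarrow>
     H1_linear T \<and> (\<exists>C. \<forall>u\<in>H1. H1_norm (T u) \<le> C * H1_norm u)"

definition H1_compact :: "('d::finite lfun \<Rightarrow> 'd lfun) \<Rightarrow> bool" where
  "H1_compact T \<longleftrightarrow>
     H1_linear T \<and>
     (\<forall>u :: nat \<Rightarrow> 'd lfun.
        (\<forall>n. u n \<in> H1) \<and> (\<exists>C. \<forall>n. H1_norm (u n) \<le> C) \<longrightarrow>
        (\<exists>w\<in>H1. \<exists>r. strict_mono r \<and> (\<lambda>n. H1_norm (T (u (r n)) - w)) \<longlonglongrightarrow> 0))"

definition H1_inverse_of :: "('d::finite lfun \<Rightarrow> 'd lfun) \<Rightarrow> ('d lfun \<Rightarrow> 'd lfun) \<Rightarrow> bool" where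
  "H1_inverse_of A S \<longleftrightarrow> (\<forall>u\<in>H1. A u \<in> H1 \<and> S u \<in> H1 \<and> S (A u) = u \<and> A (S u) = u)"


definition bs_quadratic_form :: "(int ^ 'd \<Rightarrow> real) \<Rightarrow> 'd::finite lfun \<Rightarrow> real" where
  "bs_quadratic_form V u = (\<Sum>\<^sub>\<infinity>x. V x * (cmod (u x))\<^sup>2)"

definition bs_form_bounded :: "(int ^ 'd::finite \<Rightarrow> real) \<Rightarrow> bool" where
  "bs_form_bounded V \<longleftrightarrow>
     (\<exists>C. \<forall>u\<in>H1. (\<lambda>x. V x * (cmod (u x))\<^sup>2) summable_on UNIV \<and>
                  \<bar>bs_quadratic_form V u\<bar> \<le> C * (H1_norm u)\<^sup>2)"

definition bs_sesquilinear_form ::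
    "(int ^ 'd \<Rightarrow> real) \<Rightarrow> 'd::finite lfun \<Rightarrow> 'd lfun \<Rightarrow> complex" where
  "bs_sesquilinear_form V u v = (\<Sum>\<^sub>\<infinity>x. of_real (V x) * u x * cnj (v x))"

text \<open>
  The operator generated by the quadratic form: \<open>birman_schwinger V u\<close> is the vector which
  represents the antilinear functional given by the polarised form.  It is meaningful on
  \<open>H1\<close> when \<open>bs_form_bounded V\<close> holds (Riesz).
\<close>

definition birman_schwinger :: "(int ^ 'd \<Rightarrow> real) \<Rightarrow> 'd::finite lfun \<Rightarrow> 'd lfun" where
  "birman_schwinger V u =
     (THE w. w \<in> H1 \<and> (\<forall>v\<in>H1. H1_inner w v = bs_sesquilinear_form V u v))"

definition H1_eigenspace :: "('d::finite lfun \<Rightarrow> 'd lfun) \<Rightarrow> complex \<Rightarrow> 'd lfun set" where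
  "H1_eigenspace A t = {u\<in>H1. A u = fscale t u}"

text \<open>
  \<open>l 0 \<ge> l 1 \<ge> \<dots>\<close> are all the positive eigenvalues of \<open>A\<close>, each repeated according to its
  multiplicity, and there are infinitely many of them.  Such a sequence is unique.  The two
  finiteness conditions are needed because \<open>card\<close> and \<open>dim\<close> are \<open>0\<close> in the infinite case.
  The numbering starts at \<open>0\<close>.
\<close>

definition positive_eigenvalues :: "('d::finite lfun \<Rightarrow> 'd lfun) \<Rightarrow> (nat \<Rightarrow> real) \<Rightarrow> bool" where
  "positive_eigenvalues A l \<longleftrightarrow>
     decseq l \<and> (\<forall>j. l j > 0) \<and>
     (\<forall>t>0. finite {j. l j = t} \<and>
            (\<exists>b. finite b \<and> H1_eigenspace A (of_real t) \<subseteq> fvec.span b) \<and>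
            card {j. l j = t} = fvec.dim (H1_eigenspace A (of_real t)))"


text \<open>The torus is represented by the cube \<open>[0, 2\<pi>]\<^sup>d\<close>; the integrand is singular only at
  its vertices, a null set.\<close>

definition green0 :: "'d::finite lfun" where
  "green0 x =
     of_real (1 / (2 * pi) ^ CARD('d)) *
     (LINT z : cbox 0 (\<chi> j. 2 * pi) | (lborel :: (real ^ 'd) measure).
        exp (\<i> * of_real (\<Sum>j\<in>UNIV. real_of_int (x $ j) * z $ j)) /
        of_real (4 * (\<Sum>j\<in>UNIV. (sin (z $ j / 2))\<^sup>2)))"

definition green :: "int ^ 'd \<Rightarrow> 'd::finite lfun" where
  "green y = (\<lambda>x. green0 (x - y))"

definition green_mu :: "'d::finite itself \<Rightarrow> real" where
  "green_mu _ = sqrt (Re (green0 (0 :: int ^ 'd)))"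

definition green_normalized :: "int ^ 'd \<Rightarrow> 'd::finite lfun" where
  "green_normalized y = fscale (of_real (1 / green_mu TYPE('d))) (green y)"


definition sparse :: "(int ^ 'd::finite) set \<Rightarrow> bool" where
  "sparse Y \<longleftrightarrow>
     (\<exists>T S. H1_compact T \<and> H1_bounded S \<and> H1_inverse_of (\<lambda>u. u - T u) S \<and>
        (\<forall>y\<in>Y. \<forall>y'\<in>Y. H1_inner (S (green_normalized y)) (S (green_normalized y')) =
                       (if y = y' then 1 else 0)))"

definition sparse_potential :: "(int ^ 'd::finite \<Rightarrow> real) \<Rightarrow> bool" where
  "sparse_potential V \<longleftrightarrow> (\<forall>x. V x \<ge> 0) \<and> sparse {x. V x > 0}"

definition moderately_varying :: "(nat \<Rightarrow> real) \<Rightarrow> bool" where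
  "moderately_varying p \<longleftrightarrow>
     (\<forall>j. p j > 0) \<and> decseq p \<and> p \<longlonglongrightarrow> 0 \<and> (\<lambda>j. p (Suc j) / p j) \<longlonglongrightarrow> 1"

end

theory Submission imports Defs "HOL-Complex_Analysis.Great_Picard" begin

text \<open>
  A point evaluation on \<open>H1\<close> is the inner product with a Green function:
  \<open>\<langle>u, green y\<rangle> = u y\<close>.  Hence, for a potential with values \<open>V (y k) = p k / \<mu>\<^sup>2\<close> on the points of a
  sequence \<open>y\<close> and \<open>0\<close> elsewhere, the Birman--Schwinger operator is \<open>B u = (\<Sum>k. p k \<langle>u, h k\<rangle> h k)\<close>,
  where \<open>h k\<close> is the normalised Green function of \<open>y k\<close>.  If the \<open>h k\<close> were orthonormal, then the
  eigenvalues would be exactly the \<open>p k\<close>.  They never are, but they become nearly orthonormal when the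
  points are far apart, and the proof shows that this is good enough.

  \<^item> Evaluations are bounded and the finitely supported functions are dense, so every element of \<open>H1\<close>
    vanishes at infinity (\<open>H1_vanishes_at_infinity\<close>).  The points can therefore be chosen one after
    the other such that each \<open>h k\<close> has arbitrarily small components along the finitely many vectors
    found before; a Gram--Schmidt step (\<open>orthonormal_extension\<close>) yields an orthonormal sequence \<open>e\<close> with
    \<open>(\<Sum>k. \<parallel>e k - h k\<parallel>) \<le> 1/2\<close> (\<open>nearly_orthonormal_selection\<close>).

  \<^item> The operator \<open>T u = (\<Sum>k. \<langle>u, e k\<rangle> (e k - h k))\<close> is a norm convergent series of operators of rank
    one, and its norm is at most \<open>1/2\<close>.  So it is compact, \<open>I - T\<close> has a bounded inverse, and \<open>(I - T) (e k) = h k\<close>: the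
    set of the points is sparse (\<open>orthonormalising_operator\<close>).

  \<^item> The coefficients of \<open>u\<close> with respect to \<open>h\<close> and to \<open>e\<close>, restricted to the indices from \<open>N\<close> on, differ
    in \<open>\<ell>\<^sup>2\<close> by at most \<open>tail N\<close> times the norm of \<open>u\<close>, where \<open>tail N\<close> is the remainder of the series
    of the deviations.  With the spectral theorem for positive compact operators and the min-max
    principle this gives
    \<open>p (N + j) (1 - tail N)\<^sup>2 \<le> l j \<le> p j (1 + tail j)\<^sup>2\<close>
    for the eigenvalues \<open>l\<close> and all \<open>N\<close>.  Since \<open>p (N + j) / p j\<close> tends to \<open>1\<close> for every fixed \<open>N\<close>, the ratio
    \<open>l j / p j\<close> tends to \<open>1\<close> (\<open>spectral_asymptotics\<close>).

  The properties of the Green function come from the lazy random walk.  Its Fourier symbol is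
  \<open>1 - S / d\<close> with \<open>S z = (\<Sum>j. (sin (z j / 2))\<^sup>2)\<close>, so the geometric series turns \<open>1 / (4 S)\<close> into a sum of
  powers of the symbol and the Green function into the sum of the transition probabilities divided
  by \<open>4 d\<close> (\<open>walk_sums_green0\<close>); dominated convergence requires that \<open>1 / S\<close> is integrable, which is where
  \<open>d \<ge> 3\<close> enters.  The partial sums of this series are finitely supported, their Laplacians telescope, and
  this makes them converge to the Green function in energy (\<open>walk_potential_energy\<close>,
  \<open>green0_reproducing\<close>).
\<close>

section \<open>Complex inner product spaces given by a carrier\<close>

lemma sum_lessThan_diff: "n \<le> m \<Longrightarrow> sum f {..<m} - sum f {..<n} = sum f {n..<m}"
  for f :: "nat \<Rightarrow> 'a::ab_group_add"
  using sum_diff_nat_ivl[of 0 n m f] unfolding atLeast0LessThan by simp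

lemma sum_le_tail:
  fixes g :: "nat \<Rightarrow> real"
  assumes "summable g" "\<And>k. 0 \<le> g k"
  shows "sum g {n..<m} \<le> suminf g - sum g {..<n}"
proof (cases "n \<le> m")
  case True
  show ?thesis
    unfolding sum_lessThan_diff[OF True, of g, symmetric]
    using sum_le_suminf[OF assms(1), of "{..<m}"] assms(2) by auto
next
  case False
  then show ?thesis using sum_le_suminf[OF assms(1), of "{..<n}"] assms(2) by simp
qed

lemma tail_tendsto_0:
  fixes g :: "nat \<Rightarrow> real"
  assumes "summable g"
  shows "(\<lambda>n. suminf g - sum g {..<n}) \<longlonglongrightarrow> 0"
  using tendsto_diff[OF tendsto_const summable_LIMSEQ[OF assms], of "suminf g"] by simp

text \<open>
  The form is only required to be semi-definite.  This allows two applications besides Hilbert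
  spaces: the energy on all functions of finite energy, which vanishes on constants, and the form
  of a positive operator on an invariant subspace.
\<close>

locale inner_space = vector_space scale
  for scale :: "complex \<Rightarrow> 'v::ab_group_add \<Rightarrow> 'v" (infixr \<open>\<odot>\<close> 75) +
  fixes H :: "'v set" and ip :: "'v \<Rightarrow> 'v \<Rightarrow> complex"
  assumes subspace_H: "subspace H"
    and ip_add_left [simp]: "u \<in> H \<Longrightarrow> v \<in> H \<Longrightarrow> w \<in> H \<Longrightarrow> ip (u + v) w = ip u w + ip v w"
    and ip_scale_left [simp]: "u \<in> H \<Longrightarrow> v \<in> H \<Longrightarrow> ip (c \<odot> u) v = c * ip u v"
    and ip_hermitian: "u \<in> H \<Longrightarrow> v \<in> H \<Longrightarrow> ip v u = cnj (ip u v)"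
    and ip_nonneg: "u \<in> H \<Longrightarrow> Re (ip u u) \<ge> 0"
begin

definition nrm :: "'v \<Rightarrow> real" where
  "nrm u = sqrt (Re (ip u u))"

lemma H_closed [simp]:
  shows "0 \<in> H" "u \<in> H \<Longrightarrow> v \<in> H \<Longrightarrow> u + v \<in> H" "u \<in> H \<Longrightarrow> v \<in> H \<Longrightarrow> u - v \<in> H"
    "u \<in> H \<Longrightarrow> c \<odot> u \<in> H"
  using subspace_H by (auto intro: subspace_0 subspace_add subspace_diff subspace_scale)

lemma sum_H [simp]: "(\<And>i. i \<in> I \<Longrightarrow> f i \<in> H) \<Longrightarrow> sum f I \<in> H"
  using subspace_H by (rule subspace_sum)

lemma ip_add_right [simp]:
  "u \<in> H \<Longrightarrow> v \<in> H \<Longrightarrow> w \<in> H \<Longrightarrow> ip w (u + v) = ip w u + ip w v"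
  using ip_hermitian[of "u + v" w] ip_hermitian[of u w] ip_hermitian[of v w] by simp

lemma ip_scale_right [simp]: "u \<in> H \<Longrightarrow> v \<in> H \<Longrightarrow> ip u (c \<odot> v) = cnj c * ip u v"
  using ip_hermitian[of "c \<odot> v" u] ip_hermitian[of v u] by simp

lemma ip_diff_left [simp]: "u \<in> H \<Longrightarrow> v \<in> H \<Longrightarrow> w \<in> H \<Longrightarrow> ip (u - v) w = ip u w - ip v w"
  using ip_add_left[of "u - v" v w] by simp

lemma ip_diff_right [simp]: "u \<in> H \<Longrightarrow> v \<in> H \<Longrightarrow> w \<in> H \<Longrightarrow> ip w (u - v) = ip w u - ip w v"
  using ip_add_right[of "u - v" v w] by simp

lemma ip_zero [simp]: "v \<in> H \<Longrightarrow> ip 0 v = 0" "v \<in> H \<Longrightarrow> ip v 0 = 0"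
  using ip_diff_left[of v v v] ip_diff_right[of v v v] by auto

lemma ip_sum_left:
  "(\<And>i. i \<in> I \<Longrightarrow> f i \<in> H) \<Longrightarrow> v \<in> H \<Longrightarrow> ip (sum f I) v = (\<Sum>i\<in>I. ip (f i) v)"
  by (induction I rule: infinite_finite_induct) auto

lemma ip_sum_right:
  "(\<And>i. i \<in> I \<Longrightarrow> f i \<in> H) \<Longrightarrow> v \<in> H \<Longrightarrow> ip v (sum f I) = (\<Sum>i\<in>I. ip v (f i))"
  by (induction I rule: infinite_finite_induct) auto

lemma ip_self: "u \<in> H \<Longrightarrow> ip u u = of_real ((nrm u)\<^sup>2)"
  using arg_cong[OF ip_hermitian[of u u], of Im] ip_nonneg[of u] by (simp add: nrm_def complex_eq_iff)

lemma nrm_sq: "u \<in> H \<Longrightarrow> (nrm u)\<^sup>2 = Re (ip u u)"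
  by (simp add: ip_self)

lemma nrm_nonneg [simp]: "u \<in> H \<Longrightarrow> 0 \<le> nrm u"
  by (simp add: nrm_def ip_nonneg)

lemma nrm_zero [simp]: "nrm 0 = 0"
  by (simp add: nrm_def)

lemma nrm_scale [simp]:
  assumes u: "u \<in> H"
  shows "nrm (c \<odot> u) = cmod c * nrm u"
proof -
  have "ip (c \<odot> u) (c \<odot> u) = (c * cnj c) * ip u u" using u by simp
  also have "\<dots> = of_real ((cmod c * nrm u)\<^sup>2)"
    unfolding complex_norm_square[symmetric] ip_self[OF u] of_real_mult[symmetric] power_mult_distrib ..
  finally show ?thesis using u unfolding nrm_def[of "c \<odot> u"] by simp
qed

lemma nrm_add_sq:
  assumes "u \<in> H" "v \<in> H"
  shows "(nrm (u + v))\<^sup>2 = (nrm u)\<^sup>2 + 2 * Re (ip u v) + (nrm v)\<^sup>2"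
  using assms ip_hermitian[of u v] by (simp add: nrm_sq)

lemma nrm_diff_sq:
  assumes "u \<in> H" "v \<in> H"
  shows "(nrm (u - v))\<^sup>2 = (nrm u)\<^sup>2 - 2 * Re (ip u v) + (nrm v)\<^sup>2"
  using assms ip_hermitian[of u v] by (simp add: nrm_sq)

text \<open>
  The squared norm of \<open>u - s \<langle>u, v\<rangle> v\<close> is a quadratic polynomial in the real number \<open>s\<close>.  It is evaluated at
  its minimum, or, in the degenerate case \<open>nrm v = 0\<close> where it is linear, so far out that it would be
  negative.
\<close>

lemma Cauchy_Schwarz:
  assumes u: "u \<in> H" and v: "v \<in> H"
  shows "cmod (ip u v) \<le> nrm u * nrm v"
proof -
  let ?c = "ip u v"
  have expand: "0 \<le> (nrm u)\<^sup>2 - 2 * s * (cmod ?c)\<^sup>2 + s\<^sup>2 * (cmod ?c)\<^sup>2 * (nrm v)\<^sup>2" for s :: real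
  proof -
    have "0 \<le> (nrm (u - (of_real s * ?c) \<odot> v))\<^sup>2" by simp
    also have "\<dots> = (nrm u)\<^sup>2 - 2 * Re (cnj (of_real s * ?c) * ?c) + (cmod (of_real s * ?c) * nrm v)\<^sup>2"
      using u v by (simp add: nrm_diff_sq)
    also have "Re (cnj (of_real s * ?c) * ?c) = s * (cmod ?c)\<^sup>2"
      unfolding cmod_power2 by (simp add: power2_eq_square algebra_simps)
    also have "(cmod (of_real s * ?c) * nrm v)\<^sup>2 = s\<^sup>2 * (cmod ?c)\<^sup>2 * (nrm v)\<^sup>2"
      by (simp add: norm_mult power_mult_distrib)
    finally show ?thesis by simp
  qed
  have "(cmod ?c)\<^sup>2 \<le> (nrm u)\<^sup>2 * (nrm v)\<^sup>2"
  proof (cases "nrm v = 0")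
    case False
    then have pos: "0 < (nrm v)\<^sup>2" by simp
    have "(cmod ?c)\<^sup>2 / (nrm v)\<^sup>2 \<le> (nrm u)\<^sup>2"
    proof -
      have *: "0 \<le> A - 2 * (1 / N) * B + (1 / N)\<^sup>2 * B * N \<Longrightarrow> N > 0 \<Longrightarrow> B / N \<le> A"
        for A B N :: real by (simp add: power2_eq_square)
      show ?thesis by (rule *[OF expand pos])
    qed
    with pos show ?thesis by (simp add: divide_le_eq)
  next
    case True
    have "cmod ?c = 0"
    proof (rule ccontr)
      assume "cmod ?c \<noteq> 0"
      moreover have *: "0 \<le> A - 2 * ((A + 1) / (2 * B)) * B + C * B * 0\<^sup>2 \<Longrightarrow> B = 0"
        for A B C :: real by (cases "B = 0") simp_all
      ultimately show False
        using *[OF expand[of "((nrm u)\<^sup>2 + 1) / (2 * (cmod ?c)\<^sup>2)", unfolded True]] by simp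
    qed
    then show ?thesis by simp
  qed
  then show ?thesis using u v
    by - (rule power2_le_imp_le, simp_all add: power_mult_distrib)
qed

lemma nrm_triangle: 
  assumes "u \<in> H" "v \<in> H" 
  shows "nrm (u + v) \<le> nrm u + nrm v"
proof (rule power2_le_imp_le)
  have "Re (ip u v) \<le> nrm u * nrm v"
    using Cauchy_Schwarz[OF assms] complex_Re_le_cmod order_trans by blast
  then show "(nrm (u + v))\<^sup>2 \<le> (nrm u + nrm v)\<^sup>2"
    using assms by (simp add: nrm_add_sq power2_sum)
qed (use assms in simp)

lemma nrm_minus_commute: "u \<in> H \<Longrightarrow> v \<in> H \<Longrightarrow> nrm (u - v) = nrm (v - u)"
  using nrm_diff_sq[of u v] nrm_diff_sq[of v u] ip_hermitian[of u v]
  by - (rule power2_eq_imp_eq, simp_all)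

lemma nrm_triangle_diff:
  assumes "u \<in> H" "v \<in> H" "w \<in> H"
  shows "nrm (u - w) \<le> nrm (u - v) + nrm (v - w)"
  using nrm_triangle[of "u - v" "v - w"] assms by simp

lemma nrm_diff_le: "u \<in> H \<Longrightarrow> v \<in> H \<Longrightarrow> nrm (u - v) \<le> nrm u + nrm v"
  using nrm_triangle_diff[of u 0 v] nrm_minus_commute[of 0 v] by simp

lemma nrm_le_diff: "u \<in> H \<Longrightarrow> v \<in> H \<Longrightarrow> nrm u \<le> nrm (u - v) + nrm v"
  using nrm_triangle_diff[of u v 0] by simp

lemma nrm_sum_le:
  "(\<And>i. i \<in> I \<Longrightarrow> f i \<in> H) \<Longrightarrow> nrm (sum f I) \<le> (\<Sum>i\<in>I. nrm (f i))"
proof (induction I rule: infinite_finite_induct)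
  case (insert x F)
  then have "nrm (f x + sum f F) \<le> nrm (f x) + nrm (sum f F)" by (intro nrm_triangle) auto
  with insert show ?case by simp
qed auto

definition tends :: "(nat \<Rightarrow> 'v) \<Rightarrow> 'v \<Rightarrow> bool" where
  "tends f w \<longleftrightarrow> (\<lambda>n. nrm (f n - w)) \<longlonglongrightarrow> 0"

lemma tends_ip:
  assumes f: "\<And>n. f n \<in> H" and w: "w \<in> H" and v: "v \<in> H" and t: "tends f w"
  shows "(\<lambda>n. ip (f n) v) \<longlonglongrightarrow> ip w v"
proof (rule LIM_zero_cancel, rule Lim_null_comparison)
  show "\<forall>\<^sub>F n in sequentially. norm (ip (f n) v - ip w v) \<le> nrm (f n - w) * nrm v"
    using Cauchy_Schwarz[of "f n - w" v for n] f w v by simp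
  show "(\<lambda>n. nrm (f n - w) * nrm v) \<longlonglongrightarrow> 0"
    using t unfolding tends_def by (rule tendsto_mult_left_zero)
qed

lemma tends_nrm:
  assumes f: "\<And>n. f n \<in> H" and w: "w \<in> H" and t: "tends f w"
  shows "(\<lambda>n. nrm (f n)) \<longlonglongrightarrow> nrm w"
proof (rule LIM_zero_cancel, rule Lim_null_comparison)
  have "\<bar>nrm (f n) - nrm w\<bar> \<le> nrm (f n - w)" for n
    using nrm_le_diff[of "f n" w] nrm_le_diff[of w "f n"] nrm_minus_commute[of w "f n"] f[of n] w
    by auto
  then show "\<forall>\<^sub>F n in sequentially. norm (nrm (f n) - nrm w) \<le> nrm (f n - w)" by simp
qed (use t in \<open>simp add: tends_def\<close>)

lemma tends_zero_comparison:
  assumes "\<And>n. f n \<in> H" "w \<in> H" "\<And>n. nrm (f n - w) \<le> g n" "g \<longlonglongrightarrow> 0"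
  shows "tends f w"
  unfolding tends_def
  by (rule Lim_null_comparison[of _ g]) (use assms in auto)

lemma tends_add:
  assumes "\<And>n. f n \<in> H" "\<And>n. g n \<in> H" "u \<in> H" "v \<in> H" "tends f u" "tends g v"
  shows "tends (\<lambda>n. f n + g n) (u + v)"
proof (rule tends_zero_comparison)
  show "nrm (f n + g n - (u + v)) \<le> nrm (f n - u) + nrm (g n - v)" for n
    using nrm_triangle[of "f n - u" "g n - v"] assms by (simp add: algebra_simps)
  show "(\<lambda>n. nrm (f n - u) + nrm (g n - v)) \<longlonglongrightarrow> 0"
    using assms(5,6) unfolding tends_def by (rule tendsto_add_zero)
qed (use assms in auto)

lemma tends_scale:
  assumes "\<And>n. f n \<in> H" "u \<in> H" "tends f u"
  shows "tends (\<lambda>n. c \<odot> f n) (c \<odot> u)"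
proof (rule tends_zero_comparison)
  show "nrm (c \<odot> f n - c \<odot> u) \<le> cmod c * nrm (f n - u)" for n
    using nrm_scale[of "f n - u" c] assms by (simp add: scale_right_diff_distrib)
  show "(\<lambda>n. cmod c * nrm (f n - u)) \<longlonglongrightarrow> 0"
    using assms(3) unfolding tends_def by (rule tendsto_mult_right_zero)
qed (use assms in auto)

definition linear_map :: "('v \<Rightarrow> 'v) \<Rightarrow> bool" where
  "linear_map A \<longleftrightarrow> (\<forall>u\<in>H. A u \<in> H) \<and> (\<forall>u\<in>H. \<forall>v\<in>H. A (u + v) = A u + A v) \<and>
     (\<forall>c. \<forall>u\<in>H. A (c \<odot> u) = c \<odot> A u)"

definition compact_map :: "('v \<Rightarrow> 'v) \<Rightarrow> bool" where
  "compact_map A \<longleftrightarrow> linear_map A \<and>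
     (\<forall>u :: nat \<Rightarrow> 'v. (\<forall>n. u n \<in> H) \<and> (\<exists>C. \<forall>n. nrm (u n) \<le> C) \<longrightarrow>
        (\<exists>w\<in>H. \<exists>r :: nat \<Rightarrow> nat. strict_mono r \<and> tends (\<lambda>n. A (u (r n))) w))"

lemma linear_mapD:
  assumes "linear_map A"
  shows "u \<in> H \<Longrightarrow> A u \<in> H" "u \<in> H \<Longrightarrow> v \<in> H \<Longrightarrow> A (u + v) = A u + A v"
    "u \<in> H \<Longrightarrow> A (c \<odot> u) = c \<odot> A u"
    "u \<in> H \<Longrightarrow> v \<in> H \<Longrightarrow> A (u - v) = A u - A v"
proof -
  show *: "u \<in> H \<Longrightarrow> A u \<in> H" "u \<in> H \<Longrightarrow> v \<in> H \<Longrightarrow> A (u + v) = A u + A v"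
    "u \<in> H \<Longrightarrow> A (c \<odot> u) = c \<odot> A u" for u v c
    using assms by (auto simp: linear_map_def)
  show "u \<in> H \<Longrightarrow> v \<in> H \<Longrightarrow> A (u - v) = A u - A v"
    using *(2)[of "u - v" v] by simp
qed

lemma linear_map_sum:
  assumes A: "linear_map A" and f: "\<And>i. i \<in> I \<Longrightarrow> f i \<in> H"
  shows "A (sum f I) = (\<Sum>i\<in>I. A (f i))"
proof -
  have "A 0 = 0" using linear_mapD(4)[OF A, of 0 0] by simp
  then show ?thesis using f
    by (induction I rule: infinite_finite_induct) (auto simp: linear_mapD[OF A])
qed

end

locale hilbert = inner_space scale H ip
  for scale :: "complex \<Rightarrow> 'v::ab_group_add \<Rightarrow> 'v" (infixr \<open>\<odot>\<close> 75) and H ip +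
  assumes definite: "u \<in> H \<Longrightarrow> ip u u = 0 \<Longrightarrow> u = 0"
    and complete: "(\<And>n. f n \<in> H) \<Longrightarrow>
      (\<And>e. e > 0 \<Longrightarrow> \<exists>N. \<forall>m\<ge>N. \<forall>n\<ge>N. nrm (f m - f n) < e) \<Longrightarrow> \<exists>w\<in>H. tends f w"
begin

lemma nrm_eq_0: "u \<in> H \<Longrightarrow> nrm u = 0 \<Longrightarrow> u = 0"
  using definite[of u] ip_self[of u] by simp

lemma tends_unique:
  assumes "\<And>n. f n \<in> H" "u \<in> H" "v \<in> H" "tends f u" "tends f v"
  shows "u = v"
proof -
  have "nrm (u - v) \<le> nrm (f n - u) + nrm (f n - v)" for n
    using nrm_triangle_diff[of u "f n" v] nrm_minus_commute[of u "f n"] assms by simp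
  moreover have "(\<lambda>n. nrm (f n - u) + nrm (f n - v)) \<longlonglongrightarrow> 0"
    using assms(4,5) unfolding tends_def by (rule tendsto_add_zero)
  ultimately have "nrm (u - v) \<le> 0"
    by (intro LIMSEQ_le_const) auto
  then have "nrm (u - v) = 0" using assms by (simp add: order_antisym)
  then show ?thesis using nrm_eq_0[of "u - v"] assms by simp
qed

lemma complete_tail:
  assumes f: "\<And>n. f n \<in> H" and g: "g \<longlonglongrightarrow> 0"
    and le: "\<And>m n. n \<le> m \<Longrightarrow> nrm (f m - f n) \<le> g n"
  shows "\<exists>w\<in>H. tends f w"
proof (rule complete[OF f])
  fix e :: real assume "e > 0"
  then obtain N where N: "\<And>n. n \<ge> N \<Longrightarrow> \<bar>g n\<bar> < e"
    using LIMSEQ_D[OF g \<open>e > 0\<close>] by auto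
  have less: "nrm (f m - f n) < e" if "m \<ge> n" "n \<ge> N" for m n
    using le[of n m] N[of n] that by linarith
  have "nrm (f m - f n) < e" if "m \<ge> N" "n \<ge> N" for m n
    using less[of n m] less[of m n] that nrm_minus_commute[OF f f, of m n]
    by linarith
  then show "\<exists>N. \<forall>m\<ge>N. \<forall>n\<ge>N. nrm (f m - f n) < e" by blast
qed

lemma absolutely_convergent:
  assumes f: "\<And>k. f k \<in> H" and le: "\<And>k. nrm (f k) \<le> g k" and g: "summable g"
  shows "\<exists>w\<in>H. tends (\<lambda>n. sum f {..<n}) w"
proof (rule complete_tail)
  have g0: "0 \<le> g k" for k using le[of k] nrm_nonneg[OF f[of k]] by linarith
  show "(\<lambda>n. suminf g - sum g {..<n}) \<longlonglongrightarrow> 0" by (rule tail_tendsto_0[OF g])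
  fix m n :: nat assume "n \<le> m"
  then have "nrm (sum f {..<m} - sum f {..<n}) = nrm (sum f {n..<m})"
    by (simp add: sum_lessThan_diff)
  also have "\<dots> \<le> (\<Sum>k=n..<m. nrm (f k))" using f by (rule nrm_sum_le)
  also have "\<dots> \<le> sum g {n..<m}" by (intro sum_mono le)
  also have "\<dots> \<le> suminf g - sum g {..<n}" by (rule sum_le_tail[OF g g0])
  finally show "nrm (sum f {..<m} - sum f {..<n}) \<le> suminf g - sum g {..<n}" .
qed (use f in simp)

definition Lim :: "(nat \<Rightarrow> 'v) \<Rightarrow> 'v" where
  "Lim f = (SOME w. w \<in> H \<and> tends f w)"

lemma Lim_tends:
  assumes "\<exists>w\<in>H. tends f w"
  shows "Lim f \<in> H" "tends f (Lim f)"
  using someI_ex[of "\<lambda>w. w \<in> H \<and> tends f w"] assms unfolding Lim_def by auto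

lemma Lim_eq: "(\<And>n. f n \<in> H) \<Longrightarrow> w \<in> H \<Longrightarrow> tends f w \<Longrightarrow> Lim f = w"
  using tends_unique[of f] Lim_tends[of f] by blast

lemma Lim_const: "w \<in> H \<Longrightarrow> (\<And>n. n \<ge> N \<Longrightarrow> f n = w) \<Longrightarrow> (\<And>n. f n \<in> H) \<Longrightarrow> Lim f = w"
  by (rule Lim_eq)
     (auto simp: tends_def intro!: tendsto_eventually eventually_sequentiallyI[of N])

text \<open>
  The solution is the Neumann series \<open>(\<Sum>k. (T ^^ k) w)\<close>, whose partial sums solve the equation up to
  the error \<open>(T ^^ n) w\<close>.
\<close>

lemma neumann:
  assumes T: "linear_map T" and half: "\<And>u. u \<in> H \<Longrightarrow> nrm (T u) \<le> nrm u / 2" and w: "w \<in> H"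
  shows "\<exists>u\<in>H. u - T u = w"
proof -
  define f where "f k = (T ^^ k) w" for k
  have f [simp]: "f k \<in> H" for k
    by (induction k) (auto simp: f_def w linear_mapD(1)[OF T])
  have fT: "T (f k) = f (Suc k)" for k by (simp add: f_def)
  have le: "nrm (f k) \<le> nrm w * (1 / 2) ^ k" for k
  proof (induction k)
    case (Suc k)
    then show ?case using half[of "f k"] by (simp add: fT)
  qed (simp add: f_def)
  have sm: "summable (\<lambda>k. nrm w * (1 / 2) ^ k)" by (intro summable_mult summable_geometric) simp
  obtain u where u: "u \<in> H" "tends (\<lambda>n. sum f {..<n}) u"
    using absolutely_convergent[OF f le sm] by auto
  let ?s = "\<lambda>n. sum f {..<n}"
  have Ts: "?s n - T (?s n) = w - f n" for n
  proof (induction n)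
    case 0
    show ?case using linear_mapD(4)[OF T, of 0 0] by (simp add: f_def)
  next
    case (Suc n)
    have "?s (Suc n) - T (?s (Suc n)) = (?s n - T (?s n)) + f n - f (Suc n)"
      by (simp add: linear_mapD(2)[OF T] fT)
    then show ?case using Suc by simp
  qed
  have "tends (\<lambda>n. w - f n) (u - T u)"
  proof (rule tends_zero_comparison)
    show "nrm (w - f n - (u - T u)) \<le> 2 * nrm (?s n - u)" for n
    proof -
      have eq: "w - f n - (u - T u) = (?s n - u) - T (?s n - u)"
        using Ts[of n, symmetric] u by (simp add: linear_mapD(4)[OF T])
      have d: "?s n - u \<in> H" using u by simp
      have "nrm (?s n - u - T (?s n - u)) \<le> nrm (?s n - u) + nrm (T (?s n - u))"
        by (rule nrm_diff_le[OF d linear_mapD(1)[OF T d]])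
      then show ?thesis unfolding eq using half[OF d] nrm_nonneg[OF d] by linarith
    qed
    show "(\<lambda>n. 2 * nrm (?s n - u)) \<longlonglongrightarrow> 0"
      using u(2) unfolding tends_def by (rule tendsto_mult_right_zero)
  qed (use u w linear_mapD(1)[OF T] in auto)
  moreover have "tends (\<lambda>n. w - f n) w"
  proof (rule tends_zero_comparison)
    show "nrm (w - f n - w) \<le> nrm w * (1 / 2) ^ n" for n
      using le[of n] nrm_minus_commute[of 0 "f n"] by simp
    show "(\<lambda>n. nrm w * (1 / 2) ^ n) \<longlonglongrightarrow> 0" by (rule summable_LIMSEQ_zero[OF sm])
  qed (use w in auto)
  ultimately have "u - T u = w"
    using w u linear_mapD(1)[OF T] by (intro tends_unique[of "\<lambda>n. w - f n"]) auto
  then show ?thesis using u(1) by blast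
qed

text \<open>
  Since \<open>I - T\<close> is injective, the linearity of the inverse need only be tested after applying \<open>I - T\<close>.
\<close>

lemma contraction_inverse:
  assumes T: "linear_map T" and half: "\<And>u. u \<in> H \<Longrightarrow> nrm (T u) \<le> nrm u / 2"
  obtains S where "linear_map S" "\<And>w. w \<in> H \<Longrightarrow> nrm (S w) \<le> 2 * nrm w"
    "\<And>w. w \<in> H \<Longrightarrow> S w - T (S w) = w" "\<And>u. u \<in> H \<Longrightarrow> S (u - T u) = u"
proof -
  define S where "S w = (SOME u. u \<in> H \<and> u - T u = w)" for w
  have S: "S w \<in> H" "S w - T (S w) = w" if "w \<in> H" for w
    using someI_ex[of "\<lambda>u. u \<in> H \<and> u - T u = w"] neumann[OF T half that] unfolding S_def by auto
  have inj: "u = v" if "u \<in> H" "v \<in> H" "u - T u = v - T v" for u v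
  proof -
    have "T (u - v) = u - v" using that by (simp add: linear_mapD(4)[OF T] algebra_simps)
    then have "nrm (u - v) = 0" using half[of "u - v"] that by (simp add: order_antisym)
    then show "u = v" using nrm_eq_0[of "u - v"] that by simp
  qed
  have SI: "S (u - T u) = u" if "u \<in> H" for u
    by (rule inj) (use that S[of "u - T u"] linear_mapD(1)[OF T] in auto)
  have "linear_map S"
    unfolding linear_map_def
  proof (intro conjI ballI allI)
    fix u v assume uv: "u \<in> H" "v \<in> H"
    show "S (u + v) = S u + S v"
    proof (rule inj)
      have "S u + S v - T (S u + S v) = (S u - T (S u)) + (S v - T (S v))"
        using S uv by (simp add: linear_mapD(2)[OF T] add_diff_add)
      then show "S (u + v) - T (S (u + v)) = S u + S v - T (S u + S v)"
        using S uv by simp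
    qed (use S uv in auto)
  next
    fix c u assume u: "u \<in> H"
    show "S (c \<odot> u) = c \<odot> S u"
    proof (rule inj)
      have "c \<odot> S u - T (c \<odot> S u) = c \<odot> (S u - T (S u))"
        using S u by (simp add: linear_mapD(3)[OF T] flip: scale_right_diff_distrib)
      then show "S (c \<odot> u) - T (S (c \<odot> u)) = c \<odot> S u - T (c \<odot> S u)"
        using S u by simp
    qed (use S u in auto)
  qed (use S in auto)
  moreover have "nrm (S w) \<le> 2 * nrm w" if "w \<in> H" for w
    using nrm_le_diff[of "S w" "T (S w)"] S[OF that] half[of "S w"] linear_mapD(1)[OF T] by simp
  ultimately show thesis using S SI that by blast
qed

text \<open>
  A series of operators of rank one.  The hypothesis \<open>block\<close> below says that its remainders tend to zero in
  operator norm.  It covers absolutely convergent series as well as diagonal ones, such as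
  \<open>(\<Sum>k. p k \<langle>u, h k\<rangle> h k)\<close> for nearly orthonormal \<open>h\<close> and \<open>p\<close> merely tending to zero.
\<close>

definition rank_one_series :: "(nat \<Rightarrow> 'v) \<Rightarrow> (nat \<Rightarrow> 'v) \<Rightarrow> 'v \<Rightarrow> 'v" where
  "rank_one_series x y u = Lim (\<lambda>n. \<Sum>k<n. ip u (y k) \<odot> x k)"

context
  fixes x y :: "nat \<Rightarrow> 'v" and \<epsilon> :: "nat \<Rightarrow> real"
  assumes x [simp]: "\<And>k. x k \<in> H" and y [simp]: "\<And>k. y k \<in> H"
    and \<epsilon>: "\<epsilon> \<longlonglongrightarrow> 0"
    and block: "\<And>n m u. u \<in> H \<Longrightarrow> n \<le> m \<Longrightarrow> nrm (\<Sum>k=n..<m. ip u (y k) \<odot> x k) \<le> \<epsilon> n * nrm u"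
begin

lemma rank_one_series_tends:
  assumes u: "u \<in> H"
  shows "rank_one_series x y u \<in> H"
    and "tends (\<lambda>n. \<Sum>k<n. ip u (y k) \<odot> x k) (rank_one_series x y u)"
proof -
  have "\<exists>w\<in>H. tends (\<lambda>n. \<Sum>k<n. ip u (y k) \<odot> x k) w"
  proof (rule complete_tail)
    show "(\<lambda>n. \<epsilon> n * nrm u) \<longlonglongrightarrow> 0" using \<epsilon> by (rule tendsto_mult_left_zero)
  qed (use block[OF u] in \<open>auto simp: sum_lessThan_diff\<close>)
  then show "rank_one_series x y u \<in> H"
    and "tends (\<lambda>n. \<Sum>k<n. ip u (y k) \<odot> x k) (rank_one_series x y u)"
    unfolding rank_one_series_def by (rule Lim_tends)+
qed

lemma rank_one_series_error:
  assumes u: "u \<in> H"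
  shows "nrm (rank_one_series x y u - (\<Sum>k<n. ip u (y k) \<odot> x k)) \<le> \<epsilon> n * nrm u"
proof (rule LIMSEQ_le_const2)
  let ?s = "\<lambda>n. \<Sum>k<n. ip u (y k) \<odot> x k"
  have "tends (\<lambda>m. ?s m - ?s n) (rank_one_series x y u - ?s n)"
    using rank_one_series_tends(2)[OF u] by (simp add: tends_def)
  then show "(\<lambda>m. nrm (?s m - ?s n)) \<longlonglongrightarrow> nrm (rank_one_series x y u - ?s n)"
    using rank_one_series_tends(1)[OF u] by (intro tends_nrm) auto
  have "nrm (?s m - ?s n) \<le> \<epsilon> n * nrm u" if "m \<ge> n" for m
    using block[OF u that] that by (simp add: sum_lessThan_diff)
  then show "\<exists>N. \<forall>m\<ge>N. nrm (?s m - ?s n) \<le> \<epsilon> n * nrm u" by blast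
qed

lemma rank_one_series_ip:
  assumes u: "u \<in> H" and v: "v \<in> H"
  shows "(\<lambda>k. ip u (y k) * ip (x k) v) sums ip (rank_one_series x y u) v"
proof -
  have "(\<lambda>n. ip (\<Sum>k<n. ip u (y k) \<odot> x k) v) \<longlonglongrightarrow> ip (rank_one_series x y u) v"
    using rank_one_series_tends[OF u] v by (intro tends_ip) auto
  then show ?thesis using v by (simp add: sums_def ip_sum_left)
qed

lemma rank_one_series_linear: "linear_map (rank_one_series x y)"
  unfolding linear_map_def
proof (intro conjI ballI allI)
  fix u v assume uv: "u \<in> H" "v \<in> H"
  have "tends (\<lambda>n. (\<Sum>k<n. ip u (y k) \<odot> x k) + (\<Sum>k<n. ip v (y k) \<odot> x k))
      (rank_one_series x y u + rank_one_series x y v)"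
    using uv rank_one_series_tends by (intro tends_add) auto
  then show "rank_one_series x y (u + v) = rank_one_series x y u + rank_one_series x y v"
    unfolding rank_one_series_def[of x y "u + v"] using uv rank_one_series_tends(1)
    by (intro Lim_eq) (auto simp: scale_left_distrib sum.distrib)
next
  fix c u assume u: "u \<in> H"
  have "tends (\<lambda>n. c \<odot> (\<Sum>k<n. ip u (y k) \<odot> x k)) (c \<odot> rank_one_series x y u)"
    using u rank_one_series_tends by (intro tends_scale) auto
  then show "rank_one_series x y (c \<odot> u) = c \<odot> rank_one_series x y u"
    unfolding rank_one_series_def[of x y "c \<odot> u"] using u rank_one_series_tends(1)
    by (intro Lim_eq) (auto simp: scale_sum_right)
qed (rule rank_one_series_tends(1))

text \<open>
  By a diagonal argument every bounded sequence has a subsequence along which all the functionals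
  \<open>\<langle>\<cdot>, y k\<rangle>\<close> converge.  Up to a remainder of small norm, the operator depends on finitely many of them.
\<close>

lemma rank_one_series_compact: "compact_map (rank_one_series x y)"
  unfolding compact_map_def
proof (intro conjI allI impI rank_one_series_linear)
  let ?A = "rank_one_series x y"
  fix u :: "nat \<Rightarrow> 'v"
  assume "(\<forall>n. u n \<in> H) \<and> (\<exists>C. \<forall>n. nrm (u n) \<le> C)"
  then obtain C where u [simp]: "\<And>n. u n \<in> H" and C: "\<And>n. nrm (u n) \<le> C" by auto
  have C0: "0 \<le> C" using C[of 0] nrm_nonneg[OF u[of 0]] by linarith
  \<comment> \<open>The diagonal argument needs a bound which is uniform in \<open>k\<close>; hence the normalisation.\<close>
  define \<phi> where "\<phi> n k = ip (u n) (y k) / of_real (1 + nrm (y k))" for n k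
  have "cmod (\<phi> n k) \<le> C" for n k
  proof -
    have "cmod (ip (u n) (y k)) \<le> nrm (u n) * nrm (y k)" by (rule Cauchy_Schwarz) auto
    also have "\<dots> \<le> C * (1 + nrm (y k))" using C[of n] C0 by (intro mult_mono) auto
    finally have *: "cmod (ip (u n) (y k)) \<le> C * (1 + nrm (y k))" .
    have pos: "0 < 1 + nrm (y k)" using nrm_nonneg[OF y[of k]] by linarith
    show ?thesis
      unfolding \<phi>_def norm_divide norm_of_real abs_of_pos[OF pos] using * pos
      by (simp only: pos_divide_le_eq)
  qed
  then obtain r where r: "strict_mono (r :: nat \<Rightarrow> nat)" and "\<And>k. \<exists>l. (\<lambda>n. \<phi> (r n) k) \<longlonglongrightarrow> l"
    by (rule function_convergent_subsequence[of "UNIV :: nat set" \<phi> C, OF countableI_type]) auto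
  then obtain l' where l': "\<And>k. (\<lambda>n. \<phi> (r n) k) \<longlonglongrightarrow> l' k" by metis
  define l where "l k = l' k * of_real (1 + nrm (y k))" for k
  have l: "(\<lambda>n. ip (u (r n)) (y k)) \<longlonglongrightarrow> l k" for k
  proof -
    have "of_real (1 + nrm (y k)) \<noteq> (0 :: complex)"
      using nrm_nonneg[OF y[of k]] unfolding of_real_eq_0_iff by linarith
    then have "ip (u (r n)) (y k) = \<phi> (r n) k * of_real (1 + nrm (y k))" for n
      unfolding \<phi>_def by simp
    then show ?thesis using tendsto_mult_right[OF l'[of k]] by (simp add: l_def)
  qed
  have AH: "?A (u n) \<in> H" for n by (simp add: rank_one_series_tends)
  have "\<exists>w\<in>H. tends (\<lambda>n. ?A (u (r n))) w"
  proof (rule complete)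
    fix e :: real assume e: "e > 0"
    then have "e / (4 * C + 1) > 0" using C0 by simp
    from LIMSEQ_D[OF \<epsilon> this] obtain N where N: "\<bar>\<epsilon> N\<bar> < e / (4 * C + 1)" by auto
    define s where "s n = (\<Sum>k<N. cmod (ip (u (r n)) (y k) - l k) * nrm (x k))" for n
    have "s \<longlonglongrightarrow> 0" unfolding s_def
      by (intro tendsto_null_sum tendsto_mult_left_zero tendsto_norm_zero LIM_zero l)
    from order_tendstoD(2)[OF this, of "e / 4"] obtain M where M: "\<And>n. n \<ge> M \<Longrightarrow> s n < e / 4"
      using e by (auto simp: eventually_sequentially)
    have "nrm (?A (u (r m)) - ?A (u (r n))) < e" if "m \<ge> M" "n \<ge> M" for m n
    proof -
      let ?w = "u (r m) - u (r n)" and ?s = "\<Sum>k<N. ip (u (r m) - u (r n)) (y k) \<odot> x k"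
      have "nrm (?A (u (r m)) - ?A (u (r n))) = nrm (?A ?w)"
        by (simp add: linear_mapD(4)[OF rank_one_series_linear])
      also have "\<dots> \<le> nrm (?A ?w - ?s) + nrm ?s"
        by (rule nrm_le_diff) (auto simp: rank_one_series_tends)
      also have "nrm (?A ?w - ?s) \<le> \<epsilon> N * nrm ?w" by (rule rank_one_series_error) simp
      also have "\<dots> \<le> \<bar>\<epsilon> N\<bar> * (2 * C)"
        using nrm_diff_le[of "u (r m)" "u (r n)"] C[of "r m"] C[of "r n"]
        by (intro mult_mono) auto
      also have "\<dots> \<le> e / (4 * C + 1) * (2 * C)" using N C0 by (intro mult_right_mono) auto
      also have "\<dots> \<le> e / 2" using C0 e by (simp add: field_simps)
      also have "nrm ?s \<le> (\<Sum>k<N. nrm (ip ?w (y k) \<odot> x k))" by (rule nrm_sum_le) simp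
      also have "\<dots> \<le> (\<Sum>k<N. (cmod (ip (u (r m)) (y k) - l k)
                          + cmod (ip (u (r n)) (y k) - l k)) * nrm (x k))"
      proof (rule sum_mono)
        fix k
        have "cmod (ip ?w (y k)) \<le> cmod (ip (u (r m)) (y k) - l k) + cmod (ip (u (r n)) (y k) - l k)"
          using norm_triangle_ineq4[of "ip (u (r m)) (y k) - l k" "ip (u (r n)) (y k) - l k"] by simp
        then show "nrm (ip ?w (y k) \<odot> x k) \<le> (cmod (ip (u (r m)) (y k) - l k)
                          + cmod (ip (u (r n)) (y k) - l k)) * nrm (x k)"
          by (subst nrm_scale) (auto intro: mult_right_mono)
      qed
      also have "\<dots> = s m + s n" by (simp add: s_def sum.distrib distrib_right)
      finally show ?thesis using M[OF that(1)] M[OF that(2)] by linarith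
    qed
    then show "\<exists>M. \<forall>m\<ge>M. \<forall>n\<ge>M. nrm (?A (u (r m)) - ?A (u (r n))) < e" by blast
  qed (rule AH)
  then show "\<exists>w\<in>H. \<exists>r. strict_mono r \<and> tends (\<lambda>n. ?A (u (r n))) w" using r by blast
qed

end

end


section \<open>Orthonormal families and the spectral theorem for positive compact operators\<close>

text \<open>
  Elimination: an equation in which some unknown occurs is solved for this unknown.  This lemma replaces
  dimension arguments in the min-max principle.
\<close>

lemma homogeneous_system_nontrivial:
  fixes c :: "nat \<Rightarrow> 'k \<Rightarrow> complex"
  assumes "finite K" "n < card K"
  shows "\<exists>a. (\<exists>k\<in>K. a k \<noteq> 0) \<and> (\<forall>i<n. (\<Sum>k\<in>K. a k * c i k) = 0)"
  using assms
proof (induction n arbitrary: K c)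
  case 0
  then have "K \<noteq> {}" by auto
  then show ?case by (intro exI[of _ "\<lambda>_. 1"]) auto
next
  case (Suc n)
  show ?case
  proof (cases "\<forall>k\<in>K. c n k = 0")
    case True
    from Suc.IH[OF Suc.prems(1), of c] Suc.prems(2)
    obtain a where "\<exists>k\<in>K. a k \<noteq> 0" "\<forall>i<n. (\<Sum>k\<in>K. a k * c i k) = 0" by auto
    with True show ?thesis by (intro exI[of _ a]) (auto simp: less_Suc_eq)
  next
    case False
    then obtain m where m: "m \<in> K" "c n m \<noteq> 0" by blast
    let ?K = "K - {m}"
    have "n < card ?K" "finite ?K" using Suc.prems m by simp_all
    from Suc.IH[OF this(2,1), of "\<lambda>i k. c i k - c i m * c n k / c n m"]
    obtain a where a: "\<exists>k\<in>?K. a k \<noteq> 0"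
      and eq: "\<And>i. i < n \<Longrightarrow> (\<Sum>k\<in>?K. a k * (c i k - c i m * c n k / c n m)) = 0" by auto
    define b where "b = (\<lambda>k. if k = m then - (\<Sum>k\<in>?K. a k * c n k) / c n m else a k)"
    have split: "(\<Sum>k\<in>K. b k * c i k) = b m * c i m + (\<Sum>k\<in>?K. a k * c i k)" for i
      using Suc.prems(1) m(1) by (subst sum.remove[of _ m]) (auto simp: b_def intro: sum.cong)
    have "(\<Sum>k\<in>K. b k * c i k) = 0" if "i < Suc n" for i
    proof (cases "i = n")
      case True
      then show ?thesis unfolding split using m by (simp add: b_def)
    next
      case False
      then have "i < n" using that by simp
      have "(\<Sum>k\<in>?K. a k * c i k) = (\<Sum>k\<in>?K. a k * c n k) * (c i m / c n m)"
        using eq[OF \<open>i < n\<close>] unfolding sum_distrib_right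
        by (simp add: right_diff_distrib sum_subtractf mult_ac)
      then show ?thesis unfolding split by (simp add: b_def)
    qed
    moreover have "\<exists>k\<in>K. b k \<noteq> 0" using a by (auto simp: b_def)
    ultimately show ?thesis by blast
  qed
qed

context inner_space
begin

lemma orthonormal_coefficient:
  assumes "finite K" "\<And>k. k \<in> K \<Longrightarrow> f k \<in> H" "j \<in> K"
    and "\<And>j k. j \<in> K \<Longrightarrow> k \<in> K \<Longrightarrow> ip (f j) (f k) = (if j = k then 1 else 0)"
  shows "ip (\<Sum>k\<in>K. c k \<odot> f k) (f j) = c j"
proof -
  have "ip (\<Sum>k\<in>K. c k \<odot> f k) (f j) = (\<Sum>k\<in>K. c k * ip (f k) (f j))"
    using assms(2,3) by (simp add: ip_sum_left)
  also have "\<dots> = (\<Sum>k\<in>K. if k = j then c k else 0)"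
    using assms(3,4) by (intro sum.cong) auto
  finally show ?thesis using assms(1,3) by simp
qed

lemma orthonormal_nrm:
  assumes "finite K" "\<And>k. k \<in> K \<Longrightarrow> f k \<in> H"
    and "\<And>j k. j \<in> K \<Longrightarrow> k \<in> K \<Longrightarrow> ip (f j) (f k) = (if j = k then 1 else 0)"
  shows "(nrm (\<Sum>k\<in>K. c k \<odot> f k))\<^sup>2 = (\<Sum>k\<in>K. (cmod (c k))\<^sup>2)"
proof -
  let ?u = "\<Sum>k\<in>K. c k \<odot> f k"
  have "ip ?u ?u = (\<Sum>k\<in>K. cnj (c k) * ip ?u (f k))"
    using assms(2) by (subst ip_sum_right) auto
  also have "\<dots> = (\<Sum>k\<in>K. of_real ((cmod (c k))\<^sup>2))"
    by (intro sum.cong) (simp_all add: orthonormal_coefficient[OF assms(1,2) _ assms(3)] complex_norm_square del: of_real_power)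
  finally show ?thesis using assms(2) by (simp add: nrm_sq flip: of_real_sum)
qed

lemma Bessel:
  assumes "finite K" "\<And>k. k \<in> K \<Longrightarrow> f k \<in> H" "u \<in> H"
    and on: "\<And>j k. j \<in> K \<Longrightarrow> k \<in> K \<Longrightarrow> ip (f j) (f k) = (if j = k then 1 else 0)"
  shows "(\<Sum>k\<in>K. (cmod (ip u (f k)))\<^sup>2) \<le> (nrm u)\<^sup>2"
proof -
  let ?v = "\<Sum>k\<in>K. ip u (f k) \<odot> f k"
  have "ip u ?v = (\<Sum>k\<in>K. cnj (ip u (f k)) * ip u (f k))"
    using assms(2,3) by (simp add: ip_sum_right)
  also have "\<dots> = of_real (\<Sum>k\<in>K. (cmod (ip u (f k)))\<^sup>2)"
    by (simp add: complex_norm_square mult.commute del: of_real_power)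
  finally have "Re (ip u ?v) = (\<Sum>k\<in>K. (cmod (ip u (f k)))\<^sup>2)" by simp
  moreover have "(nrm (u - ?v))\<^sup>2 = (nrm u)\<^sup>2 - 2 * Re (ip u ?v) + (nrm ?v)\<^sup>2"
    using assms(2,3) by (intro nrm_diff_sq) auto
  moreover have "(nrm ?v)\<^sup>2 = (\<Sum>k\<in>K. (cmod (ip u (f k)))\<^sup>2)"
    by (rule orthonormal_nrm[OF assms(1,2) on])
  moreover have "0 \<le> (nrm (u - ?v))\<^sup>2" by simp
  ultimately show ?thesis by linarith
qed

lemma orthonormal_independent:
  assumes "finite K" "\<And>k. k \<in> K \<Longrightarrow> f k \<in> H"
    and on: "\<And>j k. j \<in> K \<Longrightarrow> k \<in> K \<Longrightarrow> ip (f j) (f k) = (if j = k then 1 else 0)"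
  shows "inj_on f K" "independent (f ` K)"
proof -
  show inj: "inj_on f K"
  proof (rule inj_onI)
    fix j k assume "j \<in> K" "k \<in> K" "f j = f k"
    then show "j = k" using on[of j k] on[of k k] by (auto split: if_splits)
  qed
  show "independent (f ` K)"
  proof
    assume "dependent (f ` K)"
    then obtain c k where k: "k \<in> K" "c (f k) \<noteq> 0" and eq: "(\<Sum>v\<in>f ` K. c v \<odot> v) = 0"
      using assms(1) by (auto simp: dependent_finite)
    have "(\<Sum>k\<in>K. c (f k) \<odot> f k) = 0" using eq by (simp add: sum.reindex[OF inj])
    with orthonormal_coefficient[OF assms(1,2) k(1) on, of "\<lambda>k. c (f k)"] k assms(2)
    show False by simp
  qed
qed

end

locale positive_compact = hilbert scale H ip
  for scale :: "complex \<Rightarrow> 'v::ab_group_add \<Rightarrow> 'v" (infixr \<open>\<odot>\<close> 75) and H ip +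
  fixes A :: "'v \<Rightarrow> 'v" and C :: real
  assumes compact: "compact_map A"
    and symmetric: "u \<in> H \<Longrightarrow> v \<in> H \<Longrightarrow> ip (A u) v = ip u (A v)"
    and positive: "u \<in> H \<Longrightarrow> 0 \<le> Re (ip (A u) u)"
    and form_bound: "u \<in> H \<Longrightarrow> Re (ip (A u) u) \<le> C * (nrm u)\<^sup>2"
begin

lemma linear: "linear_map A"
  using compact by (simp add: compact_map_def)

lemma A_H [simp]: "u \<in> H \<Longrightarrow> A u \<in> H"
  by (rule linear_mapD(1)[OF linear])

definition q :: "'v \<Rightarrow> real" where
  "q u = Re (ip (A u) u)"

lemma q_scale: "u \<in> H \<Longrightarrow> q (c \<odot> u) = (cmod c)\<^sup>2 * q u"
proof -
  assume u: "u \<in> H"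
  have "ip (A (c \<odot> u)) (c \<odot> u) = of_real ((cmod c)\<^sup>2) * ip (A u) u"
    using u unfolding complex_norm_square by (simp add: linear_mapD(3)[OF linear])
  then show "q (c \<odot> u) = (cmod c)\<^sup>2 * q u" by (simp add: q_def)
qed

lemma q_zero: "q 0 = 0"
  using q_scale[of 0 0] by simp

lemma q_eigenvector: "u \<in> H \<Longrightarrow> A u = of_real t \<odot> u \<Longrightarrow> q u = t * (nrm u)\<^sup>2"
  by (simp add: q_def ip_self)

text \<open>
  One step of the deflation.  On the invariant subspace \<open>K\<close> the form of \<open>A\<close> has a least upper
  bound \<open>\<lambda>\<close> relative to the squared norm.  The Cauchy--Schwarz inequality for this form gives
  \<open>\<parallel>A u\<parallel>\<^sup>2 \<le> \<lambda> q u\<close>, hence \<open>\<parallel>A u - \<lambda> u\<parallel>\<^sup>2 \<le> \<lambda> (\<lambda> - q u)\<close> for unit vectors: a maximising sequence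
  consists of approximate eigenvectors, and compactness makes it subconverge.
\<close>

lemma maximal_eigenvector:
  assumes F: "F \<subseteq> H" and eigen: "\<And>f. f \<in> F \<Longrightarrow> \<exists>t. A f = t \<odot> f"
    and ex: "\<exists>u\<in>H. (\<forall>f\<in>F. ip u f = 0) \<and> 0 < q u"
  shows "\<exists>r\<in>H. (\<forall>f\<in>F. ip r f = 0) \<and> nrm r = 1 \<and> 0 < q r \<and> A r = of_real (q r) \<odot> r \<and>
           (\<forall>u\<in>H. (\<forall>f\<in>F. ip u f = 0) \<longrightarrow> q u \<le> q r * (nrm u)\<^sup>2)"
proof -
  define K where "K = {u\<in>H. \<forall>f\<in>F. ip u f = 0}"
  have KH: "u \<in> H" if "u \<in> K" for u using that by (simp add: K_def)
  have Ksub: "subspace K"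
    unfolding subspace_def using F by (auto simp: K_def subset_iff)
  have AK: "A u \<in> K" if "u \<in> K" for u
  proof -
    have "ip (A u) f = 0" if f: "f \<in> F" for f
    proof -
      obtain t where "A f = t \<odot> f" using eigen f by blast
      moreover have "ip u f = 0" "f \<in> H" using f F \<open>u \<in> K\<close> by (auto simp: K_def)
      ultimately show ?thesis using symmetric[of u f] KH[OF \<open>u \<in> K\<close>] by simp
    qed
    then show ?thesis using KH[OF that] by (simp add: K_def)
  qed
  interpret form: inner_space scale K "\<lambda>u v. ip (A u) v"
  proof
    show "ip (A v) u = cnj (ip (A u) v)" if "u \<in> K" "v \<in> K" for u v
      using symmetric[of v u] ip_hermitian[of "A u" v] that KH by simp
  qed (use Ksub in \<open>auto simp: KH linear_mapD[OF linear] positive\<close>)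
  have form_nrm: "form.nrm u = sqrt (q u)" for u by (simp add: form.nrm_def q_def)
  define S where "S = q ` {u\<in>K. nrm u = 1}"
  define l where "l = Sup S"
  have normalise: "q u / (nrm u)\<^sup>2 \<in> S" if "u \<in> K" "nrm u \<noteq> 0" for u
  proof -
    let ?v = "of_real (1 / nrm u) \<odot> u"
    have "nrm ?v = 1" using that KH by (simp add: norm_divide)
    moreover have "?v \<in> K" using form.H_closed(4)[OF that(1)] .
    moreover have "q ?v = q u / (nrm u)\<^sup>2"
      using that KH by (subst q_scale) (simp_all add: norm_divide power_divide)
    ultimately show ?thesis unfolding S_def by (intro image_eqI[of _ _ ?v]) auto
  qed
  have bdd: "bdd_above S"
    unfolding S_def bdd_above_def using form_bound KH by (intro exI[of _ C]) (fastforce simp: q_def)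
  have q_le: "q u \<le> l * (nrm u)\<^sup>2" if "u \<in> K" for u
  proof (cases "nrm u = 0")
    case True
    then show ?thesis using nrm_eq_0[OF KH[OF that]] by (simp add: q_zero)
  next
    case False
    then have "q u / (nrm u)\<^sup>2 \<le> l" unfolding l_def by (intro cSup_upper bdd normalise that)
    with False show ?thesis by (simp add: divide_le_eq)
  qed
  obtain u0 where u0: "u0 \<in> K" "0 < q u0" using ex by (auto simp: K_def)
  then have "nrm u0 \<noteq> 0" using nrm_eq_0[OF KH[OF u0(1)]] q_zero by auto
  then have S_ne: "S \<noteq> {}" using normalise[OF u0(1)] by auto
  have lpos: "0 < l"
  proof (rule ccontr)
    assume "\<not> 0 < l"
    then have "l * (nrm u0)\<^sup>2 \<le> 0" by (simp add: mult_nonpos_nonneg)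
    then show False using q_le[OF u0(1)] u0(2) by simp
  qed
  have nrm_A: "(nrm (A u))\<^sup>2 \<le> l * q u" if "u \<in> K" for u
  proof -
    have Au: "A u \<in> K" using AK that .
    have q0: "0 \<le> q u" using positive[OF KH[OF that]] by (simp add: q_def)
    have "(nrm (A u))\<^sup>2 = cmod (ip (A u) (A u))" using KH[OF Au] by (simp add: ip_self norm_power)
    also have "\<dots> \<le> sqrt (q u) * sqrt (q (A u))"
      using form.Cauchy_Schwarz[OF that Au] by (simp add: form_nrm)
    also have "\<dots> \<le> sqrt (q u) * sqrt (l * (nrm (A u))\<^sup>2)"
      using q0 by (intro mult_left_mono real_sqrt_le_mono q_le Au) simp
    also have "\<dots> = sqrt (l * q u) * nrm (A u)"
      using KH[OF Au] by (simp add: real_sqrt_mult)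
    finally have "nrm (A u) * nrm (A u) \<le> sqrt (l * q u) * nrm (A u)" by (simp add: power2_eq_square)
    then have "nrm (A u) \<le> sqrt (l * q u)"
      using nrm_nonneg[OF KH[OF Au]] q0 lpos by (cases "nrm (A u) = 0") (auto simp: mult_le_cancel_right)
    then have "(nrm (A u))\<^sup>2 \<le> (sqrt (l * q u))\<^sup>2"
      using nrm_nonneg[OF KH[OF Au]] by (rule power_mono)
    then show ?thesis using q0 lpos by simp
  qed
  have "\<exists>u\<in>K. nrm u = 1 \<and> l - 1 / real (Suc n) < q u" for n
  proof -
    have "l - 1 / real (Suc n) < Sup S" unfolding l_def[symmetric] by simp
    from less_cSupD[OF S_ne this] show ?thesis by (auto simp: S_def)
  qed
  then obtain u where u: "\<And>n. u n \<in> K" "\<And>n. nrm (u n) = 1" "\<And>n. l - 1 / real (Suc n) < q (u n)"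
    by metis
  have uH [simp]: "u n \<in> H" for n using u(1) KH by blast
  define d where "d n = nrm (A (u n) - of_real l \<odot> u n)" for n
  have "(d n)\<^sup>2 \<le> l * (1 / real (Suc n))" for n
  proof -
    have "Re (ip (A (u n)) (of_real l \<odot> u n)) = l * q (u n)" by (simp add: q_def)
    then have "(d n)\<^sup>2 = (nrm (A (u n)))\<^sup>2 - 2 * (l * q (u n)) + l\<^sup>2"
      unfolding d_def using u(2) lpos by (subst nrm_diff_sq) simp_all
    also have "\<dots> \<le> l * (l - q (u n))"
      using nrm_A[OF u(1)[of n]] by (simp add: power2_eq_square algebra_simps)
    also have "\<dots> \<le> l * (1 / real (Suc n))" using u(3)[of n] lpos by (intro mult_left_mono) auto
    finally show ?thesis .
  qed
  then have d_le: "d n \<le> sqrt (l * (1 / real (Suc n)))" for n by (rule real_le_rsqrt)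
  have "(\<lambda>n. sqrt (l * (1 / real (Suc n)))) \<longlonglongrightarrow> sqrt (l * 0)"
    by (intro tendsto_intros LIMSEQ_Suc[OF lim_1_over_n])
  then have d0: "d \<longlonglongrightarrow> 0"
    by (intro Lim_null_comparison[of d]) (use d_le in \<open>auto simp: d_def\<close>)
  obtain w \<rho> where w: "w \<in> H" and \<rho>: "strict_mono (\<rho> :: nat \<Rightarrow> nat)" and Aw: "tends (\<lambda>n. A (u (\<rho> n))) w"
    using compact u(2) uH unfolding compact_map_def by (metis order_refl)
  define r where "r = of_real (1 / l) \<odot> w"
  have rH [simp]: "r \<in> H" using w by (simp add: r_def)
  have lr: "of_real l \<odot> r = w" using lpos by (simp add: r_def flip: of_real_mult)
  have "tends (\<lambda>n. of_real l \<odot> u (\<rho> n)) w"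
  proof (rule tends_zero_comparison)
    show "nrm (of_real l \<odot> u (\<rho> n) - w) \<le> d (\<rho> n) + nrm (A (u (\<rho> n)) - w)" for n
      using nrm_triangle_diff[of "of_real l \<odot> u (\<rho> n)" "A (u (\<rho> n))" w]
        nrm_minus_commute[of "of_real l \<odot> u (\<rho> n)" "A (u (\<rho> n))"] w by (simp add: d_def)
    show "(\<lambda>n. d (\<rho> n) + nrm (A (u (\<rho> n)) - w)) \<longlonglongrightarrow> 0"
      using LIMSEQ_subseq_LIMSEQ[OF d0 \<rho>] Aw unfolding tends_def o_def by (rule tendsto_add_zero)
  qed (use w in auto)
  then have "tends (\<lambda>n. of_real (1 / l) \<odot> of_real l \<odot> u (\<rho> n)) r"
    unfolding r_def using w by (intro tends_scale) auto
  then have ur: "tends (\<lambda>n. u (\<rho> n)) r" using lpos by (simp flip: of_real_mult)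
  have "(\<lambda>n. 1) \<longlonglongrightarrow> nrm r" using tends_nrm[OF _ _ ur] u(2) by simp
  then have r1: "nrm r = 1" by (simp add: tendsto_const_iff)
  have rF: "ip r f = 0" if "f \<in> F" for f
  proof -
    have "(\<lambda>n. ip (u (\<rho> n)) f) \<longlonglongrightarrow> ip r f" using ur that F by (intro tends_ip) auto
    moreover have "ip (u (\<rho> n)) f = 0" for n using u(1)[of "\<rho> n"] that by (simp add: K_def)
    ultimately show ?thesis by (simp add: tendsto_const_iff)
  qed
  have Ar: "A r = w"
  proof -
    have "ip (A r) v = ip w v" if v: "v \<in> H" for v
    proof (rule LIMSEQ_unique)
      show "(\<lambda>n. ip (A (u (\<rho> n))) v) \<longlonglongrightarrow> ip w v" using Aw v w by (intro tends_ip) auto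
      have "(\<lambda>n. ip (u (\<rho> n)) (A v)) \<longlonglongrightarrow> ip r (A v)" using ur v by (intro tends_ip) auto
      then show "(\<lambda>n. ip (A (u (\<rho> n))) v) \<longlonglongrightarrow> ip (A r) v" using v by (simp add: symmetric)
    qed
    then have "ip (A r) (A r - w) - ip w (A r - w) = 0" using w by (simp del: ip_diff_right)
    then have "ip (A r - w) (A r - w) = 0" using w by (simp del: ip_diff_right)
    then show ?thesis using definite[of "A r - w"] w by simp
  qed
  then have Ar': "A r = of_real l \<odot> r" by (simp add: lr)
  have "q r = l" using q_eigenvector[OF rH Ar'] r1 by simp
  then show ?thesis
    using rF r1 Ar' lpos q_le by (intro bexI[of _ r]) (auto simp: K_def)
qed

text \<open>
  The eigenvectors are found one after the other; the form takes positive values on every subspace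
  of finite codimension, so this never stops.
\<close>

lemma eigenvector_sequence:
  assumes inf: "\<And>(n::nat) g. (\<And>j. j < n \<Longrightarrow> g j \<in> H) \<Longrightarrow> \<exists>u\<in>H. (\<forall>j<n. ip u (g j) = 0) \<and> 0 < q u"
  obtains f :: "nat \<Rightarrow> 'v" where "\<And>n. f n \<in> H" "\<And>j k. ip (f j) (f k) = (if j = k then 1 else 0)"
    "\<And>n. A (f n) = of_real (q (f n)) \<odot> f n" "\<And>n. 0 < q (f n)"
    "\<And>n u. u \<in> H \<Longrightarrow> (\<And>j. j < n \<Longrightarrow> ip u (f j) = 0) \<Longrightarrow> q u \<le> q (f n) * (nrm u)\<^sup>2"
proof -
  define P where "P f n r \<longleftrightarrow> r \<in> H \<and> (\<forall>j<n. ip r (f j) = 0) \<and> nrm r = 1 \<and> 0 < q r \<and>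
    A r = of_real (q r) \<odot> r \<and> (\<forall>u\<in>H. (\<forall>j<n. ip u (f j) = 0) \<longrightarrow> q u \<le> q r * (nrm u)\<^sup>2)"
    for f :: "nat \<Rightarrow> 'v" and n r
  have "\<exists>f. \<forall>n. P f n (f n)"
  proof (rule dependent_wellorder_choice)
    show "P f n r = P g n r" if "\<And>j. j < n \<Longrightarrow> f j = g j" for f g n r
      using that by (simp add: P_def)
    show "\<exists>r. P f n r" if "\<And>j. j < n \<Longrightarrow> P f j (f j)" for f n
    proof -
      have fP: "f j \<in> H" "A (f j) = of_real (q (f j)) \<odot> f j" if "j < n" for j
        using \<open>\<And>j. j < n \<Longrightarrow> P f j (f j)\<close>[OF that] by (auto simp: P_def)
      have "\<exists>r\<in>H. (\<forall>g\<in>f ` {..<n}. ip r g = 0) \<and> nrm r = 1 \<and> 0 < q r \<and> A r = of_real (q r) \<odot> r \<and>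
           (\<forall>u\<in>H. (\<forall>g\<in>f ` {..<n}. ip u g = 0) \<longrightarrow> q u \<le> q r * (nrm u)\<^sup>2)"
        using fP inf[of n f] by (intro maximal_eigenvector) auto
      then show ?thesis unfolding P_def by auto
    qed
  qed
  then obtain f where f: "\<And>n. P f n (f n)" by blast
  have fH: "f n \<in> H" for n using f[of n] by (simp add: P_def)
  have "ip (f j) (f k) = (if j = k then 1 else 0)" for j k
  proof (cases j k rule: linorder_cases)
    case less
    then have "ip (f k) (f j) = 0" using f[of k] by (simp add: P_def)
    then show ?thesis using less ip_hermitian[OF fH fH, of k j] by simp
  next
    case equal
    then show ?thesis using f[of k] ip_self[OF fH, of k] by (simp add: P_def)
  next
    case greater
    then show ?thesis using f[of j] by (simp add: P_def)
  qed
  with f fH show thesis by (intro that[of f]) (auto simp: P_def)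
qed

end

locale spectral_sequence = positive_compact scale H ip A C
  for scale :: "complex \<Rightarrow> 'v::ab_group_add \<Rightarrow> 'v" (infixr \<open>\<odot>\<close> 75) and H ip A C +
  fixes f :: "nat \<Rightarrow> 'v"
  assumes f_H [simp]: "f n \<in> H"
    and f_orthonormal: "ip (f j) (f k) = (if j = k then 1 else 0)"
    and f_eigen: "A (f n) = of_real (q (f n)) \<odot> f n"
    and f_pos: "0 < q (f n)"
    and f_max: "u \<in> H \<Longrightarrow> (\<And>j. j < n \<Longrightarrow> ip u (f j) = 0) \<Longrightarrow> q u \<le> q (f n) * (nrm u)\<^sup>2"
begin

lemma nrm_f: "nrm (f n) = 1"
  using f_orthonormal[of n n] by (simp add: nrm_def)

lemma q_f_decseq: "decseq (\<lambda>n. q (f n))"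
proof (rule decseq_SucI)
  show "q (f (Suc n)) \<le> q (f n)" for n
    using f_max[of "f (Suc n)" n] by (simp add: nrm_f f_orthonormal)
qed

lemma q_combination:
  assumes "finite K"
  shows "q (\<Sum>k\<in>K. c k \<odot> f k) = (\<Sum>k\<in>K. q (f k) * (cmod (c k))\<^sup>2)"
proof -
  let ?u = "\<Sum>k\<in>K. c k \<odot> f k"
  have "A ?u = (\<Sum>k\<in>K. (of_real (q (f k)) * c k) \<odot> f k)"
    by (simp add: linear_map_sum[OF linear] linear_mapD(3)[OF linear] mult.commute f_eigen[symmetric])
       (simp add: f_eigen mult.commute)
  then have "ip (A ?u) ?u = (\<Sum>k\<in>K. cnj (c k) * ip (\<Sum>k\<in>K. (of_real (q (f k)) * c k) \<odot> f k) (f k))"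
    by (simp add: ip_sum_right)
  also have "\<dots> = (\<Sum>k\<in>K. of_real (q (f k) * (cmod (c k))\<^sup>2))"
    using orthonormal_coefficient[OF assms, of f _ "\<lambda>k. of_real (q (f k)) * c k"] f_orthonormal
    by (intro sum.cong) (simp_all add: complex_norm_square mult_ac del: of_real_power)
  finally show ?thesis by (simp add: q_def flip: of_real_sum)
qed

text \<open>
  The min-max principle.  Some combination of \<open>f 0, \<dots>, f n\<close> is orthogonal to \<open>n\<close> given vectors, which
  bounds the eigenvalue from above; and some combination of \<open>n + 1\<close> given vectors is orthogonal to
  \<open>f 0, \<dots>, f (n - 1)\<close>, which bounds it from below.
\<close>

lemma eigenvalue_le:
  assumes x: "\<And>i. i < n \<Longrightarrow> x i \<in> H"
    and M: "\<And>u. u \<in> H \<Longrightarrow> (\<And>i. i < n \<Longrightarrow> ip u (x i) = 0) \<Longrightarrow> q u \<le> M * (nrm u)\<^sup>2"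
  shows "q (f n) \<le> M"
proof -
  obtain a k where k: "k \<le> n" "a k \<noteq> 0" and a: "\<And>i. i < n \<Longrightarrow> (\<Sum>k\<le>n. a k * ip (f k) (x i)) = 0"
    using homogeneous_system_nontrivial[of "{..n}" n "\<lambda>i k. ip (f k) (x i)"] by auto
  define u where "u = (\<Sum>k\<le>n. a k \<odot> f k)"
  have u: "u \<in> H" by (simp add: u_def)
  have "ip u (x i) = 0" if "i < n" for i
    using a[OF that] x[OF that] by (simp add: u_def ip_sum_left)
  then have "q u \<le> M * (nrm u)\<^sup>2" by (rule M[OF u])
  moreover have nrm: "(nrm u)\<^sup>2 = (\<Sum>k\<le>n. (cmod (a k))\<^sup>2)"
    unfolding u_def by (rule orthonormal_nrm) (auto simp: f_orthonormal)
  moreover have "q (f n) * (nrm u)\<^sup>2 \<le> q u"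
    unfolding nrm unfolding u_def q_combination[OF finite_atMost] sum_distrib_left
    using q_f_decseq by (intro sum_mono mult_right_mono) (auto simp: decseq_def)
  ultimately have "q (f n) * (nrm u)\<^sup>2 \<le> M * (nrm u)\<^sup>2" by linarith
  moreover have "0 < (nrm u)\<^sup>2"
    unfolding nrm using k by (intro sum_pos2[of _ k]) auto
  ultimately show ?thesis by simp
qed

lemma eigenvalue_ge:
  assumes K: "finite K" "card K = Suc n" and x: "\<And>k. k \<in> K \<Longrightarrow> x k \<in> H"
    and m: "\<And>a. m * (nrm (\<Sum>k\<in>K. a k \<odot> x k))\<^sup>2 \<le> q (\<Sum>k\<in>K. a k \<odot> x k)"
    and indep: "\<And>a k. k \<in> K \<Longrightarrow> a k \<noteq> 0 \<Longrightarrow> (\<Sum>k\<in>K. a k \<odot> x k) \<noteq> 0"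
  shows "m \<le> q (f n)"
proof -
  obtain a k where k: "k \<in> K" "a k \<noteq> 0" and a: "\<And>i. i < n \<Longrightarrow> (\<Sum>k\<in>K. a k * ip (x k) (f i)) = 0"
    using homogeneous_system_nontrivial[of K n "\<lambda>i k. ip (x k) (f i)"] K by auto
  define u where "u = (\<Sum>k\<in>K. a k \<odot> x k)"
  have u: "u \<in> H" using x by (simp add: u_def)
  have "ip u (f i) = 0" if "i < n" for i
    using a[OF that] x by (simp add: u_def ip_sum_left)
  then have "q u \<le> q (f n) * (nrm u)\<^sup>2" by (rule f_max[OF u])
  moreover have "m * (nrm u)\<^sup>2 \<le> q u" unfolding u_def by (rule m)
  ultimately have "m * (nrm u)\<^sup>2 \<le> q (f n) * (nrm u)\<^sup>2" by linarith
  moreover have "nrm u \<noteq> 0" using nrm_eq_0[OF u] indep[of k a] k by (auto simp: u_def)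
  ultimately show ?thesis by simp
qed

context
  assumes lim: "(\<lambda>n. q (f n)) \<longlonglongrightarrow> 0"
begin

lemma finite_level: "t > 0 \<Longrightarrow> finite {j. q (f j) = t}"
proof -
  assume "t > 0"
  from order_tendstoD(2)[OF lim this] obtain N where "\<And>n. n \<ge> N \<Longrightarrow> q (f n) < t"
    by (auto simp: eventually_sequentially)
  then have "{j. q (f j) = t} \<subseteq> {..<N}" by (force simp: not_le[symmetric])
  then show ?thesis by (rule finite_subset) simp
qed

text \<open>
  Let \<open>u\<close> be an eigenvector for \<open>t\<close> and \<open>p\<close> its projection to the span.  Then \<open>u - p\<close> is orthogonal to all the
  \<open>f j\<close>, so its form is at most \<open>q (f n)\<close> times its squared norm for every \<open>n\<close>.  As \<open>q (f n)\<close> tends to zero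
  and \<open>t > 0\<close>, it vanishes.
\<close>

lemma eigenspace_eq_span:
  assumes t: "t > 0"
  shows "{u\<in>H. A u = of_real t \<odot> u} = span (f ` {j. q (f j) = t})" (is "?E = span (f ` ?J)")
proof
  have "subspace ?E"
    unfolding subspace_def using linear_mapD(4)[OF linear, of 0 0]
    by (auto simp: linear_mapD[OF linear] scale_right_distrib mult.commute)
  moreover have "f ` ?J \<subseteq> ?E" using f_eigen by auto
  ultimately show "span (f ` ?J) \<subseteq> ?E" by (rule span_minimal[rotated])
  show "?E \<subseteq> span (f ` ?J)"
  proof
    fix u assume "u \<in> ?E"
    then have u: "u \<in> H" and Au: "A u = of_real t \<odot> u" by auto
    have fin: "finite ?J" by (rule finite_level[OF t])
    define p where "p = (\<Sum>j\<in>?J. ip u (f j) \<odot> f j)"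
    have p: "p \<in> H" by (simp add: p_def)
    have pspan: "p \<in> span (f ` ?J)"
      unfolding p_def by (intro span_sum span_scale span_base) auto
    with \<open>span (f ` ?J) \<subseteq> ?E\<close> have Ap: "A p = of_real t \<odot> p" by auto
    have orth: "ip (u - p) (f j) = 0" for j
    proof (cases "q (f j) = t")
      case True
      then have "ip p (f j) = ip u (f j)"
        unfolding p_def using fin f_orthonormal by (intro orthonormal_coefficient) auto
      then show ?thesis using u p by simp
    next
      case False
      have "A (u - p) = of_real t \<odot> (u - p)"
        using u p by (simp add: linear_mapD(4)[OF linear] Au Ap scale_right_diff_distrib)
      then have "of_real t * ip (u - p) (f j) = of_real (q (f j)) * ip (u - p) (f j)"
        using symmetric[of "u - p" "f j"] u p f_eigen[of j] by simp
      with False show ?thesis by simp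
    qed
    have "A (u - p) = of_real t \<odot> (u - p)"
      using u p by (simp add: linear_mapD(4)[OF linear] Au Ap scale_right_diff_distrib)
    then have "q (u - p) = t * (nrm (u - p))\<^sup>2" using u p by (intro q_eigenvector) auto
    then have "t * (nrm (u - p))\<^sup>2 \<le> q (f n) * (nrm (u - p))\<^sup>2" for n
      using f_max[of "u - p" n] orth u p by simp
    moreover have "(\<lambda>n. q (f n) * (nrm (u - p))\<^sup>2) \<longlonglongrightarrow> 0" using lim by (rule tendsto_mult_left_zero)
    ultimately have "t * (nrm (u - p))\<^sup>2 \<le> 0" by (intro LIMSEQ_le_const) auto
    then have "(nrm (u - p))\<^sup>2 \<le> 0" using t by (simp add: mult_le_0_iff)
    then have "nrm (u - p) = 0" by simp
    then have "u = p" using nrm_eq_0[of "u - p"] u p by simp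
    then show "u \<in> span (f ` ?J)" using pspan by simp
  qed
qed

lemma eigenspace_dim:
  assumes "t > 0"
  shows "dim {u\<in>H. A u = of_real t \<odot> u} = card {j. q (f j) = t}"
  using orthonormal_independent[OF finite_level[OF assms], of f] f_orthonormal
  by (simp add: eigenspace_eq_span[OF assms] dim_eq_card_independent card_image)

end

end


section \<open>Systems which are close to an orthonormal one\<close>

locale near_orthonormal = hilbert scale H ip
  for scale :: "complex \<Rightarrow> 'v::ab_group_add \<Rightarrow> 'v" (infixr \<open>\<odot>\<close> 75) and H ip +
  fixes e h :: "nat \<Rightarrow> 'v"
  assumes e_H [simp]: "e k \<in> H" and h_H [simp]: "h k \<in> H"
    and e_orthonormal: "ip (e j) (e k) = (if j = k then 1 else 0)"
    and deviation_summable: "summable (\<lambda>k. nrm (e k - h k))"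
    and deviation_le: "(\<Sum>k. nrm (e k - h k)) \<le> 1 / 2"
begin

definition tail :: "nat \<Rightarrow> real" where
  "tail n = (\<Sum>k. nrm (e k - h k)) - (\<Sum>k<n. nrm (e k - h k))"

lemma tail_limit: "tail \<longlonglongrightarrow> 0"
  unfolding tail_def by (rule tail_tendsto_0[OF deviation_summable])

lemma sum_deviation_le:
  assumes "finite F" "F \<subseteq> {n..}"
  shows "(\<Sum>k\<in>F. nrm (e k - h k)) \<le> tail n"
proof -
  obtain m where "F \<subseteq> {..<m}" using finite_nat_bounded[OF assms(1)] by blast
  then have "F \<subseteq> {n..<m}" using assms(2) by auto
  then have "(\<Sum>k\<in>F. nrm (e k - h k)) \<le> (\<Sum>k=n..<m. nrm (e k - h k))"
    by (intro sum_mono2) auto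
  also have "\<dots> \<le> tail n" unfolding tail_def by (intro sum_le_tail deviation_summable) auto
  finally show ?thesis .
qed

lemma tail_nonneg: "0 \<le> tail n"
  using sum_deviation_le[of "{}" n] by simp

lemma tail_le: "tail n \<le> 1 / 2"
  using deviation_le sum_nonneg[of "{..<n}" "\<lambda>k. nrm (e k - h k)"] unfolding tail_def by simp

lemma nrm_e: "nrm (e k) = 1"
  using e_orthonormal[of k k] by (simp add: nrm_def)

lemma deviation_coefficients:
  assumes u: "u \<in> H" and F: "finite F" "F \<subseteq> {n..}"
  shows "L2_set (\<lambda>k. cmod (ip u (e k - h k))) F \<le> tail n * nrm u"
proof -
  have "L2_set (\<lambda>k. cmod (ip u (e k - h k))) F \<le> (\<Sum>k\<in>F. cmod (ip u (e k - h k)))"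
    by (rule L2_set_le_sum) simp
  also have "\<dots> \<le> (\<Sum>k\<in>F. nrm (e k - h k) * nrm u)"
    using u by (intro sum_mono) (simp add: Cauchy_Schwarz mult.commute del: ip_diff_right)
  also have "\<dots> \<le> tail n * nrm u"
    using sum_deviation_le[OF F] u by (simp add: mult_right_mono flip: sum_distrib_right)
  finally show ?thesis .
qed

text \<open>
  Minkowski's inequality in \<open>\<ell>\<^sup>2\<close> compares the coefficients with respect to \<open>h\<close> and \<open>e\<close>; for the latter there
  is Bessel's inequality, or equality for combinations of the \<open>e k\<close>.
\<close>

lemma analysis_bound:
  assumes u: "u \<in> H" and F: "finite F" "F \<subseteq> {n..}"
  shows "L2_set (\<lambda>k. cmod (ip u (h k))) F \<le> (1 + tail n) * nrm u"
proof -
  have "L2_set (\<lambda>k. cmod (ip u (h k))) F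
      \<le> L2_set (\<lambda>k. cmod (ip u (e k)) + cmod (ip u (e k - h k))) F"
  proof (rule L2_set_mono)
    fix k
    show "cmod (ip u (h k)) \<le> cmod (ip u (e k)) + cmod (ip u (e k - h k))"
      using norm_triangle_ineq4[of "ip u (e k)" "ip u (e k - h k)"] u by simp
  qed simp
  also have "\<dots> \<le> L2_set (\<lambda>k. cmod (ip u (e k))) F + L2_set (\<lambda>k. cmod (ip u (e k - h k))) F"
    by (rule L2_set_triangle_ineq)
  also have "L2_set (\<lambda>k. cmod (ip u (e k))) F \<le> nrm u"
    unfolding L2_set_def using u Bessel[OF F(1) _ u e_orthonormal] by (intro real_le_lsqrt) auto
  also have "L2_set (\<lambda>k. cmod (ip u (e k - h k))) F \<le> tail n * nrm u"
    by (rule deviation_coefficients[OF u F])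
  finally show ?thesis by (simp add: algebra_simps)
qed

lemma analysis_lower_bound:
  assumes F: "finite F" "F \<subseteq> {n..}" and u: "u = (\<Sum>k\<in>F. c k \<odot> e k)"
  shows "(1 - tail n) * nrm u \<le> L2_set (\<lambda>k. cmod (ip u (h k))) F"
proof -
  have uH: "u \<in> H" by (simp add: u)
  have "nrm u = sqrt ((nrm u)\<^sup>2)" using uH by simp
  also have "(nrm u)\<^sup>2 = (\<Sum>k\<in>F. (cmod (c k))\<^sup>2)"
    unfolding u by (rule orthonormal_nrm[OF F(1) _ e_orthonormal]) simp
  also have "\<dots> = (\<Sum>k\<in>F. (cmod (ip u (e k)))\<^sup>2)"
    unfolding u using orthonormal_coefficient[OF F(1) _ _ e_orthonormal, of _ c] by (intro sum.cong) auto
  finally have "nrm u = L2_set (\<lambda>k. cmod (ip u (e k))) F" by (simp add: L2_set_def)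
  also have "\<dots> \<le> L2_set (\<lambda>k. cmod (ip u (h k)) + cmod (ip u (e k - h k))) F"
  proof (rule L2_set_mono)
    fix k
    show "cmod (ip u (e k)) \<le> cmod (ip u (h k)) + cmod (ip u (e k - h k))"
      using norm_triangle_ineq[of "ip u (h k)" "ip u (e k - h k)"] uH by simp
  qed simp
  also have "\<dots> \<le> L2_set (\<lambda>k. cmod (ip u (h k))) F + L2_set (\<lambda>k. cmod (ip u (e k - h k))) F"
    by (rule L2_set_triangle_ineq)
  also have "L2_set (\<lambda>k. cmod (ip u (e k - h k))) F \<le> tail n * nrm u"
    by (rule deviation_coefficients[OF uH F])
  finally show ?thesis by (simp add: algebra_simps)
qed

text \<open>
  This is dual to \<open>analysis_bound\<close>: the combination \<open>z\<close> is tested against itself.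
\<close>

lemma synthesis_bound:
  assumes F: "finite F" "F \<subseteq> {n..}"
  shows "nrm (\<Sum>k\<in>F. c k \<odot> h k) \<le> (1 + tail n) * L2_set (\<lambda>k. cmod (c k)) F"
proof -
  define z where "z = (\<Sum>k\<in>F. c k \<odot> h k)"
  have z: "z \<in> H" by (simp add: z_def)
  have "ip z z = (\<Sum>k\<in>F. c k * ip (h k) z)" by (subst (1) z_def) (simp add: ip_sum_left z)
  then have "(nrm z)\<^sup>2 \<le> cmod (\<Sum>k\<in>F. c k * ip (h k) z)"
    using nrm_sq[OF z] complex_Re_le_cmod by metis
  also have "\<dots> \<le> (\<Sum>k\<in>F. \<bar>cmod (c k)\<bar> * \<bar>cmod (ip z (h k))\<bar>)"
    using ip_hermitian[OF z h_H] by (intro order_trans[OF norm_sum]) (simp add: norm_mult)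
  also have "\<dots> \<le> L2_set (\<lambda>k. cmod (c k)) F * L2_set (\<lambda>k. cmod (ip z (h k))) F"
    by (rule L2_set_mult_ineq)
  also have "\<dots> \<le> L2_set (\<lambda>k. cmod (c k)) F * ((1 + tail n) * nrm z)"
    by (intro mult_left_mono analysis_bound z F) simp
  finally have *: "nrm z * nrm z \<le> ((1 + tail n) * L2_set (\<lambda>k. cmod (c k)) F) * nrm z"
    by (simp add: power2_eq_square mult_ac)
  have "0 \<le> (1 + tail n) * L2_set (\<lambda>k. cmod (c k)) F" using tail_nonneg[of n] by simp
  with * show ?thesis using nrm_nonneg[OF z] unfolding z_def[symmetric]
    by (cases "nrm z = 0") (auto simp: mult_le_cancel_right)
qed

subsection \<open>The operator which turns the system into the orthonormal one\<close>

text \<open>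
  On \<open>e k\<close> this operator is \<open>e k - h k\<close>, and on the orthogonal complement of all \<open>e k\<close> it vanishes.  So
  \<open>I - T\<close> maps \<open>e k\<close> to \<open>h k\<close>.
\<close>

definition T :: "'v \<Rightarrow> 'v" where
  "T = rank_one_series (\<lambda>k. e k - h k) e"

lemma T_block:
  assumes u: "u \<in> H"
  shows "nrm (\<Sum>k=n..<m. ip u (e k) \<odot> (e k - h k)) \<le> tail n * nrm u"
proof -
  have "nrm (\<Sum>k=n..<m. ip u (e k) \<odot> (e k - h k)) \<le> (\<Sum>k=n..<m. nrm (ip u (e k) \<odot> (e k - h k)))"
    by (rule nrm_sum_le) simp
  also have "\<dots> \<le> (\<Sum>k=n..<m. nrm (e k - h k) * nrm u)"
  proof (rule sum_mono)
    fix k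
    have "cmod (ip u (e k)) * nrm (e k - h k) \<le> nrm u * nrm (e k - h k)"
      using Cauchy_Schwarz[OF u e_H, of k] by (intro mult_right_mono) (simp_all add: nrm_e)
    then show "nrm (ip u (e k) \<odot> (e k - h k)) \<le> nrm (e k - h k) * nrm u"
      by (simp add: mult.commute)
  qed
  also have "\<dots> \<le> tail n * nrm u"
    using sum_deviation_le[of "{n..<m}" n] u by (simp add: mult_right_mono subset_iff flip: sum_distrib_right)
  finally show ?thesis .
qed

lemmas T_facts =
  rank_one_series_linear[of "\<lambda>k. e k - h k" e tail, folded T_def, OF _ _ tail_limit T_block]
  rank_one_series_compact[of "\<lambda>k. e k - h k" e tail, folded T_def, OF _ _ tail_limit T_block]
  rank_one_series_error[of "\<lambda>k. e k - h k" e tail _ 0, folded T_def, OF _ _ tail_limit T_block]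

lemma T_linear: "linear_map T" and T_compact: "compact_map T"
  and T_half: "u \<in> H \<Longrightarrow> nrm (T u) \<le> nrm u / 2"
proof -
  show "linear_map T" "compact_map T" using T_facts by auto
  assume u: "u \<in> H"
  have "nrm (T u) \<le> tail 0 * nrm u" using T_facts(3)[of u] u by simp
  also have "\<dots> \<le> 1 / 2 * nrm u" using tail_le u by (intro mult_right_mono) auto
  finally show "nrm (T u) \<le> nrm u / 2" by simp
qed

lemma T_e: "e j - T (e j) = h j"
proof -
  have "T (e j) = e j - h j"
    unfolding T_def rank_one_series_def
  proof (rule Lim_const[of _ "Suc j"])
    fix n assume "Suc j \<le> n"
    then have "(\<Sum>k<n. ip (e j) (e k) \<odot> (e k - h k)) = (\<Sum>k<n. if j = k then e k - h k else 0)"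
      by (intro sum.cong) (auto simp: e_orthonormal)
    also have "\<dots> = e j - h j" using \<open>Suc j \<le> n\<close> by simp
    finally show "(\<Sum>k<n. ip (e j) (e k) \<odot> (e k - h k)) = e j - h j" .
  qed auto
  then show ?thesis by simp
qed

lemma orthonormalising_operator:
  "\<exists>T S. compact_map T \<and> linear_map S \<and> (\<exists>C. \<forall>u\<in>H. nrm (S u) \<le> C * nrm u) \<and>
     (\<forall>u\<in>H. S (u - T u) = u \<and> S u - T (S u) = u) \<and> (\<forall>k. S (h k) = e k)"
proof -
  obtain S where S: "linear_map S" "\<And>w. w \<in> H \<Longrightarrow> nrm (S w) \<le> 2 * nrm w"
    "\<And>w. w \<in> H \<Longrightarrow> S w - T (S w) = w" "\<And>u. u \<in> H \<Longrightarrow> S (u - T u) = u"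
    using contraction_inverse[OF T_linear T_half] by blast
  have "S (h k) = e k" for k using S(4)[of "e k"] by (simp add: T_e)
  with S T_compact show ?thesis by blast
qed

end

subsection \<open>Spectral asymptotics of a nearly diagonal operator\<close>

locale weighted_near_orthonormal = near_orthonormal scale H ip e h
  for scale :: "complex \<Rightarrow> 'v::ab_group_add \<Rightarrow> 'v" (infixr \<open>\<odot>\<close> 75) and H ip e h +
  fixes p :: "nat \<Rightarrow> real"
  assumes p_pos: "0 < p k" and p_decseq: "decseq p" and p_limit: "p \<longlonglongrightarrow> 0"
begin

text \<open>The operator \<open>u \<mapsto> (\<Sum>k. p k \<langle>u, h k\<rangle> h k)\<close>, with the weight moved into the functional.\<close>

definition B :: "'v \<Rightarrow> 'v" where
  "B = rank_one_series h (\<lambda>k. of_real (p k) \<odot> h k)"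

lemma weighted_coefficients:
  assumes u: "u \<in> H" and F: "finite F" "F \<subseteq> {n..}"
  shows "L2_set (\<lambda>k. cmod (ip u (of_real (p k) \<odot> h k))) F \<le> 2 * p n * nrm u"
proof -
  have "L2_set (\<lambda>k. cmod (ip u (of_real (p k) \<odot> h k))) F \<le> L2_set (\<lambda>k. p n * cmod (ip u (h k))) F"
  proof (rule L2_set_mono)
    fix k assume "k \<in> F"
    then have "p k \<le> p n" using F p_decseq by (auto simp: decseq_def)
    then show "cmod (ip u (of_real (p k) \<odot> h k)) \<le> p n * cmod (ip u (h k))"
      using u p_pos[of k] by (simp add: norm_mult mult_right_mono)
  qed simp
  also have "\<dots> = p n * L2_set (\<lambda>k. cmod (ip u (h k))) F"
    using p_pos[of n] by (simp add: L2_set_right_distrib)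
  also have "\<dots> \<le> p n * (2 * nrm u)"
  proof (rule mult_left_mono)
    have "L2_set (\<lambda>k. cmod (ip u (h k))) F \<le> (1 + tail n) * nrm u" by (rule analysis_bound[OF u F])
    also have "\<dots> \<le> 2 * nrm u" using tail_le[of n] u by (intro mult_right_mono) auto
    finally show "L2_set (\<lambda>k. cmod (ip u (h k))) F \<le> 2 * nrm u" .
  qed (use p_pos[of n] in simp)
  finally show ?thesis by simp
qed

lemma B_block:
  assumes u: "u \<in> H"
  shows "nrm (\<Sum>k=n..<m. ip u (of_real (p k) \<odot> h k) \<odot> h k) \<le> 4 * p n * nrm u"
proof -
  have F: "finite {n..<m}" "{n..<m} \<subseteq> {n..}" by auto
  have "nrm (\<Sum>k=n..<m. ip u (of_real (p k) \<odot> h k) \<odot> h k)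
      \<le> (1 + tail n) * L2_set (\<lambda>k. cmod (ip u (of_real (p k) \<odot> h k))) {n..<m}"
    by (rule synthesis_bound[OF F])
  also have "\<dots> \<le> 2 * (2 * p n * nrm u)"
    using tail_nonneg[of n] tail_le[of n] by (intro mult_mono weighted_coefficients u F) auto
  finally show ?thesis by simp
qed

lemma B_block_limit: "(\<lambda>n. 4 * p n) \<longlonglongrightarrow> 0"
  using p_limit by (rule tendsto_mult_right_zero)

lemmas B_facts =
  rank_one_series_compact[of h "\<lambda>k. of_real (p k) \<odot> h k" "\<lambda>n. 4 * p n", folded B_def, OF _ _ B_block_limit B_block]
  rank_one_series_error[of h "\<lambda>k. of_real (p k) \<odot> h k" "\<lambda>n. 4 * p n" _ 0, folded B_def, OF _ _ B_block_limit B_block]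
  rank_one_series_ip[of h "\<lambda>k. of_real (p k) \<odot> h k" "\<lambda>n. 4 * p n", folded B_def, OF _ _ B_block_limit B_block]

lemma B_compact: "compact_map B"
  using B_facts(1) by simp

lemma B_linear: "linear_map B"
  using B_compact by (simp add: compact_map_def)

lemma B_ip:
  "u \<in> H \<Longrightarrow> v \<in> H \<Longrightarrow> (\<lambda>k. of_real (p k) * ip u (h k) * ip (h k) v) sums ip (B u) v"
  using B_facts(3)[of u v] by simp

lemma B_form:
  assumes u: "u \<in> H"
  shows "(\<lambda>k. p k * (cmod (ip u (h k)))\<^sup>2) sums Re (ip (B u) u)"
proof -
  have "of_real (p k) * ip u (h k) * ip (h k) u = of_real (p k * (cmod (ip u (h k)))\<^sup>2)" for k
    using u ip_hermitian[of u "h k"] by (simp add: complex_norm_square mult_ac del: of_real_power)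
  then show ?thesis using sums_Re[OF B_ip[OF u u]] by (simp only: Re_complex_of_real)
qed

sublocale positive_compact scale H ip B "4 * p 0"
proof
  show "compact_map B" by (rule B_compact)
  show "ip (B u) v = ip u (B v)" if uv: "u \<in> H" "v \<in> H" for u v
  proof (rule sums_unique2[OF B_ip[OF uv]])
    have "(\<lambda>k. cnj (of_real (p k) * ip v (h k) * ip (h k) u)) sums cnj (ip (B v) u)"
      using B_ip[OF uv(2,1)] by (simp only: sums_cnj)
    moreover have "cnj (ip (B v) u) = ip u (B v)"
      using ip_hermitian[of "B v" u] uv linear_mapD(1)[OF B_linear] by simp
    moreover have "cnj (of_real (p k) * ip v (h k) * ip (h k) u) = of_real (p k) * ip u (h k) * ip (h k) v" for k
      using ip_hermitian[of u "h k"] ip_hermitian[of v "h k"] uv by simp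
    ultimately show "(\<lambda>k. of_real (p k) * ip u (h k) * ip (h k) v) sums ip u (B v)" by (simp only:)
  qed
  show "0 \<le> Re (ip (B u) u)" if "u \<in> H" for u
    using p_pos by (intro sums_le[OF _ sums_zero B_form[OF that]]) (simp add: less_imp_le)
  show "Re (ip (B u) u) \<le> 4 * p 0 * (nrm u)\<^sup>2" if u: "u \<in> H" for u
  proof -
    have BH: "B u \<in> H" using linear_mapD(1)[OF B_linear u] .
    have "nrm (B u) \<le> 4 * p 0 * nrm u" using B_facts(2)[of u] u by simp
    then have "nrm (B u) * nrm u \<le> 4 * p 0 * nrm u * nrm u" using u by (intro mult_right_mono) auto
    then show ?thesis
      using complex_Re_le_cmod[of "ip (B u) u"] Cauchy_Schwarz[OF BH u] by (simp add: power2_eq_square)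
  qed
qed

lemma q_sums: "u \<in> H \<Longrightarrow> (\<lambda>k. p k * (cmod (ip u (h k)))\<^sup>2) sums q u"
  unfolding q_def by (rule B_form)

lemma q_upper:
  assumes u: "u \<in> H" and zero: "\<And>k. k < n \<Longrightarrow> ip u (h k) = 0"
  shows "q u \<le> p n * (1 + tail n)\<^sup>2 * (nrm u)\<^sup>2"
proof (rule LIMSEQ_le_const2)
  show "(\<lambda>m. \<Sum>k<m. p k * (cmod (ip u (h k)))\<^sup>2) \<longlonglongrightarrow> q u"
    using q_sums[OF u] by (simp add: sums_def)
  have "(\<Sum>k<m. p k * (cmod (ip u (h k)))\<^sup>2) \<le> p n * (1 + tail n)\<^sup>2 * (nrm u)\<^sup>2" for m
  proof -
    have F: "finite {n..<m}" "{n..<m} \<subseteq> {n..}" by auto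
    have "(\<Sum>k<m. p k * (cmod (ip u (h k)))\<^sup>2) = (\<Sum>k=n..<m. p k * (cmod (ip u (h k)))\<^sup>2)"
      using zero by (intro sum.mono_neutral_right) auto
    also have "\<dots> \<le> (\<Sum>k=n..<m. p n * (cmod (ip u (h k)))\<^sup>2)"
      using p_decseq by (intro sum_mono mult_right_mono) (auto simp: decseq_def)
    also have "\<dots> = p n * (L2_set (\<lambda>k. cmod (ip u (h k))) {n..<m})\<^sup>2"
      by (simp add: L2_set_def sum_nonneg sum_distrib_left)
    also have "\<dots> \<le> p n * ((1 + tail n) * nrm u)\<^sup>2"
      using p_pos[of n] by (intro mult_left_mono power_mono analysis_bound[OF u F]) auto
    finally show ?thesis by (simp add: power_mult_distrib)
  qed
  then show "\<exists>N. \<forall>m\<ge>N. (\<Sum>k<m. p k * (cmod (ip u (h k)))\<^sup>2) \<le> p n * (1 + tail n)\<^sup>2 * (nrm u)\<^sup>2" by blast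
qed

lemma q_lower:
  assumes u: "u = (\<Sum>k=N..N + n. c k \<odot> e k)"
  shows "p (N + n) * (1 - tail N)\<^sup>2 * (nrm u)\<^sup>2 \<le> q u"
proof -
  have F: "finite {N..N + n}" "{N..N + n} \<subseteq> {N..}" by auto
  have uH: "u \<in> H" by (simp add: u)
  have "p (N + n) * ((1 - tail N) * nrm u)\<^sup>2 \<le> p (N + n) * (L2_set (\<lambda>k. cmod (ip u (h k))) {N..N + n})\<^sup>2"
    using p_pos[of "N + n"] tail_le[of N] uH by (intro mult_left_mono power_mono analysis_lower_bound[OF F u]) auto
  also have "\<dots> = (\<Sum>k=N..N + n. p (N + n) * (cmod (ip u (h k)))\<^sup>2)"
    by (simp add: L2_set_def sum_nonneg sum_distrib_left)
  also have "\<dots> \<le> (\<Sum>k=N..N + n. p k * (cmod (ip u (h k)))\<^sup>2)"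
    using p_decseq by (intro sum_mono mult_right_mono) (auto simp: decseq_def)
  also have "\<dots> \<le> q u"
    using sum_le_suminf[OF sums_summable[OF q_sums[OF uH]], of "{N..N + n}"] sums_unique[OF q_sums[OF uH]]
      p_pos by (simp add: less_imp_le)
  finally show ?thesis by (simp add: power_mult_distrib)
qed

lemma e_combination_nonzero:
  assumes "finite K" "k \<in> K" "c k \<noteq> 0"
  shows "(\<Sum>k\<in>K. c k \<odot> e k) \<noteq> 0"
  using orthonormal_coefficient[OF assms(1) e_H assms(2) e_orthonormal, of c] assms(3) by auto

lemma q_positive_on_finite_codimension:
  fixes n :: nat
  assumes g: "\<And>j. j < n \<Longrightarrow> g j \<in> H"
  shows "\<exists>u\<in>H. (\<forall>j<n. ip u (g j) = 0) \<and> 0 < q u"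
proof -
  obtain a k where k: "k \<in> {0..0 + n}" "a k \<noteq> 0"
    and a: "\<And>i. i < n \<Longrightarrow> (\<Sum>k\<in>{0..0 + n}. a k * ip (e k) (g i)) = 0"
    using homogeneous_system_nontrivial[of "{0..0 + n}" n "\<lambda>i k. ip (e k) (g i)"] by auto
  define u where "u = (\<Sum>k=0..0 + n. a k \<odot> e k)"
  have u: "u \<in> H" by (simp add: u_def)
  have "nrm u \<noteq> 0" using e_combination_nonzero[of _ k a, OF _ k] nrm_eq_0[OF u] by (auto simp: u_def)
  then have "0 < p (0 + n) * (1 - tail 0)\<^sup>2 * (nrm u)\<^sup>2" using p_pos[of n] tail_le[of 0] by simp
  also have "\<dots> \<le> q u" by (rule q_lower[OF u_def])
  finally have "0 < q u" .
  moreover have "ip u (g j) = 0" if "j < n" for j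
    using a[OF that] g[OF that] by (simp add: u_def ip_sum_left)
  ultimately show ?thesis using u by blast
qed

text \<open>
  The bounds \<open>upper\<close> and \<open>lower\<close> come from the min-max principle: the upper one from the \<open>n\<close> conditions
  \<open>\<langle>u, h k\<rangle> = 0\<close> for \<open>k < n\<close>, the lower one from the span of \<open>e N, \<dots>, e (N + n)\<close>.  The shift by \<open>N\<close> makes
  the factor \<open>(1 - tail N)\<^sup>2\<close> as close to \<open>1\<close> as desired, and \<open>ratio\<close> says that it does not
  matter in the limit.
\<close>

theorem spectral_asymptotics:
  assumes ratio: "(\<lambda>j. p (Suc j) / p j) \<longlonglongrightarrow> 1"
  shows "\<exists>l. decseq l \<and> (\<forall>j. 0 < l j) \<and>
      (\<forall>t>0. finite {j. l j = t} \<and>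
         (\<exists>b. finite b \<and> {u\<in>H. B u = of_real t \<odot> u} \<subseteq> span b) \<and>
         card {j. l j = t} = dim {u\<in>H. B u = of_real t \<odot> u}) \<and>
      (\<lambda>j. l j / p j) \<longlonglongrightarrow> 1"
proof -
  obtain f :: "nat \<Rightarrow> 'v" where f: "\<And>n. f n \<in> H" "\<And>j k. ip (f j) (f k) = (if j = k then 1 else 0)"
    "\<And>n. B (f n) = of_real (q (f n)) \<odot> f n" "\<And>n. 0 < q (f n)"
    "\<And>n u. u \<in> H \<Longrightarrow> (\<And>j. j < n \<Longrightarrow> ip u (f j) = 0) \<Longrightarrow> q u \<le> q (f n) * (nrm u)\<^sup>2"
    using eigenvector_sequence[OF q_positive_on_finite_codimension] by blast
  interpret spectral_sequence scale H ip B "4 * p 0" f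
    by unfold_locales (use f in auto)
  define l where "l n = q (f n)" for n
  have upper: "l n \<le> p n * (1 + tail n)\<^sup>2" for n
    unfolding l_def using q_upper by (intro eigenvalue_le[of n h]) auto
  have lower: "p (N + n) * (1 - tail N)\<^sup>2 \<le> l n" for N n
    unfolding l_def
  proof (rule eigenvalue_ge)
    show "p (N + n) * (1 - tail N)\<^sup>2 * (nrm (\<Sum>k=N..N + n. a k \<odot> e k))\<^sup>2 \<le> q (\<Sum>k=N..N + n. a k \<odot> e k)" for a
      by (rule q_lower[OF refl])
  qed (use e_combination_nonzero in auto)
  have shift: "(\<lambda>j. p (N + j) / p j) \<longlonglongrightarrow> 1" for N
  proof (induction N)
    case 0
    have "p j \<noteq> 0" for j using p_pos[of j] by simp
    then show ?case by simp
  next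
    case (Suc N)
    have "(\<lambda>j. p (Suc (j + N)) / p (j + N)) \<longlonglongrightarrow> 1" using LIMSEQ_ignore_initial_segment[OF ratio, of N] by simp
    from tendsto_mult[OF this Suc] 
    have "(\<lambda>j. p (Suc (j + N)) / p (j + N) * (p (N + j) / p j)) \<longlonglongrightarrow> 1" by simp
    moreover have "p (Suc (j + N)) / p (j + N) * (p (N + j) / p j) = p (Suc N + j) / p j" for j
      using p_pos[of "N + j"] by (simp add: add.commute)
    ultimately show ?case by simp
  qed
  have "(\<lambda>n. l n / p n) \<longlonglongrightarrow> 1"
  proof (rule order_tendstoI)
    fix a :: real assume "1 < a"
    have "(\<lambda>n. (1 + tail n)\<^sup>2) \<longlonglongrightarrow> (1 + 0)\<^sup>2" by (intro tendsto_intros tail_limit)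
    then have "\<forall>\<^sub>F n in sequentially. (1 + tail n)\<^sup>2 < a" using \<open>1 < a\<close> by (auto dest: order_tendstoD)
    then show "\<forall>\<^sub>F n in sequentially. l n / p n < a"
    proof eventually_elim
      case (elim n)
      have "l n / p n \<le> (1 + tail n)\<^sup>2" using upper[of n] p_pos[of n] by (simp add: divide_le_eq mult.commute)
      with elim show ?case by linarith
    qed
  next
    fix a :: real assume "a < 1"
    have "(\<lambda>n. (1 - tail n)\<^sup>2) \<longlonglongrightarrow> (1 - 0)\<^sup>2" by (intro tendsto_intros tail_limit)
    then have "\<forall>\<^sub>F n in sequentially. a < (1 - tail n)\<^sup>2" using \<open>a < 1\<close> by (auto dest: order_tendstoD)
    then obtain N where N: "a < (1 - tail N)\<^sup>2" by (auto simp: eventually_sequentially)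
    have "(\<lambda>n. p (N + n) / p n * (1 - tail N)\<^sup>2) \<longlonglongrightarrow> 1 * (1 - tail N)\<^sup>2" by (intro tendsto_intros shift)
    then have "\<forall>\<^sub>F n in sequentially. a < p (N + n) / p n * (1 - tail N)\<^sup>2" using N by (auto dest: order_tendstoD)
    then show "\<forall>\<^sub>F n in sequentially. a < l n / p n"
    proof eventually_elim
      case (elim n)
      have "p (N + n) / p n * (1 - tail N)\<^sup>2 \<le> l n / p n"
        using lower[of N n] p_pos[of n] by (simp add: divide_right_mono)
      with elim show ?case by linarith
    qed
  qed
  moreover have lim: "(\<lambda>n. q (f n)) \<longlonglongrightarrow> 0"
  proof (rule tendsto_sandwich[OF _ _ tendsto_const])
    show "\<forall>\<^sub>F n in sequentially. 0 \<le> q (f n)" using f(4) by (simp add: less_imp_le)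
    show "\<forall>\<^sub>F n in sequentially. q (f n) \<le> p n * (1 + tail n)\<^sup>2" using upper by (simp add: l_def)
    have "(\<lambda>n. p n * (1 + tail n)\<^sup>2) \<longlonglongrightarrow> 0 * (1 + 0)\<^sup>2" by (intro tendsto_intros tail_limit p_limit)
    then show "(\<lambda>n. p n * (1 + tail n)\<^sup>2) \<longlonglongrightarrow> 0" by simp
  qed
  moreover have "\<exists>b. finite b \<and> {u\<in>H. B u = of_real t \<odot> u} \<subseteq> span b" if "t > 0" for t
    using eigenspace_eq_span[OF lim that] finite_level[OF lim that]
    by (intro exI[of _ "f ` {j. q (f j) = t}"]) auto
  ultimately show ?thesis
    using q_f_decseq f(4) finite_level[OF lim] eigenspace_dim[OF lim] unfolding l_def[abs_def]
    by (intro exI[of _ "\<lambda>n. q (f n)"]) auto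
qed

end


section \<open>Lattice functions of finite energy\<close>

definition edge_energy :: "'d::finite lfun \<Rightarrow> int ^ 'd \<Rightarrow> real" where
  "edge_energy u x = (\<Sum>j\<in>UNIV. (cmod (u (x + axis j 1) - u x))\<^sup>2)"

definition finite_energy :: "'d::finite lfun set" where
  "finite_energy = {u. edge_energy u summable_on UNIV}"

lemma Q0_eq: "Q0 u = infsum (edge_energy u) UNIV"
  by (simp add: Q0_def edge_energy_def[abs_def])

lemma edge_energy_nonneg [simp]: "0 \<le> edge_energy u x"
  by (simp add: edge_energy_def sum_nonneg)

lemma edge_energy_add_le: "edge_energy (u + v) x \<le> 2 * edge_energy u x + 2 * edge_energy v x"
proof -
  have "(cmod (a + b))\<^sup>2 \<le> 2 * (cmod a)\<^sup>2 + 2 * (cmod b)\<^sup>2" for a b :: complex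
  proof -
    have "(cmod (a + b))\<^sup>2 \<le> (cmod a + cmod b)\<^sup>2" by (intro power_mono norm_triangle_ineq) simp
    also have "\<dots> \<le> 2 * (cmod a)\<^sup>2 + 2 * (cmod b)\<^sup>2"
      using zero_le_power2[of "cmod a - cmod b"] by (simp add: power2_eq_square algebra_simps)
    finally show ?thesis .
  qed
  from this[of "u (x + axis j 1) - u x" "v (x + axis j 1) - v x" for j]
  have "(cmod ((u + v) (x + axis j 1) - (u + v) x))\<^sup>2
      \<le> 2 * (cmod (u (x + axis j 1) - u x))\<^sup>2 + 2 * (cmod (v (x + axis j 1) - v x))\<^sup>2" for j
    by (simp add: algebra_simps)
  then show ?thesis
    unfolding edge_energy_def sum_distrib_left sum.distrib[symmetric] by (rule sum_mono)
qed

lemma edge_energy_fscale: "edge_energy (fscale c u) x = (cmod c)\<^sup>2 * edge_energy u x"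
proof -
  have "cmod (c * a - c * b) = cmod c * cmod (a - b)" for a b
    by (simp flip: norm_mult add: right_diff_distrib)
  then show ?thesis by (simp add: edge_energy_def fscale_def power_mult_distrib sum_distrib_left)
qed

lemma finite_energy_subspace: "fvec.subspace finite_energy"
  unfolding fvec.subspace_def
proof (intro conjI ballI allI)
  show "0 \<in> finite_energy" by (simp add: finite_energy_def edge_energy_def[abs_def])
  show "u + v \<in> finite_energy" if "u \<in> finite_energy" "v \<in> finite_energy" for u v :: "'a lfun"
  proof -
    have "(\<lambda>x. 2 * edge_energy u x + 2 * edge_energy v x) summable_on UNIV"
      using that by (intro summable_on_add summable_on_cmult_right) (auto simp: finite_energy_def)
    then show ?thesis unfolding finite_energy_def mem_Collect_eq
      by (rule summable_on_comparison_test) (auto simp: edge_energy_add_le)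
  qed
  show "fscale c u \<in> finite_energy" if "u \<in> finite_energy" for c and u :: "'a lfun"
    using that by (auto simp: finite_energy_def edge_energy_fscale[abs_def] intro: summable_on_cmult_right)
qed

definition edge_product :: "'d::finite lfun \<Rightarrow> 'd lfun \<Rightarrow> int ^ 'd \<Rightarrow> complex" where
  "edge_product u v x = (\<Sum>j\<in>UNIV. (u (x + axis j 1) - u x) * cnj (v (x + axis j 1) - v x))"

lemma H1_inner_eq: "H1_inner u v = infsum (edge_product u v) UNIV"
  by (simp add: H1_inner_def edge_product_def[abs_def])

lemma edge_product_summable:
  assumes "u \<in> finite_energy" "v \<in> finite_energy"
  shows "edge_product u v summable_on UNIV"
proof (rule abs_summable_summable, rule Infinite_Sum.abs_summable_on_comparison_test')
  show "(\<lambda>x. edge_energy u x + edge_energy v x) summable_on UNIV"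
    using assms by (intro summable_on_add) (auto simp: finite_energy_def)
  fix x
  have ab: "a * b \<le> a\<^sup>2 + b\<^sup>2" for a b :: real
    using zero_le_power2[of "a - b"] zero_le_power2[of a] zero_le_power2[of b]
    unfolding power2_diff by linarith
  have "cmod (edge_product u v x)
      \<le> (\<Sum>j\<in>UNIV. cmod (u (x + axis j 1) - u x) * cmod (v (x + axis j 1) - v x))"
    unfolding edge_product_def
    by (rule order_trans[OF norm_sum]) (simp add: norm_mult flip: complex_cnj_diff)
  also have "\<dots> \<le> edge_energy u x + edge_energy v x"
    unfolding edge_energy_def sum.distrib[symmetric] by (intro sum_mono ab)
  finally show "norm (edge_product u v x) \<le> edge_energy u x + edge_energy v x" .
qed

lemma H1_inner_self:
  assumes "u \<in> finite_energy"
  shows "H1_inner u u = of_real (Q0 u)"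
proof -
  have "edge_product u u = (\<lambda>x. of_real (edge_energy u x))"
    unfolding edge_product_def[abs_def] edge_energy_def[abs_def] of_real_sum complex_norm_square ..
  moreover have "((\<lambda>x. complex_of_real (edge_energy u x)) has_sum of_real (Q0 u)) UNIV"
    unfolding Q0_eq using assms by (intro has_sum_of_real has_sum_infsum) (simp add: finite_energy_def)
  ultimately show ?thesis unfolding H1_inner_eq by (simp add: infsumI)
qed

interpretation energy: inner_space fscale "finite_energy :: 'd::finite lfun set" H1_inner
proof
  show "fvec.subspace (finite_energy :: 'd lfun set)" by (rule finite_energy_subspace)
next
  fix u v w :: "'d lfun"
  assume *: "u \<in> finite_energy" "v \<in> finite_energy" "w \<in> finite_energy"
  have "edge_product (u + v) w = (\<lambda>x. edge_product u w x + edge_product v w x)"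
    by (simp add: fun_eq_iff edge_product_def sum.distrib[symmetric] algebra_simps)
  then show "H1_inner (u + v) w = H1_inner u w + H1_inner v w"
    unfolding H1_inner_eq using * by (simp add: infsum_add edge_product_summable)
next
  fix c and u v :: "'d lfun"
  assume *: "u \<in> finite_energy" "v \<in> finite_energy"
  have "edge_product (fscale c u) v = (\<lambda>x. c * edge_product u v x)"
    by (simp add: fun_eq_iff edge_product_def fscale_def sum_distrib_left algebra_simps)
  then show "H1_inner (fscale c u) v = c * H1_inner u v"
    unfolding H1_inner_eq by (simp add: infsum_cmult_right')
next
  fix u v :: "'d lfun"
  have "edge_product v u = (\<lambda>x. cnj (edge_product u v x))"
    by (simp add: fun_eq_iff edge_product_def mult.commute)
  then show "H1_inner v u = cnj (H1_inner u v)"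
    unfolding H1_inner_eq by (simp flip: infsum_cnj)
next
  fix u :: "'d lfun"
  assume "u \<in> finite_energy"
  then show "0 \<le> Re (H1_inner u u)"
    by (simp add: H1_inner_self Q0_eq infsum_nonneg)
qed

lemma energy_nrm: "u \<in> finite_energy \<Longrightarrow> energy.nrm u = H1_norm u"
  by (simp add: energy.nrm_def H1_norm_def H1_inner_self)

lemma Q0_energy_nrm: "u \<in> finite_energy \<Longrightarrow> Q0 u = (energy.nrm u)\<^sup>2"
  by (simp add: energy.nrm_sq H1_inner_self)

definition finitely_supported :: "('a \<Rightarrow> complex) \<Rightarrow> bool" where
  "finitely_supported u \<longleftrightarrow> finite {x. u x \<noteq> 0}"

lemma finitely_supported_closed:
  assumes "finitely_supported u" "finitely_supported v"
  shows "finitely_supported (u + v)" "finitely_supported (u - v)" "finitely_supported (fscale c u)"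
proof -
  have "finite ({x. u x \<noteq> 0} \<union> {x. v x \<noteq> 0})" using assms by (simp add: finitely_supported_def)
  moreover have "{x. (u + v) x \<noteq> 0} \<subseteq> {x. u x \<noteq> 0} \<union> {x. v x \<noteq> 0}"
    "{x. (u - v) x \<noteq> 0} \<subseteq> {x. u x \<noteq> 0} \<union> {x. v x \<noteq> 0}"
    "{x. fscale c u x \<noteq> 0} \<subseteq> {x. u x \<noteq> 0} \<union> {x. v x \<noteq> 0}" by (auto simp: fscale_def)
  ultimately show "finitely_supported (u + v)" "finitely_supported (u - v)" "finitely_supported (fscale c u)"
    unfolding finitely_supported_def using finite_subset by blast+
qed

lemma finitely_supported_shift:
  fixes u :: "'a::ab_group_add \<Rightarrow> complex"
  assumes "finitely_supported u"
  shows "finitely_supported (\<lambda>x. u (x + a))" "finitely_supported (\<lambda>x. u (x - a))"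
proof -
  have "{x. u (x + a) \<noteq> 0} \<subseteq> (\<lambda>x. x - a) ` {x. u x \<noteq> 0}"
    "{x. u (x - a) \<noteq> 0} \<subseteq> (\<lambda>x. x + a) ` {x. u x \<noteq> 0}"
    by (auto intro: image_eqI[of _ _ "x + a" for x] image_eqI[of _ _ "x - a" for x])
  then show "finitely_supported (\<lambda>x. u (x + a))" "finitely_supported (\<lambda>x. u (x - a))"
    using assms unfolding finitely_supported_def by (meson finite_imageI finite_subset)+
qed

lemma finitely_supported_finite_energy:
  fixes u :: "'d::finite lfun"
  assumes "finitely_supported u"
  shows "u \<in> finite_energy"
proof -
  let ?S = "{x. u x \<noteq> 0} \<union> (\<Union>j. {x. u (x + axis j 1) \<noteq> 0})"
  have "finite ?S"
    using assms finitely_supported_shift(1)[OF assms] by (auto simp: finitely_supported_def)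
  moreover have "{x \<in> UNIV. edge_energy u x \<noteq> 0} \<subseteq> ?S"
    by (auto simp: edge_energy_def intro: ccontr)
  ultimately show ?thesis
    unfolding finite_energy_def mem_Collect_eq
    by (intro finite_nonzero_values_imp_summable_on) (rule finite_subset)
qed

text \<open>Fatou's lemma: pointwise limits do not increase the energy.\<close>

lemma energy_Fatou:
  assumes f: "\<And>n. f n \<in> finite_energy" and lim: "\<And>x. (\<lambda>n. f n x) \<longlonglongrightarrow> u x"
    and le: "\<And>n. n \<ge> N \<Longrightarrow> Q0 (f n) \<le> c"
  shows "u \<in> finite_energy" "Q0 u \<le> c"
proof -
  have bound: "sum (edge_energy u) F \<le> c" if F: "finite F" for F
  proof (rule LIMSEQ_le_const2)
    show "(\<lambda>n. sum (edge_energy (f n)) F) \<longlonglongrightarrow> sum (edge_energy u) F"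
      unfolding edge_energy_def by (intro tendsto_intros lim)
    have "sum (edge_energy (f n)) F \<le> c" if "n \<ge> N" for n
      using finite_sum_le_infsum[of "edge_energy (f n)" UNIV F] f[of n] F le[OF that]
      by (simp add: finite_energy_def Q0_eq)
    then show "\<exists>N. \<forall>n\<ge>N. sum (edge_energy (f n)) F \<le> c" by blast
  qed
  then have "edge_energy u summable_on UNIV"
    by (intro nonneg_bdd_above_summable_on) (auto simp: bdd_above_def)
  then show "u \<in> finite_energy" "Q0 u \<le> c"
    unfolding finite_energy_def Q0_eq using bound by (auto intro: infsum_le_finite_sums)
qed

text \<open>
  Fatou's lemma, applied to \<open>\<phi> n - \<phi> m\<close> with \<open>m\<close> tending to infinity, turns the Cauchy condition into
  convergence to the pointwise limit.
\<close>

lemma energy_Cauchy_limit: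
  assumes fin: "\<And>n. \<phi> n \<in> finite_energy" and lim: "\<And>x. (\<lambda>n. \<phi> n x) \<longlonglongrightarrow> u x"
    and cauchy: "\<And>e. e > 0 \<Longrightarrow> \<exists>N. \<forall>m\<ge>N. \<forall>n\<ge>N. Q0 (\<phi> m - \<phi> n) < e"
  shows "u \<in> finite_energy" "energy.tends \<phi> u"
proof -
  have close: "\<exists>N. \<forall>n\<ge>N. \<phi> n - u \<in> finite_energy \<and> Q0 (\<phi> n - u) \<le> e" if e: "e > 0" for e
  proof -
    obtain N where N: "\<And>m n. m \<ge> N \<Longrightarrow> n \<ge> N \<Longrightarrow> Q0 (\<phi> n - \<phi> m) < e" using cauchy[OF e] by blast
    have "\<phi> n - u \<in> finite_energy \<and> Q0 (\<phi> n - u) \<le> e" if "n \<ge> N" for n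
    proof -
      have d: "\<phi> n - \<phi> m \<in> finite_energy" for m using fin by simp
      have l: "(\<lambda>m. (\<phi> n - \<phi> m) x) \<longlonglongrightarrow> (\<phi> n - u) x" for x
        unfolding fun_diff_def by (intro tendsto_intros lim)
      have le: "Q0 (\<phi> n - \<phi> m) \<le> e" if "m \<ge> N" for m
        using N[OF that \<open>n \<ge> N\<close>] by (rule less_imp_le)
      show ?thesis by (rule conjI[OF energy_Fatou[OF d l le]])
    qed
    then show ?thesis by blast
  qed
  obtain N where "\<phi> N - u \<in> finite_energy" using close[of 1] by auto
  from energy.H_closed(3)[OF fin[of N] this] show u: "u \<in> finite_energy" by simp
  show "energy.tends \<phi> u"
    unfolding energy.tends_def
  proof (rule LIMSEQ_I)
    fix e :: real assume "e > 0"
    then obtain N where N: "\<And>n. n \<ge> N \<Longrightarrow> Q0 (\<phi> n - u) \<le> (e / 2)\<^sup>2" using close[of "(e / 2)\<^sup>2"] by auto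
    have "energy.nrm (\<phi> n - u) \<le> e / 2" if "n \<ge> N" for n
      using N[OF that] fin u \<open>e > 0\<close> by - (rule power2_le_imp_le, simp_all add: Q0_energy_nrm)
    with \<open>e > 0\<close> have "energy.nrm (\<phi> n - u) < e" if "n \<ge> N" for n using that by force
    then show "\<exists>N. \<forall>n\<ge>N. norm (energy.nrm (\<phi> n - u) - 0) < e" using fin u by auto
  qed
qed

lemma H1_approximation:
  assumes "u \<in> H1"
  obtains \<phi> where "\<And>n. finitely_supported (\<phi> n)" "u \<in> finite_energy"
    "energy.tends \<phi> u" "\<And>x. (\<lambda>n. \<phi> n x) \<longlonglongrightarrow> u x"
proof -
  obtain \<phi> where \<phi>: "\<And>n. finitely_supported (\<phi> n)" "\<And>x. (\<lambda>n. \<phi> n x) \<longlonglongrightarrow> u x"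
    and cauchy: "\<And>e. e > 0 \<Longrightarrow> \<exists>N. \<forall>m\<ge>N. \<forall>n\<ge>N. Q0 (\<phi> m - \<phi> n) < e"
    using assms unfolding H1_def finitely_supported_def by auto
  with energy_Cauchy_limit[OF finitely_supported_finite_energy[OF \<phi>(1)] \<phi>(2) cauchy] that
  show thesis by blast
qed

lemma H1_finite_energy: "u \<in> H1 \<Longrightarrow> u \<in> finite_energy"
  by (erule H1_approximation)

lemma H1I:
  assumes \<phi>: "\<And>n. finitely_supported (\<phi> n)" and u: "u \<in> finite_energy"
    and t: "energy.tends \<phi> u" and lim: "\<And>x. (\<lambda>n. \<phi> n x) \<longlonglongrightarrow> u x"
  shows "u \<in> H1"
  unfolding H1_def mem_Collect_eq
proof (rule exI[of _ \<phi>], intro conjI allI impI)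
  have fin: "\<phi> n \<in> finite_energy" for n by (intro finitely_supported_finite_energy \<phi>)
  fix e :: real assume e: "e > 0"
  then have "sqrt e / 2 > 0" by simp
  from order_tendstoD(2)[OF t[unfolded energy.tends_def] this]
  obtain N where N: "\<And>n. n \<ge> N \<Longrightarrow> energy.nrm (\<phi> n - u) < sqrt e / 2" by (auto simp: eventually_sequentially)
  have "Q0 (\<phi> m - \<phi> n) < e" if "m \<ge> N" "n \<ge> N" for m n
  proof -
    have "energy.nrm (\<phi> m - \<phi> n) < sqrt e"
      using energy.nrm_triangle_diff[OF fin u fin, of m n] energy.nrm_minus_commute[OF u fin, of n]
        N[OF that(1)] N[OF that(2)] by simp
    then have "(energy.nrm (\<phi> m - \<phi> n))\<^sup>2 < (sqrt e)\<^sup>2" using fin by (intro power_strict_mono) auto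
    then show ?thesis using e fin by (simp add: Q0_energy_nrm)
  qed
  then show "\<exists>N. \<forall>m\<ge>N. \<forall>n\<ge>N. Q0 (\<phi> m - \<phi> n) < e" by blast
qed (use \<phi> lim in \<open>auto simp: finitely_supported_def\<close>)

lemma finitely_supported_H1: "finitely_supported u \<Longrightarrow> u \<in> H1"
  by (rule H1I[of "\<lambda>_. u"]) (auto simp: finitely_supported_finite_energy energy.tends_def)

lemma H1_subspace: "fvec.subspace (H1 :: 'd::finite lfun set)"
  unfolding fvec.subspace_def
proof (intro conjI ballI allI)
  show "(0 :: 'd lfun) \<in> H1" by (rule finitely_supported_H1) (simp add: finitely_supported_def)
next
  fix u v :: "'d lfun" assume "u \<in> H1" "v \<in> H1"
  then obtain \<phi> \<psi> where
    \<phi>: "\<And>n. finitely_supported (\<phi> n)" "u \<in> finite_energy" "energy.tends \<phi> u" "\<And>x. (\<lambda>n. \<phi> n x) \<longlonglongrightarrow> u x" and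
    \<psi>: "\<And>n. finitely_supported (\<psi> n)" "v \<in> finite_energy" "energy.tends \<psi> v" "\<And>x. (\<lambda>n. \<psi> n x) \<longlonglongrightarrow> v x"
    by (metis H1_approximation)
  show "u + v \<in> H1"
  proof (rule H1I)
    show "energy.tends (\<lambda>n. \<phi> n + \<psi> n) (u + v)"
      using \<phi> \<psi> by (intro energy.tends_add) (auto simp: finitely_supported_finite_energy)
  qed (use \<phi> \<psi> in \<open>auto intro!: finitely_supported_closed tendsto_intros\<close>)
next
  fix c and u :: "'d lfun" assume "u \<in> H1"
  then obtain \<phi> where
    \<phi>: "\<And>n. finitely_supported (\<phi> n)" "u \<in> finite_energy" "energy.tends \<phi> u" "\<And>x. (\<lambda>n. \<phi> n x) \<longlonglongrightarrow> u x"
    by (metis H1_approximation)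
  show "fscale c u \<in> H1"
  proof (rule H1I)
    show "energy.tends (\<lambda>n. fscale c (\<phi> n)) (fscale c u)"
      using \<phi> by (intro energy.tends_scale) (auto simp: finitely_supported_finite_energy)
    show "(\<lambda>n. fscale c (\<phi> n) x) \<longlonglongrightarrow> fscale c u x" for x
      unfolding fscale_def by (intro tendsto_intros \<phi>)
  qed (use \<phi> in \<open>auto intro!: finitely_supported_closed\<close>)
qed

lemma infsum_shift:
  fixes f :: "'a::ab_group_add \<Rightarrow> 'b::{comm_monoid_add, t2_space}"
  shows "infsum (\<lambda>x. f (x + a)) UNIV = infsum f UNIV"
  by (rule infsum_reindex_bij_witness[of _ "\<lambda>x. x - a" "\<lambda>x. x + a"]) auto

lemma summable_on_shift:
  fixes f :: "'a::ab_group_add \<Rightarrow> 'b::{comm_monoid_add, t2_space}"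
  shows "(\<lambda>x. f (x + a)) summable_on UNIV \<longleftrightarrow> f summable_on UNIV"
  by (rule summable_on_reindex_bij_witness[of _ "\<lambda>x. x - a" "\<lambda>x. x + a"]) auto

lemma infsum_sum_swap:
  fixes f :: "'j \<Rightarrow> 'a \<Rightarrow> 'b::{topological_comm_monoid_add, t2_space}"
  assumes "\<And>j. f j summable_on A"
  shows "(\<Sum>\<^sub>\<infinity>x\<in>A. \<Sum>j\<in>J. f j x) = (\<Sum>j\<in>J. infsum (f j) A)"
proof -
  have "((\<lambda>x. \<Sum>j\<in>J. f j x) has_sum (\<Sum>j\<in>J. infsum (f j) A)) A"
    using assms by (induction J rule: infinite_finite_induct) (auto intro: has_sum_add)
  then show ?thesis by (rule infsumI)
qed

definition translate :: "int ^ 'd \<Rightarrow> 'd::finite lfun \<Rightarrow> 'd lfun" where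
  "translate y u = (\<lambda>x. u (x - y))"

lemma translate_inner: "H1_inner (translate y u) (translate y v) = H1_inner u v"
proof -
  have "edge_product (translate y u) (translate y v) = (\<lambda>x. edge_product u v (x + - y))"
    by (simp add: fun_eq_iff edge_product_def translate_def algebra_simps)
  then show ?thesis unfolding H1_inner_eq by (simp only: infsum_shift)
qed

lemma translate_finite_energy: "u \<in> finite_energy \<Longrightarrow> translate y u \<in> finite_energy"
proof -
  have "edge_energy (translate y u) = (\<lambda>x. edge_energy u (x + - y))"
    by (simp add: fun_eq_iff edge_energy_def translate_def algebra_simps)
  then show "u \<in> finite_energy \<Longrightarrow> translate y u \<in> finite_energy"
    unfolding finite_energy_def by (simp only: mem_Collect_eq summable_on_shift)
qed

lemma translate_diff: "translate y u - translate y v = translate y (u - v)"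
  by (simp add: translate_def fun_eq_iff)

lemma translate_H1: "u \<in> H1 \<Longrightarrow> translate y u \<in> H1"
proof (erule H1_approximation)
  fix \<phi> assume \<phi>: "\<And>n. finitely_supported (\<phi> n)" "u \<in> finite_energy" "energy.tends \<phi> u"
    "\<And>x. (\<lambda>n. \<phi> n x) \<longlonglongrightarrow> u x"
  show "translate y u \<in> H1"
  proof (rule H1I)
    show "finitely_supported (translate y (\<phi> n))" for n
      unfolding translate_def by (intro finitely_supported_shift \<phi>)
    show "energy.tends (\<lambda>n. translate y (\<phi> n)) (translate y u)"
      using \<phi>(3) by (simp add: energy.tends_def energy.nrm_def translate_diff translate_inner)
    show "(\<lambda>n. translate y (\<phi> n) x) \<longlonglongrightarrow> translate y u x" for x
      unfolding translate_def by (rule \<phi>)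
  qed (rule translate_finite_energy[OF \<phi>(2)])
qed

text \<open>
  Summation by parts; the sum over \<open>j\<close> on the right-hand side is the positive lattice Laplacian of \<open>u\<close>.  The
  finite support of \<open>v\<close> makes all rearrangements legitimate for arbitrary \<open>u\<close>.
\<close>

lemma inner_by_parts:
  fixes u v :: "'d::finite lfun"
  assumes v: "finitely_supported v"
  shows "H1_inner u v =
    (\<Sum>\<^sub>\<infinity>x. (\<Sum>j\<in>UNIV. 2 * u x - u (x + axis j 1) - u (x - axis j 1)) * cnj (v x))"
proof -
  have sm: "(\<lambda>x. g x * cnj (v x)) summable_on UNIV" for g :: "int ^ 'd \<Rightarrow> complex"
    using v unfolding finitely_supported_def
    by (intro finite_nonzero_values_imp_summable_on) (auto elim: rev_finite_subset)
  have sm': "(\<lambda>x. g x * cnj (v (x + a))) summable_on UNIV" for g and a :: "int ^ 'd"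
    using summable_on_shift[of "\<lambda>x. g (x - a) * cnj (v x)" a] sm[of "\<lambda>x. g (x - a)"] by simp
  have j: "(\<Sum>\<^sub>\<infinity>x. (u (x + a) - u x) * cnj (v (x + a) - v x))
      = (\<Sum>\<^sub>\<infinity>x. (2 * u x - u (x + a) - u (x - a)) * cnj (v x))"
    and js: "(\<lambda>x. (u (x + a) - u x) * cnj (v (x + a) - v x)) summable_on UNIV" for a
  proof -
    have eq: "(u (x + a) - u x) * cnj (v (x + a) - v x)
        = (u (x + a) - u x) * cnj (v (x + a)) + (u x - u (x + a)) * cnj (v x)" for x
      by (simp add: algebra_simps)
    show "(\<lambda>x. (u (x + a) - u x) * cnj (v (x + a) - v x)) summable_on UNIV"
      unfolding eq by (intro summable_on_add sm sm')
    have "(\<Sum>\<^sub>\<infinity>x. (u (x + a) - u x) * cnj (v (x + a) - v x))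
        = (\<Sum>\<^sub>\<infinity>x. (u (x + a) - u x) * cnj (v (x + a))) + (\<Sum>\<^sub>\<infinity>x. (u x - u (x + a)) * cnj (v x))"
      unfolding eq by (rule infsum_add[OF sm' sm])
    also have "(\<Sum>\<^sub>\<infinity>x. (u (x + a) - u x) * cnj (v (x + a))) = (\<Sum>\<^sub>\<infinity>x. (u x - u (x - a)) * cnj (v x))"
      using infsum_shift[of "\<lambda>x. (u x - u (x - a)) * cnj (v x)" a] by simp
    also have "\<dots> + (\<Sum>\<^sub>\<infinity>x. (u x - u (x + a)) * cnj (v x))
        = (\<Sum>\<^sub>\<infinity>x. (u x - u (x - a)) * cnj (v x) + (u x - u (x + a)) * cnj (v x))"
      by (rule infsum_add[OF sm sm, symmetric])
    also have "\<dots> = (\<Sum>\<^sub>\<infinity>x. (2 * u x - u (x + a) - u (x - a)) * cnj (v x))"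
      by (rule infsum_cong) (simp add: algebra_simps)
    finally show "(\<Sum>\<^sub>\<infinity>x. (u (x + a) - u x) * cnj (v (x + a) - v x))
      = (\<Sum>\<^sub>\<infinity>x. (2 * u x - u (x + a) - u (x - a)) * cnj (v x))" .
  qed
  have "H1_inner u v = (\<Sum>j\<in>UNIV. \<Sum>\<^sub>\<infinity>x. (u (x + axis j 1) - u x) * cnj (v (x + axis j 1) - v x))"
    unfolding H1_inner_def using js by (intro infsum_sum_swap)
  also have "\<dots> = (\<Sum>j\<in>UNIV. \<Sum>\<^sub>\<infinity>x. (2 * u x - u (x + axis j 1) - u (x - axis j 1)) * cnj (v x))"
    by (simp only: j)
  also have "\<dots> = (\<Sum>\<^sub>\<infinity>x. \<Sum>j\<in>UNIV. (2 * u x - u (x + axis j 1) - u (x - axis j 1)) * cnj (v x))"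
    using sm by (intro infsum_sum_swap[symmetric])
  finally show ?thesis by (simp only: sum_distrib_right)
qed


section \<open>The lattice Green function as the potential of a random walk\<close>

subsection \<open>Integrals of products over the torus\<close>

lemma prod_Basis_cart:
  fixes G :: "real ^ 'd \<Rightarrow> 'c::comm_monoid_mult"
  shows "(\<Prod>b\<in>Basis. G b) = (\<Prod>j\<in>UNIV. G (axis j 1))"
proof -
  have Basis: "(Basis :: (real ^ 'd) set) = range (\<lambda>j. axis j 1)" by (auto simp: Basis_vec_def)
  have inj: "inj (\<lambda>j :: 'd. axis j (1 :: real))" by (auto simp: inj_def axis_eq_axis)
  show ?thesis unfolding Basis prod.reindex[OF inj] by simp
qed

lemma integral_prod_cart:
  fixes f :: "'d::finite \<Rightarrow> real \<Rightarrow> complex"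
  assumes f: "\<And>j. integrable lborel (f j)"
  shows "(\<integral>z. (\<Prod>j\<in>UNIV. f j (z $ j)) \<partial>(lborel :: (real ^ 'd) measure)) = (\<Prod>j\<in>UNIV. integral\<^sup>L lborel (f j))"
proof -
  define F where "F b = f (axis_index b)" for b :: "real ^ 'd"
  have [measurable]: "F b \<in> borel_measurable borel" for b
    using borel_measurable_integrable[OF f[of "axis_index b"]] by (simp add: F_def)
  interpret product_sigma_finite "\<lambda>b :: real ^ 'd. lborel :: real measure" by standard
  have "(\<integral>z. (\<Prod>j\<in>UNIV. f j (z $ j)) \<partial>(lborel :: (real ^ 'd) measure))
      = (\<integral>z. (\<Prod>b\<in>Basis. F b (z \<bullet> b)) \<partial>(lborel :: (real ^ 'd) measure))"
    by (simp add: prod_Basis_cart F_def axis_index_axis cart_eq_inner_axis)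
  also have "\<dots> = (\<integral>g. (\<Prod>b\<in>Basis. F b ((\<Sum>c\<in>Basis. g c *\<^sub>R c) \<bullet> b)) \<partial>(\<Pi>\<^sub>M b\<in>(Basis :: (real ^ 'd) set). lborel))"
    by (subst lborel_eq) (subst integral_distr; simp)
  also have "\<dots> = (\<integral>g. (\<Prod>b\<in>Basis. F b (g b)) \<partial>(\<Pi>\<^sub>M b\<in>(Basis :: (real ^ 'd) set). lborel))"
    by simp
  also have "\<dots> = (\<Prod>b\<in>(Basis :: (real ^ 'd) set). integral\<^sup>L lborel (F b))"
    using f by (intro product_integral_prod) (auto simp: F_def)
  finally show ?thesis by (simp add: prod_Basis_cart F_def axis_index_axis)
qed

lemma nn_integral_prod_cart:
  fixes f :: "'d::finite \<Rightarrow> real \<Rightarrow> real"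
  assumes f: "\<And>j. f j \<in> borel_measurable borel" "\<And>j t. 0 \<le> f j t"
  shows "(\<integral>\<^sup>+z. ennreal (\<Prod>j\<in>UNIV. f j (z $ j)) \<partial>(lborel :: (real ^ 'd) measure))
      = (\<Prod>j\<in>UNIV. \<integral>\<^sup>+t. ennreal (f j t) \<partial>lborel)"
proof -
  have "(\<integral>\<^sup>+z. (\<Prod>b\<in>Basis. ennreal (f (axis_index b) (z \<bullet> b))) \<partial>(lborel :: (real ^ 'd) measure))
      = (\<Prod>b\<in>(Basis :: (real ^ 'd) set). \<integral>\<^sup>+t. ennreal (f (axis_index b) t) \<partial>lborel)"
    using f by (intro nn_integral_lborel_prod) auto
  then show ?thesis
    using f by (simp add: prod_Basis_cart axis_index_axis prod_ennreal flip: cart_eq_inner_axis)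
qed

definition torus :: "(real ^ 'd::finite) set" where
  "torus = cbox 0 (\<chi> j. 2 * pi)"

lemma mem_torus: "z \<in> torus \<longleftrightarrow> (\<forall>j. 0 \<le> z $ j \<and> z $ j \<le> 2 * pi)"
  by (simp add: torus_def mem_box_cart)

lemma indicator_torus: "indicator torus z = (\<Prod>j\<in>UNIV. indicator {0..2 * pi} (z $ j) :: 'a::comm_semiring_1)"
proof (cases "z \<in> torus")
  case False
  then obtain j where "\<not> (0 \<le> z $ j \<and> z $ j \<le> 2 * pi)" by (auto simp: mem_torus)
  then have "(\<Prod>j\<in>UNIV. indicator {0..2 * pi} (z $ j) :: 'a) = 0"
    by (intro prod_zero bexI[of _ j]) auto
  with False show ?thesis by simp
qed (simp add: mem_torus)

lemma torus_sets [measurable]: "torus \<in> sets borel"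
  by (simp add: torus_def)

lemma set_integrable_torus:
  fixes f :: "real ^ 'd::finite \<Rightarrow> 'b::{banach, second_countable_topology}"
  assumes "continuous_on UNIV f"
  shows "set_integrable lborel torus f"
  unfolding set_integrable_def torus_def
  by (rule borel_integrable_compact) (auto intro: continuous_on_subset[OF assms])

definition character :: "int ^ 'd \<Rightarrow> real ^ 'd::finite \<Rightarrow> complex" where
  "character x z = exp (\<i> * of_real (\<Sum>j\<in>UNIV. real_of_int (x $ j) * z $ j))"

lemma norm_character [simp]: "norm (character x z) = 1"
  by (simp add: character_def norm_exp_i_times)

lemma character_zero [simp]: "character 0 z = 1"
  by (simp add: character_def)

lemma character_add: "character (x + y) z = character x z * character y z"
  by (simp add: character_def sum.distrib distrib_left distrib_right exp_add)

lemma character_axis: "character (axis j 1) z = exp (\<i> * of_real (z $ j))"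
proof -
  have "(\<Sum>i\<in>UNIV. real_of_int (axis j 1 $ i) * z $ i) = (\<Sum>i\<in>UNIV. if j = i then z $ i else 0)"
    by (rule sum.cong) (auto simp: axis_def)
  then show ?thesis by (simp add: character_def)
qed

lemma character_minus: "character (- x) z = cnj (character x z)"
  by (simp add: character_def exp_cnj sum_negf)

lemma continuous_character [continuous_intros]: "continuous_on A (character x)"
  unfolding character_def[abs_def] by (intro continuous_intros)

lemma integral_exp_circle:
  "(\<integral>t. indicator {0..2 * pi} t *\<^sub>R exp (\<i> * of_real (real_of_int n * t)) \<partial>lborel)
    = (if n = 0 then of_real (2 * pi) else 0)"
proof (cases "n = 0")
  case True
  have "(\<integral>t. indicator {0..2 * pi} t *\<^sub>R (1 :: complex) \<partial>lborel) = of_real (2 * pi) - of_real 0"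
    by (rule integral_FTC_Icc) (auto intro!: derivative_eq_intros simp: has_vector_derivative_of_real)
  with True show ?thesis by simp
next
  case False
  define c where "c = \<i> * of_int n"
  have c: "c \<noteq> 0" using False by (simp add: c_def)
  have arg: "\<i> * of_real (real_of_int n * t) = c * of_real t" for t by (simp add: c_def)
  let ?F = "\<lambda>t. exp (c * of_real t) / c"
  have "(\<integral>t. indicator {0..2 * pi} t *\<^sub>R exp (\<i> * of_real (real_of_int n * t)) \<partial>lborel) = ?F (2 * pi) - ?F 0"
    unfolding arg
  proof (rule integral_FTC_Icc)
    fix t
    have "((\<lambda>z. exp (c * z) / c) has_field_derivative exp (c * of_real t)) (at (of_real t))"
      using c by (auto intro!: derivative_eq_intros)
    from has_vector_derivative_real_field[OF this]
    show "(?F has_vector_derivative exp (c * of_real t)) (at t within {0..2 * pi})" by simp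
  qed (auto intro!: continuous_intros)
  also have "exp (c * of_real (2 * pi)) = 1"
    using exp_integer_2pi[of "of_int n"] by (simp add: c_def mult_ac)
  finally show ?thesis using False by simp
qed

lemma character_orthogonality:
  "(LINT z:torus|lborel. character x z) = (if x = 0 then of_real ((2 * pi) ^ CARD('d)) else 0)"
  for x :: "int ^ 'd::finite"
proof -
  have "indicator torus z *\<^sub>R character x z
      = (\<Prod>j\<in>UNIV. indicator {0..2 * pi} (z $ j) *\<^sub>R exp (\<i> * of_real (real_of_int (x $ j) * z $ j)))" for z
    by (simp add: indicator_torus character_def exp_sum sum_distrib_left scaleR_conv_of_real
        prod.distrib of_real_prod)
  then have "(LINT z:torus|lborel. character x z)
      = (\<integral>z. (\<Prod>j\<in>UNIV. indicator {0..2 * pi} (z $ j) *\<^sub>R exp (\<i> * of_real (real_of_int (x $ j) * z $ j))) \<partial>lborel)"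
    by (simp add: set_lebesgue_integral_def)
  also have "\<dots> = (\<Prod>j\<in>UNIV. \<integral>t. indicator {0..2 * pi} t *\<^sub>R exp (\<i> * of_real (real_of_int (x $ j) * t)) \<partial>lborel)"
    by (rule integral_prod_cart, rule borel_integrable_compact) (auto intro!: continuous_intros)
  also have "\<dots> = (\<Prod>j\<in>UNIV. if x $ j = 0 then of_real (2 * pi) else 0)"
    by (simp only: integral_exp_circle)
  also have "\<dots> = (if x = 0 then of_real ((2 * pi) ^ CARD('d)) else 0)"
    by (auto simp: vec_eq_iff prod_zero_iff)
  finally show ?thesis .
qed

subsection \<open>The lazy random walk\<close>

definition sin_sum :: "real ^ 'd::finite \<Rightarrow> real" where
  "sin_sum z = (\<Sum>j\<in>UNIV. (sin (z $ j / 2))\<^sup>2)"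

text \<open>
  This is the Fourier multiplier of one step of the walk below, which rests with probability
  \<open>1/2\<close> and otherwise jumps to a uniformly chosen neighbour.  Resting keeps the symbol away from \<open>-1\<close>, so
  that the sum of its powers converges wherever \<open>sin_sum\<close> is positive.
\<close>

definition walk_symbol :: "real ^ 'd::finite \<Rightarrow> real" where
  "walk_symbol z = 1 - sin_sum z / CARD('d)"

primrec walk :: "nat \<Rightarrow> int ^ 'd::finite \<Rightarrow> real" where
  "walk 0 x = (if x = 0 then 1 else 0)"
| "walk (Suc n) x = walk n x / 2 +
     (\<Sum>j\<in>UNIV. walk n (x + axis j 1) + walk n (x - axis j 1)) / (4 * CARD('d))"

lemma sin_sum_nonneg: "0 \<le> sin_sum z"
  by (simp add: sin_sum_def sum_nonneg)

lemma sin_sum_le: "sin_sum z \<le> CARD('d)" for z :: "real ^ 'd::finite"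
  unfolding sin_sum_def using sum_bounded_above[of UNIV "\<lambda>j. (sin (z $ j / 2))\<^sup>2" 1]
  by (simp add: abs_square_le_1)

lemma walk_symbol_bounds: "0 \<le> walk_symbol z" "walk_symbol z \<le> 1"
  using sin_sum_nonneg[of z] sin_sum_le[of z] by (simp_all add: walk_symbol_def divide_le_eq)

lemma continuous_walk_symbol [continuous_intros]: "continuous_on A walk_symbol"
  unfolding walk_symbol_def[abs_def] sin_sum_def by (intro continuous_intros) auto

lemma walk_symbol_character:
  fixes x :: "int ^ 'd::finite"
  shows "of_real (walk_symbol z) * character x z = character x z / 2 +
     (\<Sum>j\<in>UNIV. character (x + axis j 1) z + character (x - axis j 1) z) / of_nat (4 * CARD('d))"
proof -
  have "character (x + axis j 1) z + character (x - axis j 1) z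
      = of_real (2 - 4 * (sin (z $ j / 2))\<^sup>2) * character x z" for j
  proof -
    have "character (x + axis j 1) z + character (x - axis j 1) z
        = (character (axis j 1) z + cnj (character (axis j 1) z)) * character x z"
      using character_add[of x "- axis j 1" z]
      by (simp add: character_add character_minus algebra_simps)
    also have "character (axis j 1) z + cnj (character (axis j 1) z) = of_real (2 * cos (z $ j))"
      by (simp add: complex_add_cnj character_axis Re_exp)
    also have "2 * cos (z $ j) = 2 - 4 * (sin (z $ j / 2))\<^sup>2"
      using cos_double_sin[of "z $ j / 2"] by simp
    finally show ?thesis .
  qed
  then have sum: "(\<Sum>j\<in>UNIV. character (x + axis j 1) z + character (x - axis j 1) z)
      = of_real (2 * CARD('d) - 4 * sin_sum z) * character x z"
    by (simp add: sin_sum_def sum_subtractf sum_distrib_left flip: sum_distrib_right)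
  show ?thesis unfolding sum by (simp add: walk_symbol_def field_simps)
qed

lemma walk_integral:
  fixes x :: "int ^ 'd::finite"
  shows "(LINT z:torus|lborel. of_real (walk_symbol z) ^ n * character x z)
    = of_real ((2 * pi) ^ CARD('d) * walk n x)"
proof (induction n arbitrary: x)
  case 0
  show ?case by (simp add: character_orthogonality)
next
  case (Suc n)
  let ?g = "\<lambda>x z. of_real (walk_symbol z) ^ n * character x z"
  let ?I = "\<lambda>x :: int ^ 'd. LINT z:torus|lborel. ?g x z"
  have int: "has_bochner_integral lborel (\<lambda>z. indicator torus z *\<^sub>R ?g x z) (?I x)" for x :: "int ^ 'd"
    unfolding set_lebesgue_integral_def
    by (intro has_bochner_integral_integrable set_integrable_torus[unfolded set_integrable_def] continuous_intros)
  have eq: "indicator torus z *\<^sub>R (of_real (walk_symbol z) ^ Suc n * character x z)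
      = indicator torus z *\<^sub>R ?g x z / 2 + (\<Sum>j\<in>UNIV. indicator torus z *\<^sub>R ?g (x + axis j 1) z
          + indicator torus z *\<^sub>R ?g (x - axis j 1) z) / of_nat (4 * CARD('d))" for z
  proof -
    have "of_real (walk_symbol z) ^ Suc n * character x z
        = of_real (walk_symbol z) ^ n * (of_real (walk_symbol z) * character x z)" by simp
    then show ?thesis unfolding walk_symbol_character
      by (simp add: distrib_left sum_distrib_left scaleR_conv_of_real)
  qed
  have "(LINT z:torus|lborel. of_real (walk_symbol z) ^ Suc n * character x z)
      = ?I x / 2 + (\<Sum>j\<in>UNIV. ?I (x + axis j 1) + ?I (x - axis j 1)) / of_nat (4 * CARD('d))"
    unfolding set_lebesgue_integral_def[of _ _ "\<lambda>z. of_real (walk_symbol z) ^ Suc n * character x z"] eq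
    by (intro has_bochner_integral_integral_eq has_bochner_integral_add has_bochner_integral_divide_zero
        has_bochner_integral_sum int)
  then show ?case
    by (simp add: Suc.IH distrib_left sum_distrib_left sum.distrib)
qed

text \<open>
  The Fourier integrand at the origin is a power of the symbol, which is nonnegative; at \<open>x\<close> it is multiplied
  by a character, which has modulus \<open>1\<close>.
\<close>

lemma walk_le_origin:
  fixes x :: "int ^ 'd::finite"
  shows "walk n x \<le> walk n (0 :: int ^ 'd)"
proof -
  let ?c = "(2 * pi) ^ CARD('d)" and ?T = "torus :: (real ^ 'd) set"
  have "?c * walk n x \<le> norm (LINT z:?T|lborel. of_real (walk_symbol z) ^ n * character x z)"
    unfolding walk_integral norm_of_real by (rule abs_ge_self)
  also have "\<dots> \<le> (LINT z:?T|lborel. norm (of_real (walk_symbol z) ^ n * character x z))"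
    by (intro set_integral_norm_bound set_integrable_torus continuous_intros)
  also have "\<dots> = (LINT z:?T|lborel. walk_symbol z ^ n)"
    by (simp add: norm_mult norm_power walk_symbol_bounds)
  also have "of_real \<dots> = (LINT z:?T|lborel. complex_of_real (walk_symbol z ^ n))"
    by (rule set_integral_complex_of_real[symmetric])
  then have "(LINT z:?T|lborel. walk_symbol z ^ n) = ?c * walk n (0 :: int ^ 'd)"
    using walk_integral[of n "0 :: int ^ 'd"] by (simp flip: of_real_power of_real_mult)
  finally show ?thesis by simp
qed

lemma walk_nonneg: "0 \<le> walk n x"
  by (induction n arbitrary: x) (auto intro!: add_nonneg_nonneg sum_nonneg divide_nonneg_nonneg)

lemma walk_finite_support: "finite {x :: int ^ 'd::finite. walk n x \<noteq> 0}"
proof (induction n)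
  case (Suc n)
  let ?S = "{x :: int ^ 'd. walk n x \<noteq> 0}"
  have "{x :: int ^ 'd. walk (Suc n) x \<noteq> 0}
      \<subseteq> ?S \<union> (\<Union>j. (\<lambda>x. x - axis j 1) ` ?S \<union> (\<lambda>x. x + axis j 1) ` ?S)" (is "_ \<subseteq> ?U")
  proof (rule subsetI, rule ccontr)
    fix x :: "int ^ 'd" assume x: "x \<in> {x. walk (Suc n) x \<noteq> 0}" "x \<notin> ?U"
    have "walk n x = 0" using x(2) by blast
    moreover have "walk n (x + axis j 1) = 0" for j
    proof (rule ccontr)
      assume "walk n (x + axis j 1) \<noteq> 0"
      then have "x + axis j 1 - axis j 1 \<in> (\<lambda>x. x - axis j 1) ` ?S" by blast
      then show False using x(2) by auto
    qed
    moreover have "walk n (x - axis j 1) = 0" for j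
    proof (rule ccontr)
      assume "walk n (x - axis j 1) \<noteq> 0"
      then have "x - axis j 1 + axis j 1 \<in> (\<lambda>x. x + axis j 1) ` ?S" by blast
      then show False using x(2) by auto
    qed
    ultimately show False using x(1) by simp
  qed
  then show ?case by (rule finite_subset) (use Suc in auto)
qed simp

lemma walk_mass: "(walk n has_sum 1) (UNIV :: (int ^ 'd::finite) set)"
proof (induction n)
  case 0
  show ?case by (rule has_sum_finite_neutralI[of "{0}"]) auto
next
  case (Suc n)
  have shift: "((\<lambda>x. walk n (x + a)) has_sum 1) UNIV" for a :: "int ^ 'd"
    using Suc has_sum_reindex_bij_witness[of UNIV "\<lambda>x. x - a" "\<lambda>x. x + a" UNIV "walk n" "\<lambda>x. walk n (x + a)" 1 1]
    by simp
  have sum: "((\<lambda>x. \<Sum>j\<in>J. walk n (x + axis j 1) + walk n (x - axis j 1)) has_sum (\<Sum>j\<in>J. 1 + 1)) UNIV" for J :: "'d set"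
  proof (induction J rule: infinite_finite_induct)
    case (insert j J)
    have "((\<lambda>x. walk n (x + axis j 1) + walk n (x - axis j 1)) has_sum (1 + 1)) UNIV"
      using shift[of "axis j 1"] shift[of "- axis j 1"] by (intro has_sum_add) simp_all
    from has_sum_add[OF this insert.IH] insert.hyps show ?case by simp
  qed simp_all
  have "(walk (Suc n) has_sum (1 / 2 + (\<Sum>j\<in>(UNIV :: 'd set). 1 + 1) / (4 * CARD('d)))) (UNIV :: (int ^ 'd) set)"
    unfolding walk.simps by (intro has_sum_add has_sum_divide_const Suc sum)
  moreover have "1 / 2 + (\<Sum>j\<in>(UNIV :: 'd set). 1 + 1) / (4 * CARD('d)) = (1 :: real)" by simp
  ultimately show ?case by (simp only:)
qed

subsection \<open>Transience in dimension at least three\<close>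

text \<open>
  Up to \<open>pi / 3\<close> the derivative of the sine is at least \<open>1 / 2\<close>, and from there up to \<open>pi / 2\<close> the sine is at least
  \<open>1 / 2\<close>; the crude constant suffices since only integrability is at stake.
\<close>

lemma sin_half_ge:
  assumes "0 \<le> t" "t \<le> pi"
  shows "t / 8 \<le> sin (t / 2)"
proof (cases "t / 2 \<le> pi / 3")
  case True
  have "sin 0 - 0 / 4 \<le> sin (t / 2) - (t / 2) / 4"
  proof (rule DERIV_nonneg_imp_nondecreasing[of 0 "t / 2" "\<lambda>x. sin x - x / 4"])
    fix x assume x: "0 \<le> x" "x \<le> t / 2"
    have "cos (pi / 3) \<le> cos x" using x True by (intro cos_monotone_0_pi_le) auto
    then have "0 \<le> cos x - 1 / 4" by (simp add: cos_60)
    moreover have "((\<lambda>x. sin x - x / 4) has_real_derivative cos x - 1 / 4) (at x)"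
      by (auto intro!: derivative_eq_intros)
    ultimately show "\<exists>y. ((\<lambda>x. sin x - x / 4) has_real_derivative y) (at x) \<and> 0 \<le> y" by blast
  qed (use assms in simp)
  then show ?thesis by simp
next
  case False
  have "sin (pi / 3) \<le> sin (t / 2)" using assms False by (intro sin_monotone_2pi_le) auto
  then have "sqrt 3 / 2 \<le> sin (t / 2)" by (simp only: sin_60)
  moreover have "1 \<le> sqrt 3" by simp
  ultimately show ?thesis using pi_less_4 assms by linarith
qed

lemma circle_singularity_integrable:
  fixes \<alpha> :: real
  assumes \<alpha>: "0 < \<alpha>" "\<alpha> < 1"
  shows "(\<integral>\<^sup>+t. ennreal (indicator {0..2 * pi} t * \<bar>sin (t / 2)\<bar> powr (- \<alpha>)) \<partial>lborel) < \<infinity>"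
proof -
  define f where "f t = (if t \<in> {0..2 * pi} then t powr (- \<alpha>) else 0)" for t :: real
  have [measurable]: "f \<in> borel_measurable borel" unfolding f_def[abs_def] by measurable
  have f0: "0 \<le> f t" for t by (simp add: f_def)
  have "(\<lambda>t. t powr (- \<alpha>)) integrable_on {0..2 * pi}"
    using \<alpha> by (intro integrable_on_powr_from_0) auto
  then obtain I where "((\<lambda>t. t powr (- \<alpha>)) has_integral I) {0..2 * pi}" by (auto simp: integrable_on_def)
  then have "(f has_integral I) UNIV"
    unfolding f_def[abs_def] by (subst has_integral_restrict_UNIV)
  from nn_integral_has_integral_lborel[OF _ f0 this]
  have I: "(\<integral>\<^sup>+t. ennreal (f t) \<partial>lborel) = ennreal I" by simp
  have I': "(\<integral>\<^sup>+t. ennreal (f (2 * pi - t)) \<partial>lborel) = ennreal I"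
    using nn_integral_real_affine[of "\<lambda>t. ennreal (f t)" "- 1" "2 * pi"] I by simp
  have le: "indicator {0..2 * pi} t * \<bar>sin (t / 2)\<bar> powr (- \<alpha>) \<le> 8 powr \<alpha> * (f t + f (2 * pi - t))" for t
  proof -
    have key: "(sin (s / 2)) powr (- \<alpha>) \<le> 8 powr \<alpha> * f s" if "0 < s" "s \<le> pi" for s
    proof -
      have "(sin (s / 2)) powr (- \<alpha>) \<le> (s / 8) powr (- \<alpha>)"
        using sin_half_ge[of s] that \<alpha> by (intro powr_mono2') auto
      also have "\<dots> = 8 powr \<alpha> * s powr (- \<alpha>)"
        using that by (simp add: powr_divide powr_minus field_simps)
      finally show ?thesis using that by (simp add: f_def)
    qed
    consider "t \<notin> {0..2 * pi} \<or> t = 0 \<or> t = 2 * pi" | "0 < t" "t \<le> pi" | "pi \<le> t" "t < 2 * pi" by force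
    then show ?thesis
    proof cases
      case 1
      then have zero: "indicator {0..2 * pi} t * \<bar>sin (t / 2)\<bar> powr (- \<alpha>) = 0" by auto
      show ?thesis unfolding zero using f0 by simp
    next
      case 2
      then have "0 \<le> sin (t / 2)" by (intro sin_ge_zero) auto
      then have "indicator {0..2 * pi} t * \<bar>sin (t / 2)\<bar> powr (- \<alpha>) = sin (t / 2) powr (- \<alpha>)" using 2 by simp
      also note key[OF 2]
      also have "8 powr \<alpha> * f t \<le> 8 powr \<alpha> * (f t + f (2 * pi - t))"
        using f0 by (intro mult_left_mono) auto
      finally show ?thesis .
    next
      case 3
      then have "0 \<le> sin (t / 2)" by (intro sin_ge_zero) auto
      moreover have "sin ((2 * pi - t) / 2) = sin (t / 2)"
        using sin_pi_minus[of "t / 2"] by (simp add: diff_divide_distrib)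
      ultimately have "indicator {0..2 * pi} t * \<bar>sin (t / 2)\<bar> powr (- \<alpha>) = sin ((2 * pi - t) / 2) powr (- \<alpha>)"
        using 3 by simp
      also have "\<dots> \<le> 8 powr \<alpha> * f (2 * pi - t)" using 3 by (intro key) auto
      also have "\<dots> \<le> 8 powr \<alpha> * (f t + f (2 * pi - t))"
        using f0 by (intro mult_left_mono) auto
      finally show ?thesis .
    qed
  qed
  have "(\<integral>\<^sup>+t. ennreal (indicator {0..2 * pi} t * \<bar>sin (t / 2)\<bar> powr (- \<alpha>)) \<partial>lborel)
      \<le> (\<integral>\<^sup>+t. ennreal (8 powr \<alpha>) * (ennreal (f t) + ennreal (f (2 * pi - t))) \<partial>lborel)"
    using le f0 by (intro nn_integral_mono) (simp flip: ennreal_plus ennreal_mult')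
  also have "\<dots> = ennreal (8 powr \<alpha>) * (ennreal I + ennreal I)"
    by (simp add: nn_integral_cmult nn_integral_add I I')
  also have "\<dots> < \<infinity>" by (simp add: ennreal_mult_less_top)
  finally show ?thesis .
qed

lemma AE_coordinate_neq: "AE z in (lborel :: (real ^ 'd::finite) measure). z $ j \<noteq> c"
proof -
  have eq: "{z :: real ^ 'd. z $ j = c} = {z. z \<bullet> axis j 1 = c}" by (simp add: cart_eq_inner_axis)
  have "negligible {z :: real ^ 'd. z \<bullet> axis j 1 = c}"
    by (intro negligible_standard_hyperplane) (auto simp: Basis_vec_def)
  moreover have "{z :: real ^ 'd. z \<bullet> axis j 1 = c} \<in> sets lborel" by measurable
  ultimately have "{z :: real ^ 'd. z $ j = c} \<in> null_sets lborel"
    unfolding eq by (simp add: negligible_iff_null_sets null_sets_completion_iff)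
  then show ?thesis by (rule AE_I') auto
qed

lemma AE_torus_interior:
  "AE z in (lborel :: (real ^ 'd::finite) measure). z \<in> torus \<longrightarrow> (\<forall>j. 0 < sin (z $ j / 2))"
proof -
  have "AE z in (lborel :: (real ^ 'd) measure). \<forall>j. z $ j \<noteq> 0 \<and> z $ j \<noteq> 2 * pi"
    unfolding AE_all_countable by (intro allI AE_conjI AE_coordinate_neq)
  then show ?thesis
  proof eventually_elim
    case (elim z)
    have "0 < sin (z $ j / 2)" if "z \<in> torus" for j
    proof (rule sin_gt_zero)
      have "0 \<le> z $ j" "z $ j \<le> 2 * pi" using that by (auto simp: mem_torus)
      moreover have "z $ j \<noteq> 0" "z $ j \<noteq> 2 * pi" using elim by auto
      ultimately show "0 < z $ j / 2" "z $ j / 2 < pi" by auto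
    qed
    then show ?case by blast
  qed
qed

lemma sin_sum_pos:
  assumes "\<forall>j. 0 < sin (z $ j / 2)"
  shows "0 < sin_sum z"
  unfolding sin_sum_def using assms by (intro sum_pos) (auto simp: order_less_imp_not_eq2)

text \<open>
  No \<open>\<bar>sin (z j / 2)\<bar>\<close> exceeds the square root of \<open>sin_sum z\<close>, so the product of their powers with exponent
  \<open>2 / d\<close> is at most \<open>sin_sum z\<close>.  This separates the variables; for \<open>d \<ge> 3\<close> the exponent is less than \<open>1\<close>
  and every one-dimensional singularity is integrable.
\<close>

lemma inverse_sin_sum_le:
  fixes z :: "real ^ 'd::finite"
  assumes pos: "\<forall>j. 0 < sin (z $ j / 2)"
  shows "1 / sin_sum z \<le> (\<Prod>j\<in>UNIV. \<bar>sin (z $ j / 2)\<bar> powr (- (2 / CARD('d))))"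
proof -
  let ?S = "sin_sum z" and ?d = "real CARD('d)"
  have S: "0 < ?S" by (rule sin_sum_pos[OF pos])
  have "(\<Prod>j\<in>(UNIV :: 'd set). \<bar>sin (z $ j / 2)\<bar> powr (2 / ?d)) \<le> (\<Prod>j\<in>(UNIV :: 'd set). ?S powr (1 / ?d))"
  proof (rule prod_mono)
    fix j
    have "(sin (z $ j / 2))\<^sup>2 \<le> ?S" unfolding sin_sum_def by (rule member_le_sum) auto
    then have "\<bar>sin (z $ j / 2)\<bar> \<le> ?S powr (1 / 2)"
      using S real_le_rsqrt[of "\<bar>sin (z $ j / 2)\<bar>" ?S] by (simp add: powr_half_sqrt)
    then have "\<bar>sin (z $ j / 2)\<bar> powr (2 / ?d) \<le> (?S powr (1 / 2)) powr (2 / ?d)"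
      by (intro powr_mono2) auto
    then show "0 \<le> \<bar>sin (z $ j / 2)\<bar> powr (2 / ?d) \<and> \<bar>sin (z $ j / 2)\<bar> powr (2 / ?d) \<le> ?S powr (1 / ?d)"
      by (simp add: powr_powr)
  qed
  also have "\<dots> = ?S"
    using S by (simp add: powr_power)
  finally have "1 / ?S \<le> 1 / (\<Prod>j\<in>(UNIV :: 'd set). \<bar>sin (z $ j / 2)\<bar> powr (2 / ?d))"
    using pos S by (intro divide_left_mono mult_pos_pos prod_pos) (auto simp: order_less_imp_not_eq2)
  then show ?thesis by (simp add: powr_minus inverse_eq_divide prod_dividef)
qed

lemma sin_sum_measurable [measurable]: "sin_sum \<in> borel_measurable (borel :: (real ^ 'd::finite) measure)"
  unfolding sin_sum_def[abs_def] by (intro borel_measurable_continuous_onI continuous_intros) auto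

lemma green_symbol_integrable:
  assumes d: "CARD('d::finite) \<ge> 3"
  shows "set_integrable lborel torus (\<lambda>z :: real ^ 'd. 1 / (4 * sin_sum z))"
  unfolding set_integrable_def
proof (rule integrableI_bounded)
  let ?W = "\<lambda>t. indicator {0..2 * pi} t * \<bar>sin (t / 2)\<bar> powr (- (2 / CARD('d)))"
  show "(\<lambda>z :: real ^ 'd. indicator torus z *\<^sub>R (1 / (4 * sin_sum z))) \<in> borel_measurable lborel"
    by measurable
  have "(\<integral>\<^sup>+z. ennreal (norm (indicator torus z *\<^sub>R (1 / (4 * sin_sum z)))) \<partial>(lborel :: (real ^ 'd) measure))
      \<le> (\<integral>\<^sup>+z. ennreal (\<Prod>j\<in>UNIV. ?W (z $ j)) \<partial>(lborel :: (real ^ 'd) measure))"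
  proof (rule nn_integral_mono_AE)
    show "AE z in (lborel :: (real ^ 'd) measure).
        ennreal (norm (indicator torus z *\<^sub>R (1 / (4 * sin_sum z)))) \<le> ennreal (\<Prod>j\<in>UNIV. ?W (z $ j))"
      using AE_torus_interior
    proof eventually_elim
      case (elim z)
      show ?case
      proof (cases "z \<in> torus")
        case True
        with elim have pos: "\<forall>j. 0 < sin (z $ j / 2)" by blast
        have "1 / (4 * sin_sum z) \<le> 1 / sin_sum z"
          using sin_sum_pos[OF pos] by (intro divide_left_mono) auto
        also note inverse_sin_sum_le[OF pos]
        finally show ?thesis using True sin_sum_nonneg[of z]
          by (intro ennreal_leI) (simp add: prod.distrib mem_torus)
      qed simp
    qed
  qed
  also have "\<dots> = (\<Prod>j\<in>(UNIV :: 'd set). \<integral>\<^sup>+t. ennreal (?W t) \<partial>lborel)"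
    by (rule nn_integral_prod_cart) auto
  also have "\<dots> < \<infinity>"
  proof -
    obtain c where "0 \<le> c" "(\<integral>\<^sup>+t. ennreal (?W t) \<partial>lborel) = ennreal c"
      using circle_singularity_integrable[of "2 / CARD('d)"] d unfolding infinity_ennreal_def less_top_ennreal by auto
    then show ?thesis by (simp add: ennreal_power)
  qed
  finally show "(\<integral>\<^sup>+z. ennreal (norm (indicator torus z *\<^sub>R (1 / (4 * sin_sum z)))) \<partial>(lborel :: (real ^ 'd) measure)) < \<infinity>" .
qed

lemma geometric_partial_sum:
  fixes z :: "real ^ 'd::finite"
  assumes "0 < sin_sum z"
  shows "(\<Sum>n<N. walk_symbol z ^ n) / (4 * CARD('d)) = (1 - walk_symbol z ^ N) / (4 * sin_sum z)"
proof -
  have "walk_symbol z \<noteq> 1" using assms by (simp add: walk_symbol_def)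
  then have "(\<Sum>n<N. walk_symbol z ^ n) = (1 - walk_symbol z ^ N) / (1 - walk_symbol z)"
    by (simp add: sum_gp_strict)
  also have "1 - walk_symbol z = sin_sum z / CARD('d)" by (simp add: walk_symbol_def)
  finally show ?thesis using assms by (simp add: field_simps)
qed

text \<open>
  The partial sums of the geometric series of the symbol increase to \<open>d / sin_sum z\<close>, so their Fourier
  coefficients converge by dominated convergence.
\<close>

lemma walk_sums_green0:
  fixes x :: "int ^ 'd::finite"
  assumes d: "CARD('d) \<ge> 3"
  shows "(\<lambda>n. complex_of_real (walk n x / (4 * CARD('d)))) sums green0 x"
proof -
  let ?c = "complex_of_real (1 / (2 * pi) ^ CARD('d))"
  define s where "s N z = indicator torus z *\<^sub>R (\<Sum>n<N. of_real (walk_symbol z) ^ n * character x z / of_nat (4 * CARD('d)))"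
    for N and z :: "real ^ 'd"
  define f where "f z = indicator torus z *\<^sub>R (character x z / of_real (4 * sin_sum z))" for z
  have "(\<lambda>N. integral\<^sup>L lborel (s N)) \<longlonglongrightarrow> integral\<^sup>L lborel f"
  proof (rule integral_dominated_convergence)
    show "integrable lborel (\<lambda>z :: real ^ 'd. indicator torus z *\<^sub>R (1 / (4 * sin_sum z)))"
      using green_symbol_integrable[OF d] unfolding set_integrable_def .
    have [measurable]: "character x \<in> borel_measurable borel" "walk_symbol \<in> borel_measurable (borel :: (real ^ 'd) measure)"
      by (intro borel_measurable_continuous_onI continuous_intros)+
    show "f \<in> borel_measurable lborel" unfolding f_def[abs_def] by measurable
    show "s N \<in> borel_measurable lborel" for N unfolding s_def[abs_def] by measurable
    have sum: "(\<Sum>n<N. of_real (walk_symbol z) ^ n * character x z / of_nat (4 * CARD('d)))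
        = of_real ((1 - walk_symbol z ^ N) / (4 * sin_sum z)) * character x z" if "0 < sin_sum z" for N z
      unfolding geometric_partial_sum[OF that, symmetric]
      by (simp add: sum_distrib_right sum_divide_distrib)
    show "AE z in lborel. (\<lambda>N. s N z) \<longlonglongrightarrow> f z"
      using AE_torus_interior
    proof eventually_elim
      case (elim z)
      show ?case
      proof (cases "z \<in> torus")
        case True
        then have S: "0 < sin_sum z" using elim sin_sum_pos by blast
        then have "walk_symbol z < 1" by (simp add: walk_symbol_def)
        then have "(\<lambda>N. walk_symbol z ^ N) \<longlonglongrightarrow> 0" using walk_symbol_bounds(1)[of z] by (intro LIMSEQ_realpow_zero) auto
        then have "(\<lambda>N. of_real ((1 - walk_symbol z ^ N) / (4 * sin_sum z)) * character x z)
            \<longlonglongrightarrow> of_real ((1 - 0) / (4 * sin_sum z)) * character x z"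
          using S by (intro tendsto_mult tendsto_of_real tendsto_divide tendsto_diff tendsto_const) auto
        then show ?thesis unfolding s_def f_def sum[OF S] using True by simp
      qed (simp add: s_def f_def)
    qed
    show "AE z in lborel. norm (s N z) \<le> indicator torus z *\<^sub>R (1 / (4 * sin_sum z))" for N
      using AE_torus_interior
    proof eventually_elim
      case (elim z)
      show ?case
      proof (cases "z \<in> torus")
        case True
        then have S: "0 < sin_sum z" using elim sin_sum_pos by blast
        have "0 \<le> walk_symbol z ^ N" "walk_symbol z ^ N \<le> 1"
          using walk_symbol_bounds[of z] by (auto intro: power_le_one)
        then have "\<bar>(1 - walk_symbol z ^ N) / (4 * sin_sum z)\<bar> \<le> 1 / (4 * sin_sum z)"
          using S by (simp add: divide_right_mono)
        then show ?thesis unfolding s_def sum[OF S] norm_scaleR norm_mult norm_of_real norm_character using True by simp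
      qed (simp add: s_def)
    qed
  qed
  moreover have "?c * integral\<^sup>L lborel (s N) = (\<Sum>n<N. of_real (walk n x / (4 * CARD('d))))" for N
  proof -
    have "has_bochner_integral lborel
        (\<lambda>z. \<Sum>n<N. indicator torus z *\<^sub>R (of_real (walk_symbol z) ^ n * character x z) / of_nat (4 * CARD('d)))
        (\<Sum>n<N. (LINT z:torus|lborel. of_real (walk_symbol z) ^ n * character x z) / of_nat (4 * CARD('d)))"
      unfolding set_lebesgue_integral_def
      by (intro has_bochner_integral_sum has_bochner_integral_divide_zero has_bochner_integral_integrable
          set_integrable_torus[unfolded set_integrable_def] continuous_intros)
    also have "(\<lambda>z. \<Sum>n<N. indicator torus z *\<^sub>R (of_real (walk_symbol z) ^ n * character x z) / of_nat (4 * CARD('d))) = s N"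
      by (simp add: s_def fun_eq_iff sum_distrib_left scaleR_conv_of_real)
    finally have "integral\<^sup>L lborel (s N)
        = (\<Sum>n<N. (LINT z:torus|lborel. of_real (walk_symbol z) ^ n * character x z) / of_nat (4 * CARD('d)))"
      by (rule has_bochner_integral_integral_eq)
    then show ?thesis unfolding walk_integral
      by (simp add: sum_distrib_left field_simps)
  qed
  moreover have "green0 x = ?c * integral\<^sup>L lborel f"
    by (simp add: green0_def f_def[abs_def] set_lebesgue_integral_def torus_def character_def sin_sum_def)
  ultimately show ?thesis unfolding sums_def
    using tendsto_mult_left[of "\<lambda>N. integral\<^sup>L lborel (s N)" _ _ ?c] by simp
qed


section \<open>The reproducing kernel of the energy space\<close>

definition walk_potential :: "nat \<Rightarrow> 'd::finite lfun" where
  "walk_potential N x = of_real (\<Sum>n<N. walk n x / (4 * CARD('d)))"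

lemma walk_potential_finitely_supported: "finitely_supported (walk_potential N :: 'd::finite lfun)"
proof -
  have "{x :: int ^ 'd. walk_potential N x \<noteq> 0} \<subseteq> (\<Union>n<N. {x. walk n x \<noteq> 0})"
  proof
    fix x :: "int ^ 'd" assume "x \<in> {x. walk_potential N x \<noteq> 0}"
    then have "(\<Sum>n<N. walk n x / (4 * CARD('d))) \<noteq> 0"
      unfolding walk_potential_def of_real_eq_0_iff mem_Collect_eq .
    then obtain n where "n < N" "walk n x / (4 * CARD('d)) \<noteq> 0" by (auto elim: sum.not_neutral_contains_not_neutral)
    then show "x \<in> (\<Union>n<N. {x. walk n x \<noteq> 0})" by auto
  qed
  then show ?thesis
    unfolding finitely_supported_def by (rule finite_subset) (auto intro: walk_finite_support)
qed

text \<open>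
  The Laplacian is \<open>4 d\<close> times the difference between a function and its average over one step of the walk,
  whence the sum telescopes.
\<close>

lemma walk_potential_laplacian:
  fixes x :: "int ^ 'd::finite"
  shows "(\<Sum>j\<in>UNIV. 2 * walk_potential N x - walk_potential N (x + axis j 1) - walk_potential N (x - axis j 1))
    = of_real (walk 0 x - walk N x)"
proof (induction N)
  case 0
  show ?case by (simp add: walk_potential_def)
next
  case (Suc N)
  let ?d = "real CARD('d)"
  have "(\<Sum>j\<in>UNIV. walk N (x + axis j 1) + walk N (x - axis j 1)) = 4 * ?d * (walk (Suc N) x - walk N x / 2)"
    by simp
  then have "(\<Sum>j\<in>UNIV. 2 * walk N x - walk N (x + axis j 1) - walk N (x - axis j 1)) / (4 * ?d)
      = (2 * ?d * walk N x - 4 * ?d * (walk (Suc N) x - walk N x / 2)) / (4 * ?d)"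
    by (simp add: sum_subtractf sum.distrib)
  also have "\<dots> = walk N x - walk (Suc N) x" by (simp add: field_simps del: walk.simps)
  finally have step: "(\<Sum>j\<in>UNIV. 2 * walk N x - walk N (x + axis j 1) - walk N (x - axis j 1)) / (4 * ?d)
      = walk N x - walk (Suc N) x" .
  have "(\<Sum>j\<in>UNIV. 2 * walk_potential (Suc N) x - walk_potential (Suc N) (x + axis j 1) - walk_potential (Suc N) (x - axis j 1))
      = (\<Sum>j\<in>UNIV. 2 * walk_potential N x - walk_potential N (x + axis j 1) - walk_potential N (x - axis j 1))
        + of_real ((\<Sum>j\<in>UNIV. 2 * walk N x - walk N (x + axis j 1) - walk N (x - axis j 1)) / (4 * ?d))"
    by (simp add: walk_potential_def sum_divide_distrib sum.distrib[symmetric] add_divide_distrib diff_divide_distrib algebra_simps)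
  also have "\<dots> = of_real (walk 0 x - walk (Suc N) x)"
    unfolding Suc.IH step by (simp del: walk.simps)
  finally show ?case .
qed

lemma walk_potential_inner:
  assumes "finitely_supported v"
  shows "H1_inner (walk_potential N) v = (\<Sum>\<^sub>\<infinity>x. of_real (walk 0 x - walk N x) * cnj (v x))"
  unfolding inner_by_parts[OF assms] walk_potential_laplacian ..

context
  assumes d3: "CARD('d::finite) \<ge> 3"
begin

lemma walk_summable: "summable (\<lambda>n. walk n (x :: int ^ 'd) / (4 * CARD('d)))"
  using sums_summable[OF walk_sums_green0[OF d3, of x]] by (simp only: summable_of_real_iff)

lemma green0_eq: "green0 (x :: int ^ 'd) = of_real (\<Sum>n. walk n x / (4 * CARD('d)))"
  using sums_unique2[OF walk_sums_green0[OF d3] sums_of_real[OF summable_sums[OF walk_summable]]] .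

lemma walk_tendsto_0: "(\<lambda>n. walk n (x :: int ^ 'd)) \<longlonglongrightarrow> 0"
proof -
  have "(\<lambda>n. walk n x / (4 * CARD('d)) * (4 * CARD('d))) \<longlonglongrightarrow> 0"
    using summable_LIMSEQ_zero[OF walk_summable] by (rule tendsto_mult_left_zero)
  then show ?thesis by simp
qed

lemma walk_potential_tendsto: "(\<lambda>N. walk_potential N (x :: int ^ 'd)) \<longlonglongrightarrow> green0 x"
  using walk_sums_green0[OF d3, of x] by (simp add: sums_def walk_potential_def)

text \<open>
  Summation by parts expresses the energy of \<open>u = walk_potential M - walk_potential N\<close> as the sum of \<open>u\<close> times
  its Laplacian.  The Laplacian is at most \<open>walk N\<close>, a probability distribution, and \<open>u\<close> is nonnegative
  and largest at the origin, where it is a block of the convergent Green series.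
\<close>

lemma walk_potential_energy:
  assumes "N \<le> M"
  shows "Q0 (walk_potential M - walk_potential N :: 'd lfun)
    \<le> (\<Sum>n. walk n (0 :: int ^ 'd) / (4 * CARD('d))) - (\<Sum>n<N. walk n (0 :: int ^ 'd) / (4 * CARD('d)))"
proof -
  let ?u = "walk_potential M - walk_potential N :: 'd lfun"
  define w where "w x = (\<Sum>n=N..<M. walk n x / (4 * CARD('d)))" for x :: "int ^ 'd"
  have u: "?u x = of_real (w x)" for x
    by (simp only: fun_diff_def walk_potential_def of_real_diff[symmetric] sum_lessThan_diff[OF assms] w_def)
  have fs: "finitely_supported ?u" by (intro finitely_supported_closed walk_potential_finitely_supported)
  have fin: "walk_potential n \<in> (finite_energy :: 'd lfun set)" for n
    by (intro finitely_supported_finite_energy walk_potential_finitely_supported)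
  have ufin: "?u \<in> finite_energy" by (rule finitely_supported_finite_energy[OF fs])
  have w0: "0 \<le> w x" for x unfolding w_def by (intro sum_nonneg divide_nonneg_nonneg walk_nonneg) simp
  have wle: "w x \<le> w 0" for x unfolding w_def by (intro sum_mono divide_right_mono walk_le_origin) simp
  have sm: "(\<lambda>x. c x * w x) summable_on UNIV" for c :: "int ^ 'd \<Rightarrow> real"
  proof (rule finite_nonzero_values_imp_summable_on)
    have "{x \<in> UNIV. c x * w x \<noteq> 0} \<subseteq> {x. ?u x \<noteq> 0}" unfolding u of_real_eq_0_iff by auto
    then show "finite {x \<in> UNIV. c x * w x \<noteq> 0}"
      using fs unfolding finitely_supported_def by (rule finite_subset)
  qed
  have ip: "H1_inner (walk_potential n) ?u = of_real (\<Sum>\<^sub>\<infinity>x. (walk 0 x - walk n x) * w x)" for n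
  proof -
    have "((\<lambda>x. complex_of_real ((walk 0 x - walk n x) * w x)) has_sum
        of_real (\<Sum>\<^sub>\<infinity>x. (walk 0 x - walk n x) * w x)) UNIV"
      by (intro has_sum_of_real has_sum_infsum sm)
    then show ?thesis unfolding walk_potential_inner[OF fs] u by (simp add: infsumI)
  qed
  have "Q0 ?u = Re (H1_inner ?u ?u)" using H1_inner_self[OF ufin] by simp
  also have "\<dots> = (\<Sum>\<^sub>\<infinity>x. (walk 0 x - walk M x) * w x) - (\<Sum>\<^sub>\<infinity>x. (walk 0 x - walk N x) * w x)"
    using energy.ip_diff_left[OF fin fin ufin] ip by simp
  also have "\<dots> = (\<Sum>\<^sub>\<infinity>x. (walk N x - walk M x) * w x)"
  proof -
    have "(\<Sum>\<^sub>\<infinity>x. (walk N x - walk M x) * w x) + (\<Sum>\<^sub>\<infinity>x. (walk 0 x - walk N x) * w x)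
        = (\<Sum>\<^sub>\<infinity>x. (walk N x - walk M x) * w x + (walk 0 x - walk N x) * w x)"
      by (rule infsum_add[OF sm sm, symmetric])
    also have "\<dots> = (\<Sum>\<^sub>\<infinity>x. (walk 0 x - walk M x) * w x)"
      by (rule infsum_cong) (simp only: distrib_right[symmetric], simp)
    finally show ?thesis by simp
  qed
  also have "\<dots> \<le> w 0"
  proof (rule has_sum_mono[OF has_sum_infsum[OF sm]])
    show "((\<lambda>x. walk N x * w 0) has_sum w 0) (UNIV :: (int ^ 'd) set)"
      using has_sum_cmult_left[OF walk_mass[of N, where 'd = 'd], of "w 0"] by simp
    show "(walk N x - walk M x) * w x \<le> walk N x * w 0" for x :: "int ^ 'd"
      using walk_nonneg[of M x] walk_nonneg[of N x] w0[of x] wle[of x]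
      by (intro order_trans[OF mult_right_mono mult_left_mono]) auto
  qed
  also have "w 0 \<le> (\<Sum>n. walk n (0 :: int ^ 'd) / (4 * CARD('d))) - (\<Sum>n<N. walk n (0 :: int ^ 'd) / (4 * CARD('d)))"
    unfolding w_def by (intro sum_le_tail walk_summable divide_nonneg_nonneg walk_nonneg) simp
  finally show ?thesis .
qed

lemma walk_potential_Cauchy:
  assumes "e > 0"
  shows "\<exists>N. \<forall>m\<ge>N. \<forall>n\<ge>N. Q0 (walk_potential m - walk_potential n :: 'd lfun) < e"
proof -
  let ?g = "\<lambda>n. walk n (0 :: int ^ 'd) / (4 * CARD('d))"
  from order_tendstoD(2)[OF tail_tendsto_0[OF walk_summable[of 0]] assms]
  obtain N where N: "\<And>n. n \<ge> N \<Longrightarrow> suminf ?g - sum ?g {..<n} < e" by (auto simp: eventually_sequentially)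
  have fin: "walk_potential n \<in> (finite_energy :: 'd lfun set)" for n
    by (intro finitely_supported_finite_energy walk_potential_finitely_supported)
  have comm: "Q0 (walk_potential m - walk_potential n :: 'd lfun) = Q0 (walk_potential n - walk_potential m :: 'd lfun)" for m n
    using energy.nrm_minus_commute[OF fin fin, of m n] fin by (simp add: Q0_energy_nrm)
  have le: "Q0 (walk_potential m - walk_potential n :: 'd lfun) < e" if "n \<le> m" "N \<le> n" for m n
    using walk_potential_energy[OF that(1)] N[OF that(2)] by linarith
  have "Q0 (walk_potential m - walk_potential n :: 'd lfun) < e" if "N \<le> m" "N \<le> n" for m n
    using le[of n m] le[of m n] that comm[of m n] by (cases "n \<le> m") auto
  then show ?thesis by blast
qed

lemma green0_energy:
  "(green0 :: 'd lfun) \<in> finite_energy" "energy.tends walk_potential (green0 :: 'd lfun)"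
  using energy_Cauchy_limit[of walk_potential "green0 :: 'd lfun"] walk_potential_Cauchy walk_potential_tendsto
  by (auto intro: finitely_supported_finite_energy walk_potential_finitely_supported)

lemma green0_H1: "(green0 :: 'd lfun) \<in> H1"
  by (rule H1I[OF walk_potential_finitely_supported green0_energy walk_potential_tendsto])

text \<open>
  The Laplacian of \<open>walk_potential N\<close> is the unit mass at the origin minus \<open>walk N\<close>, and \<open>walk N\<close> tends to zero
  pointwise.
\<close>

lemma green0_reproducing_finite:
  assumes v: "finitely_supported (v :: 'd lfun)"
  shows "H1_inner green0 v = cnj (v 0)"
proof (rule LIMSEQ_unique)
  show "(\<lambda>N. H1_inner (walk_potential N) v) \<longlonglongrightarrow> H1_inner green0 v"
    using green0_energy v
    by (intro energy.tends_ip) (auto intro: finitely_supported_finite_energy walk_potential_finitely_supported)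
  let ?S = "insert 0 {x. v x \<noteq> 0}"
  have fin: "finite ?S" using v by (simp add: finitely_supported_def)
  have "H1_inner (walk_potential N) v = (\<Sum>x\<in>?S. of_real (walk 0 x - walk N x) * cnj (v x))" for N
    unfolding walk_potential_inner[OF v] using fin
    by (intro infsumI has_sum_finite_neutralI[of ?S]) auto
  moreover have "(\<lambda>N. \<Sum>x\<in>?S. of_real (walk 0 x - walk N x) * cnj (v x))
      \<longlonglongrightarrow> (\<Sum>x\<in>?S. of_real (walk 0 x - 0) * cnj (v x))"
    by (intro tendsto_intros walk_tendsto_0)
  moreover have "(\<Sum>x\<in>?S. of_real (walk 0 x - 0) * cnj (v x)) = cnj (v 0)"
    using fin by (subst sum.remove[of _ 0]) (auto intro!: sum.neutral)
  ultimately show "(\<lambda>N. H1_inner (walk_potential N) v) \<longlonglongrightarrow> cnj (v 0)" by (simp only:)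
qed

lemma green0_reproducing:
  assumes "(v :: 'd lfun) \<in> H1"
  shows "H1_inner v green0 = v 0"
proof -
  obtain \<phi> where \<phi>: "\<And>n. finitely_supported (\<phi> n)" "v \<in> finite_energy"
    "energy.tends \<phi> v" "\<And>x. (\<lambda>n. \<phi> n x) \<longlonglongrightarrow> v x"
    using H1_approximation[OF assms] by blast
  have fin: "\<phi> n \<in> finite_energy" for n by (intro finitely_supported_finite_energy \<phi>)
  have "(\<lambda>n. H1_inner (\<phi> n) green0) \<longlonglongrightarrow> H1_inner v green0"
    by (rule energy.tends_ip[OF fin \<phi>(2) green0_energy(1) \<phi>(3)])
  moreover have "H1_inner (\<phi> n) green0 = \<phi> n 0" for n
    using energy.ip_hermitian[OF green0_energy(1) fin, of n] green0_reproducing_finite[OF \<phi>(1)] by simp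
  ultimately show ?thesis using \<phi>(4)[of 0] by (simp add: LIMSEQ_unique)
qed

lemma green_translate: "green y = translate y (green0 :: 'd lfun)"
  by (simp add: green_def translate_def)

lemma green_H1: "(green y :: 'd lfun) \<in> H1"
  unfolding green_translate by (intro translate_H1 green0_H1)

lemma green_reproducing:
  assumes "(v :: 'd lfun) \<in> H1"
  shows "H1_inner v (green y) = v y"
proof -
  have v: "v = translate y (translate (- y) v)" by (simp add: translate_def)
  have "H1_inner v (green y) = H1_inner (translate (- y) v) green0"
    unfolding green_translate by (subst v) (rule translate_inner)
  also have "\<dots> = v y"
    using green0_reproducing[OF translate_H1[OF assms, of "- y"]] by (simp add: translate_def)
  finally show ?thesis .
qed

lemma green_mu_pos: "0 < green_mu TYPE('d)"
  and green_mu_sq: "of_real ((green_mu TYPE('d))\<^sup>2) = green0 (0 :: int ^ 'd)"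
proof -
  let ?g = "\<lambda>n. walk n (0 :: int ^ 'd) / (4 * CARD('d))"
  have "0 < ?g 0" by simp
  also have "?g 0 = sum ?g {0}" by simp
  also have "\<dots> \<le> suminf ?g"
    by (intro sum_le_suminf walk_summable divide_nonneg_nonneg walk_nonneg) auto
  finally have pos: "0 < suminf ?g" .
  then show "0 < green_mu TYPE('d)" by (simp add: green_mu_def green0_eq)
  show "of_real ((green_mu TYPE('d))\<^sup>2) = green0 (0 :: int ^ 'd)"
    using pos by (simp add: green_mu_def green0_eq)
qed

lemma H1_pointwise_bound:
  assumes "(v :: 'd lfun) \<in> H1"
  shows "cmod (v y) \<le> green_mu TYPE('d) * energy.nrm v"
proof -
  have g: "(green y :: 'd lfun) \<in> H1" by (rule green_H1)
  have "of_real ((energy.nrm (green y :: 'd lfun))\<^sup>2) = H1_inner (green y) (green y :: 'd lfun)"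
    using energy.ip_self[OF H1_finite_energy[OF g]] by simp
  also have "\<dots> = of_real ((green_mu TYPE('d))\<^sup>2)"
    unfolding green_mu_sq green_reproducing[OF g] by (simp add: green_def)
  finally have "(energy.nrm (green y :: 'd lfun))\<^sup>2 = (green_mu TYPE('d))\<^sup>2" by (simp only: of_real_eq_iff)
  then have "energy.nrm (green y :: 'd lfun) = green_mu TYPE('d)"
    using energy.nrm_nonneg[OF H1_finite_energy[OF g]] green_mu_pos by (simp add: power2_eq_iff)
  then show ?thesis
    using energy.Cauchy_Schwarz[OF H1_finite_energy[OF assms] H1_finite_energy[OF g]]
    by (simp add: green_reproducing[OF assms] mult.commute)
qed

text \<open>
  By \<open>H1_pointwise_bound\<close> a Cauchy sequence converges pointwise.  Replacing its members by finitely supported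
  functions at distance at most \<open>1 / (n + 1)\<close> shows that the limit belongs to \<open>H1\<close>.
\<close>

lemma H1_hilbert: "hilbert fscale (H1 :: 'd lfun set) H1_inner"
proof -
  interpret inner_space fscale "H1 :: 'd lfun set" H1_inner
  proof
    show "fvec.subspace (H1 :: 'd lfun set)" by (rule H1_subspace)
  qed (auto simp: H1_finite_energy energy.ip_nonneg intro: energy.ip_hermitian)
  show ?thesis
  proof
    fix u :: "'d lfun" assume u: "u \<in> H1" "H1_inner u u = 0"
    then have "energy.nrm u = 0" by (simp add: energy.nrm_def)
    then show "u = 0" using H1_pointwise_bound[OF u(1)] by (auto simp: fun_eq_iff)
  next
    fix f :: "nat \<Rightarrow> 'd lfun"
    assume f: "\<And>n. f n \<in> H1" and cauchy: "\<And>e. e > 0 \<Longrightarrow> \<exists>N. \<forall>m\<ge>N. \<forall>n\<ge>N. energy.nrm (f m - f n) < e"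
    let ?mu = "green_mu TYPE('d)"
    have fin: "f n \<in> finite_energy" for n by (intro H1_finite_energy f)
    have "Cauchy (\<lambda>n. f n x)" for x
    proof (rule CauchyI)
      fix e :: real assume "e > 0"
      then obtain N where N: "\<And>m n. m \<ge> N \<Longrightarrow> n \<ge> N \<Longrightarrow> energy.nrm (f m - f n) < e / ?mu"
        using cauchy[of "e / ?mu"] green_mu_pos by auto
      have "norm (f m x - f n x) < e" if "m \<ge> N" "n \<ge> N" for m n
      proof -
        have "norm (f m x - f n x) \<le> ?mu * energy.nrm (f m - f n)"
          using H1_pointwise_bound[of "f m - f n" x] f by simp
        also have "\<dots> < e" using N[OF that] green_mu_pos by (simp add: field_simps)
        finally show ?thesis .
      qed
      then show "\<exists>N. \<forall>m\<ge>N. \<forall>n\<ge>N. norm (f m x - f n x) < e" by blast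
    qed
    then have "\<exists>l. (\<lambda>n. f n x) \<longlonglongrightarrow> l" for x
      by (simp add: Cauchy_convergent_iff convergent_def)
    then obtain u where u: "\<And>x. (\<lambda>n. f n x) \<longlonglongrightarrow> u x" by metis
    have cauchy': "\<exists>N. \<forall>m\<ge>N. \<forall>n\<ge>N. Q0 (f m - f n) < e" if "e > 0" for e
    proof -
      have "sqrt e > 0" using that by simp
      then obtain N where N: "\<And>m n. m \<ge> N \<Longrightarrow> n \<ge> N \<Longrightarrow> energy.nrm (f m - f n) < sqrt e"
        using cauchy by blast
      have "Q0 (f m - f n) < e" if "m \<ge> N" "n \<ge> N" for m n
        using power_strict_mono[OF N[OF that], of 2] fin \<open>e > 0\<close> by (simp add: Q0_energy_nrm)
      then show ?thesis by blast
    qed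
    have ufin: "u \<in> finite_energy" and fu: "energy.tends f u"
      using energy_Cauchy_limit[OF fin u cauchy'] by auto
    have "\<exists>\<phi>. finitely_supported \<phi> \<and> energy.nrm (\<phi> - f n) < 1 / real (Suc n)" for n
    proof -
      obtain \<phi> where \<phi>: "\<And>k. finitely_supported (\<phi> k)" "energy.tends \<phi> (f n)"
        using H1_approximation[OF f[of n]] by metis
      from order_tendstoD(2)[OF \<phi>(2)[unfolded energy.tends_def], of "1 / real (Suc n)"]
      obtain k where "energy.nrm (\<phi> k - f n) < 1 / real (Suc n)" by (auto simp: eventually_sequentially)
      with \<phi>(1) show ?thesis by blast
    qed
    then obtain \<phi> where \<phi>: "\<And>n. finitely_supported (\<phi> n)"
      and near: "\<And>n. energy.nrm (\<phi> n - f n) < 1 / real (Suc n)" by metis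
    have \<phi>H: "\<phi> n \<in> H1" for n by (intro finitely_supported_H1 \<phi>)
    have \<phi>fin: "\<phi> n \<in> finite_energy" for n by (intro H1_finite_energy \<phi>H)
    have inv: "(\<lambda>n. 1 / real (Suc n)) \<longlonglongrightarrow> 0" by (rule LIMSEQ_Suc[OF lim_1_over_n])
    have "u \<in> H1"
    proof (rule H1I[OF \<phi> ufin])
      show "energy.tends \<phi> u"
      proof (rule energy.tends_zero_comparison[OF \<phi>fin ufin])
        show "energy.nrm (\<phi> n - u) \<le> 1 / real (Suc n) + energy.nrm (f n - u)" for n
          using energy.nrm_triangle_diff[OF \<phi>fin fin ufin, of n n] near[of n] by linarith
        show "(\<lambda>n. 1 / real (Suc n) + energy.nrm (f n - u)) \<longlonglongrightarrow> 0"
          using inv fu unfolding energy.tends_def by (rule tendsto_add_zero)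
      qed
      show "(\<lambda>n. \<phi> n x) \<longlonglongrightarrow> u x" for x
      proof -
        have "(\<lambda>n. \<phi> n x - f n x) \<longlonglongrightarrow> 0"
        proof (rule Lim_null_comparison)
          have "norm (\<phi> n x - f n x) \<le> ?mu * (1 / real (Suc n))" for n
            using H1_pointwise_bound[of "\<phi> n - f n" x] f \<phi>H near[of n] green_mu_pos
              mult_left_mono[of "energy.nrm (\<phi> n - f n)" "1 / real (Suc n)" ?mu] by simp
          then show "\<forall>\<^sub>F n in sequentially. norm (\<phi> n x - f n x) \<le> ?mu * (1 / real (Suc n))" by simp
          show "(\<lambda>n. ?mu * (1 / real (Suc n))) \<longlonglongrightarrow> 0" using inv by (rule tendsto_mult_right_zero)
        qed
        from tendsto_add[OF this u[of x]] show ?thesis by simp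
      qed
    qed
    then show "\<exists>w\<in>H1. energy.tends f w" using fu by blast
  qed
qed

text \<open>Point evaluations are uniformly bounded, and finitely supported functions are dense.\<close>

lemma H1_vanishes_at_infinity:
  assumes v: "(v :: 'd lfun) \<in> H1" and e: "e > 0"
  shows "finite {x. e \<le> cmod (v x)}"
proof -
  let ?mu = "green_mu TYPE('d)"
  obtain \<phi> where \<phi>: "\<And>n. finitely_supported (\<phi> n)" "energy.tends \<phi> v"
    using H1_approximation[OF v] by metis
  have "e / ?mu > 0" using e green_mu_pos by simp
  from order_tendstoD(2)[OF \<phi>(2)[unfolded energy.tends_def] this]
  obtain n where n: "energy.nrm (\<phi> n - v) < e / ?mu" by (auto simp: eventually_sequentially)
  have "\<phi> n - v \<in> H1" using fvec.subspace_diff[OF H1_subspace finitely_supported_H1[OF \<phi>(1)] v] .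
  then have near: "cmod (\<phi> n x - v x) < e" for x
    using H1_pointwise_bound[of "\<phi> n - v" x] n green_mu_pos by (simp add: field_simps)
  have "\<phi> n x \<noteq> 0" if "e \<le> cmod (v x)" for x
    using near[of x] that by auto
  then have "{x. e \<le> cmod (v x)} \<subseteq> {x. \<phi> n x \<noteq> 0}" by blast
  then show ?thesis using \<phi>(1)[of n] unfolding finitely_supported_def by (rule finite_subset)
qed

end


section \<open>Selection of a sparse sequence of lattice points\<close>

text \<open>
  A Gram--Schmidt step: subtracting the projection \<open>p\<close> and normalising the result each move \<open>g\<close> by
  at most \<open>\<eta>\<close>.
\<close>

lemma (in hilbert) orthonormal_extension:
  assumes K: "finite K" "\<And>k. k \<in> K \<Longrightarrow> f k \<in> H"
    and on: "\<And>j k. j \<in> K \<Longrightarrow> k \<in> K \<Longrightarrow> ip (f j) (f k) = (if j = k then 1 else 0)"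
    and g: "g \<in> H" "nrm g = 1" and small: "(\<Sum>k\<in>K. cmod (ip g (f k))) \<le> \<eta>" and \<eta>: "\<eta> < 1"
  shows "\<exists>e\<in>H. nrm e = 1 \<and> (\<forall>k\<in>K. ip e (f k) = 0) \<and> nrm (e - g) \<le> 2 * \<eta>"
proof -
  define p where "p = (\<Sum>k\<in>K. ip g (f k) \<odot> f k)"
  define w where "w = g - p"
  have p: "p \<in> H" using K by (simp add: p_def)
  have w: "w \<in> H" using p g by (simp add: w_def)
  have f1: "nrm (f k) = 1" if "k \<in> K" for k using on[OF that that] by (simp add: nrm_def)
  have "nrm p \<le> (\<Sum>k\<in>K. nrm (ip g (f k) \<odot> f k))" unfolding p_def using K by (intro nrm_sum_le) auto
  also have "\<dots> = (\<Sum>k\<in>K. cmod (ip g (f k)))" using K f1 by (intro sum.cong) auto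
  finally have p\<eta>: "nrm p \<le> \<eta>" using small by linarith
  have gw: "nrm (g - w) = nrm p" by (simp add: w_def)
  have "1 \<le> nrm p + nrm w" using nrm_le_diff[OF g(1) w] g gw by simp
  moreover have "nrm w \<le> nrm p + 1"
    using nrm_le_diff[OF w g(1)] nrm_minus_commute[OF w g(1)] g gw by simp
  ultimately have w1: "\<bar>1 - nrm w\<bar> \<le> \<eta>" and wpos: "0 < nrm w" using p\<eta> \<eta> by linarith+
  define e where "e = of_real (1 / nrm w) \<odot> w"
  have e: "e \<in> H" using w by (simp add: e_def)
  have "e - w = of_real (1 / nrm w - 1) \<odot> w"
    by (simp add: e_def scale_left_diff_distrib)
  then have "nrm (e - w) = \<bar>1 / nrm w - 1\<bar> * nrm w" using w by (simp only: nrm_scale norm_of_real)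
  also have "\<dots> = \<bar>(1 / nrm w - 1) * nrm w\<bar>" using wpos by (simp add: abs_mult)
  also have "\<dots> = \<bar>1 - nrm w\<bar>" using wpos by (simp add: left_diff_distrib)
  finally have "nrm (e - g) \<le> 2 * \<eta>"
    using nrm_triangle_diff[OF e w g(1)] nrm_minus_commute[OF w g(1)] gw p\<eta> w1 by simp
  moreover have "nrm e = 1" using w wpos by (simp add: e_def norm_divide)
  moreover have "ip e (f k) = 0" if "k \<in> K" for k
  proof -
    have "ip p (f k) = ip g (f k)"
      unfolding p_def by (rule orthonormal_coefficient[OF K that on])
    then show ?thesis using K(2)[OF that] w p g by (simp add: e_def w_def)
  qed
  ultimately show ?thesis using e by blast
qed

lemma infinite_lattice: "infinite (UNIV :: (int ^ 'd::finite) set)"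
proof
  assume "finite (UNIV :: (int ^ 'd) set)"
  moreover have "inj (\<lambda>n :: int. (\<chi> j. n) :: int ^ 'd)" by (auto simp: inj_def vec_eq_iff)
  ultimately have "finite (UNIV :: int set)" using finite_imageD finite_subset subset_UNIV by metis
  then show False by simp
qed

context
  assumes d3: "CARD('d::finite) \<ge> 3"
begin

interpretation H1: hilbert fscale "H1 :: 'd lfun set" H1_inner
  by (rule H1_hilbert[OF d3])

lemma green_normalized_H1: "green_normalized y \<in> (H1 :: 'd lfun set)"
  unfolding green_normalized_def by (intro H1.H_closed green_H1[OF d3])

lemma inner_green_normalized:
  "(v :: 'd lfun) \<in> H1 \<Longrightarrow> H1_inner v (green_normalized y) = v y / of_real (green_mu TYPE('d))"
  unfolding green_normalized_def
  by (simp add: H1.ip_scale_right[OF _ green_H1[OF d3]] green_reproducing[OF d3])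

lemma green_normalized_nrm: "H1.nrm (green_normalized y :: 'd lfun) = 1"
proof -
  have "H1_inner (green_normalized y) (green_normalized y :: 'd lfun) = green_normalized y y / of_real (green_mu TYPE('d))"
    by (rule inner_green_normalized[OF green_normalized_H1])
  also have "\<dots> = 1"
    using green_mu_pos[OF d3] green_mu_sq[OF d3]
    by (simp add: green_normalized_def fscale_def green_def power2_eq_square flip: green_mu_sq[OF d3])
  finally show ?thesis by (simp add: H1.nrm_def)
qed

lemma H1_norm_eq: "(u :: 'd lfun) \<in> H1 \<Longrightarrow> H1_norm u = H1.nrm u"
  by (simp add: energy_nrm[OF H1_finite_energy])

lemma linear_map_H1: "H1.linear_map A \<longleftrightarrow> H1_linear (A :: 'd lfun \<Rightarrow> 'd lfun)"
  by (auto simp: H1.linear_map_def H1_linear_def)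

lemma compact_map_H1:
  assumes A: "H1.compact_map (A :: 'd lfun \<Rightarrow> 'd lfun)" and eq: "\<And>u. u \<in> H1 \<Longrightarrow> A' u = A u"
  shows "H1_compact A'"
  unfolding H1_compact_def
proof (intro conjI allI impI)
  have lin: "H1_linear A" using A by (simp add: H1.compact_map_def linear_map_H1)
  then show "H1_linear A'" using eq by (simp add: H1_linear_def)
  fix u :: "nat \<Rightarrow> 'd lfun"
  assume u: "(\<forall>n. u n \<in> H1) \<and> (\<exists>C. \<forall>n. H1_norm (u n) \<le> C)"
  then have "H1.nrm (u n) = H1_norm (u n)" for n by (simp add: H1_norm_eq)
  with u have "(\<forall>n. u n \<in> H1) \<and> (\<exists>C. \<forall>n. H1.nrm (u n) \<le> C)" by simp
  then obtain w r where w: "w \<in> H1" and r: "strict_mono (r :: nat \<Rightarrow> nat)" "H1.tends (\<lambda>n. A (u (r n))) w"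
    using A unfolding H1.compact_map_def by blast
  have "A (u (r n)) - w \<in> H1" for n using lin u w by (simp add: H1_linear_def)
  then have "(\<lambda>n. H1_norm (A' (u (r n)) - w)) \<longlonglongrightarrow> 0"
    using r(2) u by (simp add: H1.tends_def H1_norm_eq eq)
  with w r(1) show "\<exists>w\<in>H1. \<exists>r. strict_mono r \<and> (\<lambda>n. H1_norm (A' (u (r n)) - w)) \<longlonglongrightarrow> 0" by blast
qed

text \<open>
  The component of the normalised Green function of \<open>y\<close> along \<open>e j\<close> is, up to conjugation, \<open>e j y / \<mu>\<close>.  It is
  small for all but finitely many \<open>y\<close>, since \<open>e j\<close> vanishes at infinity.
\<close>

lemma nearly_orthonormal_selection:
  fixes \<delta> :: "nat \<Rightarrow> real"
  assumes \<delta>: "\<And>k. 0 < \<delta> k" "\<And>k. \<delta> k \<le> 1"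
  shows "\<exists>(y :: nat \<Rightarrow> int ^ 'd) e. inj y \<and> (\<forall>k. e k \<in> H1) \<and>
    (\<forall>j k. H1_inner (e j) (e k) = (if j = k then 1 else 0)) \<and>
    (\<forall>k. H1.nrm (e k - green_normalized (y k)) \<le> \<delta> k)"
proof -
  let ?mu = "green_mu TYPE('d)"
  define P where "P f k r \<longleftrightarrow> snd r \<in> H1 \<and> H1.nrm (snd r) = 1 \<and> (\<forall>j<k. H1_inner (snd r) (snd (f j)) = 0) \<and>
      H1.nrm (snd r - green_normalized (fst r)) \<le> \<delta> k \<and> (\<forall>j<k. fst r \<noteq> fst (f j))"
    for f :: "nat \<Rightarrow> (int ^ 'd) \<times> 'd lfun" and k r
  have on: "H1_inner (snd (f i)) (snd (f j)) = (if i = j then 1 else 0)"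
    if P: "\<And>i. i < n \<Longrightarrow> P f i (f i)" and ij: "i < n" "j < n" for f n i j
  proof (cases i j rule: linorder_cases)
    case less
    then have "H1_inner (snd (f j)) (snd (f i)) = 0" using P[OF ij(2)] by (simp add: P_def)
    then show ?thesis using less P[OF ij(1)] P[OF ij(2)] H1.ip_hermitian[of "snd (f j)" "snd (f i)"]
      by (simp add: P_def)
  next
    case equal
    then show ?thesis using P[OF ij(1)] H1.ip_self[of "snd (f i)"] by (simp add: P_def)
  next
    case greater
    then show ?thesis using P[OF ij(1)] by (simp add: P_def)
  qed
  have "\<exists>f. \<forall>k. P f k (f k)"
  proof (rule dependent_wellorder_choice)
    show "P f k r = P g k r" if "\<And>j. j < k \<Longrightarrow> f j = g j" for f g k r
      using that by (simp add: P_def)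
    show "\<exists>r. P f k r" if P: "\<And>j. j < k \<Longrightarrow> P f j (f j)" for f k
    proof -
      have fH: "snd (f j) \<in> H1" if "j < k" for j using P[OF that] by (simp add: P_def)
      \<comment> \<open>chosen such that \<open>k\<close> components below \<open>c / \<mu>\<close> add up to at most \<open>\<delta> k / 2\<close>\<close>
      define c where "c = ?mu * (\<delta> k / 2) / real (Suc k)"
      have c: "c > 0" using \<delta>(1)[of k] green_mu_pos[OF d3] by (simp add: c_def)
      have "finite ((\<Union>j<k. {x. c \<le> cmod (snd (f j) x)}) \<union> (\<lambda>j. fst (f j)) ` {..<k})"
        using H1_vanishes_at_infinity[OF d3 fH c] by auto
      from ex_new_if_finite[OF infinite_lattice this]
      obtain y where y: "\<And>j. j < k \<Longrightarrow> cmod (snd (f j) y) < c" "\<And>j. j < k \<Longrightarrow> y \<noteq> fst (f j)"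
        by (auto simp: not_le)
      let ?g = "green_normalized y :: 'd lfun"
      have "\<exists>e\<in>H1. H1.nrm e = 1 \<and> (\<forall>j\<in>{..<k}. H1_inner e (snd (f j)) = 0) \<and> H1.nrm (e - ?g) \<le> 2 * (\<delta> k / 2)"
      proof (rule H1.orthonormal_extension)
        show "(\<Sum>j<k. cmod (H1_inner ?g (snd (f j)))) \<le> \<delta> k / 2"
        proof -
          have "cmod (H1_inner ?g (snd (f j))) \<le> \<delta> k / 2 / real (Suc k)" if j: "j < k" for j
          proof -
            have "cmod (H1_inner ?g (snd (f j))) = cmod (snd (f j) y) / ?mu"
              using H1.ip_hermitian[OF fH[OF j] green_normalized_H1, of y] inner_green_normalized[OF fH[OF j], of y]
                green_mu_pos[OF d3] by (simp add: norm_divide)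
            also have "\<dots> \<le> c / ?mu"
              using y(1)[OF j] green_mu_pos[OF d3] by (intro divide_right_mono) auto
            also have "\<dots> = \<delta> k / 2 / real (Suc k)" using green_mu_pos[OF d3] by (simp add: c_def)
            finally show ?thesis .
          qed
          then have "(\<Sum>j<k. cmod (H1_inner ?g (snd (f j)))) \<le> (\<Sum>j<k. \<delta> k / 2 / real (Suc k))"
            by (intro sum_mono) auto
          also have "\<dots> = real k / real (Suc k) * (\<delta> k / 2)" by simp
          also have "\<dots> \<le> 1 * (\<delta> k / 2)" using \<delta>(1)[of k] by (intro mult_right_mono) auto
          finally show ?thesis by simp
        qed
        show "\<delta> k / 2 < 1" using \<delta>(2)[of k] by simp
        show "H1_inner (snd (f i)) (snd (f j)) = (if i = j then 1 else 0)" if "i \<in> {..<k}" "j \<in> {..<k}" for i j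
          using on[OF P, of k i j] that by simp
      qed (use fH green_normalized_H1 green_normalized_nrm in auto)
      then obtain e where "e \<in> H1" "H1.nrm e = 1" "\<And>j. j < k \<Longrightarrow> H1_inner e (snd (f j)) = 0" "H1.nrm (e - ?g) \<le> \<delta> k"
        by auto
      then have "P f k (y, e)" using y by (simp add: P_def)
      then show ?thesis ..
    qed
  qed
  then obtain f where f: "\<And>k. P f k (f k)" by blast
  show ?thesis
  proof (rule exI[of _ "\<lambda>k. fst (f k)"], rule exI[of _ "\<lambda>k. snd (f k)"], intro conjI allI)
    show "inj (\<lambda>k. fst (f k))"
    proof (rule linorder_injI)
      show "fst (f j) \<noteq> fst (f k)" if "j < k" for j k
        using f[of k] that unfolding P_def by metis
    qed
    show "H1_inner (snd (f j)) (snd (f k)) = (if j = k then 1 else 0)" for j k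
      using on[OF f, of j "Suc (max j k)" k] by simp
  qed (use f in \<open>auto simp: P_def\<close>)
qed

section \<open>The Birman--Schwinger operator of a sparse potential\<close>

lemma has_sum_supported_on_sequence:
  fixes y :: "nat \<Rightarrow> 'a" and g :: "'a \<Rightarrow> 'b::banach"
  assumes y: "inj y" and zero: "\<And>x. x \<notin> range y \<Longrightarrow> g x = 0"
    and sums: "(\<lambda>k. g (y k)) sums S" and abs: "summable (\<lambda>k. norm (g (y k)))"
  shows "(g has_sum S) UNIV"
proof -
  have "((\<lambda>k. g (y k)) has_sum S) UNIV" by (rule norm_summable_imp_has_sum[OF abs sums])
  then have "(g has_sum S) (range y)" using has_sum_reindex[OF y, of g S] by (simp add: o_def)
  then show ?thesis using has_sum_cong_neutral[of UNIV "range y" g g S] zero by auto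
qed

text \<open>
  The factor \<open>1 / \<mu>\<^sup>2\<close> in the potential compensates for \<open>\<langle>u, h k\<rangle> = u (y k) / \<mu>\<close>, so that the form of \<open>V\<close> is
  the form of the operator \<open>W.B\<close> with the weights \<open>p\<close>.
\<close>

lemma sparse_potential_with_spectrum:
  assumes p: "moderately_varying p"
  shows "\<exists>V :: int ^ 'd \<Rightarrow> real. sparse_potential V \<and> bs_form_bounded V \<and>
           H1_compact (birman_schwinger V) \<and>
           (\<exists>l. positive_eigenvalues (birman_schwinger V) l \<and> (\<lambda>j. l j / p j) \<longlonglongrightarrow> 1)"
proof -
  let ?mu = "green_mu TYPE('d)"
  have mu: "0 < ?mu" by (rule green_mu_pos[OF d3])
  have ppos: "0 < p k" for k using p by (simp add: moderately_varying_def)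
  define \<delta> :: "nat \<Rightarrow> real" where "\<delta> k = (1 / 2) ^ (k + 2)" for k
  have \<delta>: "0 < \<delta> k" "\<delta> k \<le> 1" for k
    unfolding \<delta>_def by (simp, rule power_le_one) auto
  have \<delta>sum: "\<delta> sums (1 / 2)"
  proof -
    have "\<delta> = (\<lambda>k. 1 / 4 * (1 / 2) ^ k)" by (simp add: fun_eq_iff \<delta>_def)
    then show ?thesis using sums_mult[OF geometric_sums[of "1 / 2 :: real"], of "1 / 4"] by simp
  qed
  obtain y e where y: "inj (y :: nat \<Rightarrow> int ^ 'd)" and e: "\<And>k. e k \<in> H1"
    "\<And>j k. H1_inner (e j) (e k) = (if j = k then 1 else 0)"
    and near: "\<And>k. H1.nrm (e k - green_normalized (y k)) \<le> \<delta> k"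
    using nearly_orthonormal_selection[of \<delta>, OF \<delta>] by (elim exE conjE) blast
  define h where "h k = (green_normalized (y k) :: 'd lfun)" for k
  have hH: "h k \<in> H1" for k unfolding h_def by (rule green_normalized_H1)
  have dev: "summable (\<lambda>k. H1.nrm (e k - h k))"
  proof (rule summable_comparison_test)
    show "\<exists>N. \<forall>n\<ge>N. norm (H1.nrm (e n - h n)) \<le> \<delta> n" using near e hH by (simp add: h_def)
  qed (rule sums_summable[OF \<delta>sum])
  interpret W: weighted_near_orthonormal fscale H1 H1_inner e h p
  proof
    show "(\<Sum>k. H1.nrm (e k - h k)) \<le> 1 / 2"
      using suminf_le[OF _ dev sums_summable[OF \<delta>sum]] near sums_unique[OF \<delta>sum] by (simp add: h_def)
  qed (use e hH dev p in \<open>auto simp: moderately_varying_def\<close>)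
  define V where "V x = (if x \<in> range y then p (inv y x) / ?mu\<^sup>2 else 0)" for x
  have Vy: "V (y k) = p k / ?mu\<^sup>2" for k using y by (simp add: V_def)
  have V0: "V x = 0" if "x \<notin> range y" for x using that by (simp add: V_def)
  have supp: "{x. V x > 0} = range y"
  proof (rule set_eqI)
    show "x \<in> {x. V x > 0} \<longleftrightarrow> x \<in> range y" for x
      using V0[of x] Vy ppos mu by (cases "x \<in> range y") auto
  qed
  have coef: "H1_inner u (h k) = u (y k) / of_real ?mu" if "u \<in> H1" for u k
    unfolding h_def by (rule inner_green_normalized[OF that])
  have form: "((\<lambda>x. V x * (cmod (u x))\<^sup>2) has_sum W.q u) UNIV" if u: "u \<in> H1" for u
  proof (rule has_sum_supported_on_sequence[OF y])
    have eq: "V (y k) * (cmod (u (y k)))\<^sup>2 = p k * (cmod (H1_inner u (h k)))\<^sup>2" for k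
      using mu by (simp add: Vy coef[OF u] norm_divide power_divide)
    show "(\<lambda>k. V (y k) * (cmod (u (y k)))\<^sup>2) sums W.q u" unfolding eq by (rule W.q_sums[OF u])
    then show "summable (\<lambda>k. norm (V (y k) * (cmod (u (y k)))\<^sup>2))"
      unfolding eq using ppos by (simp add: sums_summable abs_mult less_imp_le)
  qed (simp add: V0)
  have sesq: "H1_inner (W.B u) v = bs_sesquilinear_form V u v" if u: "u \<in> H1" and v: "v \<in> H1" for u v
  proof -
    have "((\<lambda>x. of_real (V x) * u x * cnj (v x)) has_sum H1_inner (W.B u) v) UNIV"
    proof (rule has_sum_supported_on_sequence[OF y])
      have eq: "of_real (V (y k)) * u (y k) * cnj (v (y k)) = of_real (p k) * H1_inner u (h k) * H1_inner (h k) v" for k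
        using mu coef[OF u, of k] coef[OF v, of k] H1.ip_hermitian[OF v hH, of k]
        by (simp add: Vy power2_eq_square)
      show "(\<lambda>k. of_real (V (y k)) * u (y k) * cnj (v (y k))) sums H1_inner (W.B u) v"
        unfolding eq by (rule W.B_ip[OF u v])
      show "summable (\<lambda>k. norm (of_real (V (y k)) * u (y k) * cnj (v (y k))))"
      proof (rule summable_comparison_test)
        let ?F = "\<lambda>u k. p k * (cmod (H1_inner u (h k)))\<^sup>2"
        show "summable (\<lambda>k. ?F u k + ?F v k)"
          using W.q_sums[OF u] W.q_sums[OF v] by (intro summable_add sums_summable)
        have "norm (of_real (V (y k)) * u (y k) * cnj (v (y k))) \<le> ?F u k + ?F v k" for k
        proof -
          have ab: "a * b \<le> a\<^sup>2 + b\<^sup>2" for a b :: real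
            using zero_le_power2[of "a - b"] zero_le_power2[of a] zero_le_power2[of b]
            unfolding power2_diff by linarith
          have "norm (of_real (V (y k)) * u (y k) * cnj (v (y k)))
              = p k * (cmod (H1_inner u (h k)) * cmod (H1_inner v (h k)))"
            unfolding eq using H1.ip_hermitian[OF v hH, of k] ppos[of k] by (simp add: norm_mult)
          also have "\<dots> \<le> p k * ((cmod (H1_inner u (h k)))\<^sup>2 + (cmod (H1_inner v (h k)))\<^sup>2)"
            using ppos[of k] by (intro mult_left_mono ab) simp
          finally show ?thesis by (simp add: distrib_left)
        qed
        then show "\<exists>N. \<forall>k\<ge>N. norm (norm (of_real (V (y k)) * u (y k) * cnj (v (y k)))) \<le> ?F u k + ?F v k" by simp
      qed
    qed (simp add: V0)
    then show ?thesis by (simp add: bs_sesquilinear_form_def infsumI)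
  qed
  have bs: "birman_schwinger V u = W.B u" if u: "u \<in> H1" for u
    unfolding birman_schwinger_def
  proof (rule the_equality)
    show "W.B u \<in> H1 \<and> (\<forall>v\<in>H1. H1_inner (W.B u) v = bs_sesquilinear_form V u v)"
      using sesq[OF u] u by simp
    fix w assume w: "w \<in> H1 \<and> (\<forall>v\<in>H1. H1_inner w v = bs_sesquilinear_form V u v)"
    have d: "w - W.B u \<in> H1" using w u by simp
    have "H1_inner (w - W.B u) (w - W.B u) = H1_inner w (w - W.B u) - H1_inner (W.B u) (w - W.B u)"
      using w u d by (intro H1.ip_diff_left) auto
    also have "\<dots> = 0" using w d sesq[OF u d] by simp
    finally show "w = W.B u" using H1.definite[OF d] by simp
  qed
  have "sparse_potential V"
    unfolding sparse_potential_def
  proof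
    show "\<forall>x. V x \<ge> 0" using ppos by (simp add: V_def less_imp_le)
    obtain T S C where T: "H1.compact_map T" and S: "H1.linear_map S"
      and bound: "\<forall>u\<in>H1. H1.nrm (S u) \<le> C * H1.nrm u"
      and inv: "\<forall>u\<in>H1. S (u - T u) = u \<and> S u - T (S u) = u" and Sh: "\<forall>k. S (h k) = e k"
      using W.orthonormalising_operator by blast
    show "sparse {x. V x > 0}"
      unfolding sparse_def supp
    proof (intro exI conjI)
      show "H1_compact T" by (rule compact_map_H1[OF T]) simp
      show "H1_bounded S"
        unfolding H1_bounded_def
      proof (intro conjI exI[of _ C] ballI)
        show "H1_linear S" using S by (simp add: linear_map_H1)
        show "H1_norm (S u) \<le> C * H1_norm u" if "u \<in> H1" for u
          using bound that H1.linear_mapD(1)[OF S that] by (simp add: H1_norm_eq)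
      qed
      show "H1_inverse_of (\<lambda>u. u - T u) S"
        unfolding H1_inverse_of_def using inv S T
        by (auto simp: H1.compact_map_def H1.linear_map_def)
      show "\<forall>x\<in>range y. \<forall>x'\<in>range y. H1_inner (S (green_normalized x)) (S (green_normalized x')) = (if x = x' then 1 else 0)"
        using Sh e(2) y by (auto simp: h_def inj_eq)
    qed
  qed
  moreover have "bs_form_bounded V"
    unfolding bs_form_bounded_def
  proof (intro exI[of _ "4 * p 0"] ballI conjI)
    fix u :: "'d lfun" assume u: "u \<in> H1"
    show "(\<lambda>x. V x * (cmod (u x))\<^sup>2) summable_on UNIV" by (rule has_sum_imp_summable[OF form[OF u]])
    have "bs_quadratic_form V u = W.q u" unfolding bs_quadratic_form_def by (rule infsumI[OF form[OF u]])
    then show "\<bar>bs_quadratic_form V u\<bar> \<le> 4 * p 0 * (H1_norm u)\<^sup>2"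
      using W.positive[OF u] W.form_bound[OF u] by (simp add: W.q_def H1_norm_eq[OF u])
  qed
  moreover have "H1_compact (birman_schwinger V)" by (rule compact_map_H1[OF W.B_compact bs])
  moreover have "\<exists>l. positive_eigenvalues (birman_schwinger V) l \<and> (\<lambda>j. l j / p j) \<longlonglongrightarrow> 1"
  proof -
    have "H1_eigenspace (birman_schwinger V) t = {u \<in> H1. W.B u = fscale t u}" for t
      unfolding H1_eigenspace_def using bs by auto
    then show ?thesis
      using W.spectral_asymptotics p unfolding moderately_varying_def positive_eigenvalues_def by auto
  qed
  ultimately show ?thesis by blast
qed

end

theorem corollary6p7:
  fixes p :: "nat \<Rightarrow> real"
  assumes "CARD('d::finite) \<ge> 3"
    and "moderately_varying p"
  shows "\<exists>V :: int ^ 'd \<Rightarrow> real.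
           sparse_potential V \<and>
           bs_form_bounded V \<and>
           H1_compact (birman_schwinger V) \<and>
           (\<exists>l. positive_eigenvalues (birman_schwinger V) l \<and>
                (\<lambda>j. l j / p j) \<longlonglongrightarrow> 1)"
  by (rule sparse_potential_with_spectrum[OF assms])


end
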